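(* Let $G=(V,E)$ be a connected, locally finite, infinite graph that is vertex-transitive, amenable and transient. For $u>0$, let $\mathcal I^u\subseteq V$ be the random interlacement at level $u$ on $G$, and let $\mathcal V^u=V\setminus\mathcal I^u$ be its vacant set. Then for any $u>0$, the number of infinite connected components of $\mathcal V^u$ is either almost surely equal to $0$ or almost surely equal to $1$.
   Context: A graph $G=(V,E)$ is vertex-transitive if for any $x,y\in V$ there is a graph automorphism of $G$ mapping $x$ to $y$. For $A\subseteq V$, the (inner) vertex boundary is $\partial A=\{x\in A: (x,y)\in E\text{ for some }y\notin A\}$. $G$ is amenable if $\kappa_V(G)=\inf\{|\partial A|/|A| : A\subset V,\ 0<|A|<\infty\}$ equals $0$. $G$ is transient if the simple random walk on $G$ is transient. Let $\mathsf P_x$ denote the law of the simple random walk $(X_n)_{n\ge 0}$ on $G$ started at $x$. For finite $K\subset V$, the equilibrium measure of $K$ is $e_K(x)=\mathsf P_x[X_n\notin K\text{ for all }n\ge 1]$ for $x\in K$ (and $e_K(x)=0$ for $x\notin K$), and the capacity of $K$ is $\mathrm{cap}(K)=\sum_{x\in K}e_K(x)$. The random interlacement at level $u>0$ is a random subset $\mathcal I^u$ of $V$, defined on a probability space with measure $\mathbb P$, whose law on the set of all subsets of $V$, equipped with the $\sigma$-algebra generated by the events $\{F\subseteq V: F\cap K=\emptyset\}$ with $K\subset V$ finite, is uniquely characterized by $$\mathbb P[\mathcal I^u\cap K=\emptyset]=e^{-u\,\mathrm{cap}(K)}\quad\text{for every finite }K\subset V.$$ Connected components of a subset of $V$ are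 those of the subgraph of $G$ induced by it. *)

theory Defs
  imports "HOL-Probability.Probability" "HOL-Library.Extended_Nat"
begin

section \<open>Graphs\<close>

text \<open>
  A graph is a vertex set \<open>V\<close> together with a symmetric irreflexive adjacency relation \<open>E\<close> on \<open>V\<close>;
  an undirected edge is represented by its two orientations.
\<close>

definition graph :: "'v set \<Rightarrow> ('v \<times> 'v) set \<Rightarrow> bool" where
  "graph V E \<longleftrightarrow> E \<subseteq> V \<times> V \<and> sym E \<and> irrefl E"

definition connected_graph :: "'v set \<Rightarrow> ('v \<times> 'v) set \<Rightarrow> bool" where
  "connected_graph V E \<longleftrightarrow> V \<noteq> {} \<and> (\<forall>x\<in>V. \<forall>y\<in>V. (x, y) \<in> E\<^sup>*)"

definition locally_finite :: "'v set \<Rightarrow> ('v \<times> 'v) set \<Rightarrow> bool" where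
  "locally_finite V E \<longleftrightarrow> (\<forall>x\<in>V. finite (E `` {x}))"

definition automorphism :: "'v set \<Rightarrow> ('v \<times> 'v) set \<Rightarrow> ('v \<Rightarrow> 'v) \<Rightarrow> bool" where
  "automorphism V E f \<longleftrightarrow>
    bij_betw f V V \<and> (\<forall>x\<in>V. \<forall>y\<in>V. (f x, f y) \<in> E \<longleftrightarrow> (x, y) \<in> E)"

definition vertex_transitive :: "'v set \<Rightarrow> ('v \<times> 'v) set \<Rightarrow> bool" where
  "vertex_transitive V E \<longleftrightarrow> (\<forall>x\<in>V. \<forall>y\<in>V. \<exists>f. automorphism V E f \<and> f x = y)"

definition vertex_boundary :: "'v set \<Rightarrow> ('v \<times> 'v) set \<Rightarrow> 'v set \<Rightarrow> 'v set" where
  "vertex_boundary V E A = {x \<in> A. \<exists>y\<in>V - A. (x, y) \<in> E}"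

definition vertex_isoperimetric_const :: "'v set \<Rightarrow> ('v \<times> 'v) set \<Rightarrow> real" where
  "vertex_isoperimetric_const V E =
    (INF A\<in>{A. A \<subseteq> V \<and> finite A \<and> A \<noteq> {}}. real (card (vertex_boundary V E A)) / real (card A))"

definition amenable :: "'v set \<Rightarrow> ('v \<times> 'v) set \<Rightarrow> bool" where
  "amenable V E \<longleftrightarrow> vertex_isoperimetric_const V E = 0"

text \<open>The vertex sets of the connected components of the subgraph induced by \<open>W\<close>; the equivalence
  classes of points of \<open>W\<close> stay inside \<open>W\<close>.\<close>

definition components_of :: "('v \<times> 'v) set \<Rightarrow> 'v set \<Rightarrow> 'v set set" where
  "components_of E W = W // (Restr E W)\<^sup>*"

definition num_infinite_components :: "('v \<times> 'v) set \<Rightarrow> 'v set \<Rightarrow> enat" where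
  "num_infinite_components E W =
    (let S = {C \<in> components_of E W. infinite C} in if finite S then enat (card S) else \<infinity>)"


section \<open>Simple random walk\<close>

text \<open>
  The conditional law of the \<open>i\<close>-th position given the earlier positions.  The law on trajectories
  is then provided by the Ionescu-Tulcea theorem.  The kernel is a probability measure for every
  relation \<open>E\<close>, but it is only meaningful when all neighbourhoods are finite and nonempty.
\<close>

definition srw_kernel :: "('v \<times> 'v) set \<Rightarrow> 'v \<Rightarrow> nat \<Rightarrow> (nat \<Rightarrow> 'v) \<Rightarrow> 'v measure" where
  "srw_kernel E x i \<omega> =
    (case i of 0 \<Rightarrow> return (count_space UNIV) x
             | Suc n \<Rightarrow> measure_pmf (pmf_of_set (E `` {\<omega> n})))"

global_interpretation srw: Ionescu_Tulcea "srw_kernel E x" "\<lambda>_. count_space UNIV"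
  for E :: "('v \<times> 'v) set" and x :: 'v
proof (rule Ionescu_Tulcea.intro)
  fix i :: nat
  show "srw_kernel E x i \<in>
      (\<Pi>\<^sub>M j\<in>{0..<i}. count_space UNIV) \<rightarrow>\<^sub>M subprob_algebra (count_space UNIV)"
  proof (cases i)
    case 0
    then show ?thesis
      by (simp add: srw_kernel_def[abs_def] space_subprob_algebra subprob_space_return)
  next
    case (Suc n)
    have "(\<lambda>\<omega>. \<omega> n) \<in> (\<Pi>\<^sub>M j\<in>{0..<i}. count_space UNIV) \<rightarrow>\<^sub>M (count_space UNIV :: 'v measure)"
      using Suc by (intro measurable_component_singleton) auto
    moreover have "(\<lambda>y. measure_pmf (pmf_of_set (E `` {y})))
        \<in> count_space UNIV \<rightarrow>\<^sub>M subprob_algebra (count_space UNIV)"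
      by (simp add: measure_pmf_in_subprob_algebra)
    ultimately show ?thesis
      unfolding srw_kernel_def[abs_def] Suc by (auto intro: measurable_compose)
  qed
next
  fix i and \<omega> :: "nat \<Rightarrow> 'v"
  assume "\<omega> \<in> space (\<Pi>\<^sub>M j\<in>{0..<i}. count_space UNIV)"
  show "prob_space (srw_kernel E x i \<omega>)"
    by (auto simp: srw_kernel_def prob_space_return prob_space_measure_pmf split: nat.split)
qed

definition srw_law :: "('v \<times> 'v) set \<Rightarrow> 'v \<Rightarrow> (nat \<Rightarrow> 'v) measure" where
  "srw_law E x = srw.PF.lim E x"

lemma sets_srw_law [measurable_cong]: "sets (srw_law E x) = sets (\<Pi>\<^sub>M i\<in>UNIV. count_space UNIV)"
  by (simp add: srw_law_def)

lemma space_srw_law [simp]: "space (srw_law E x) = UNIV"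
  by (simp add: srw_law_def space_PiM)

lemma srw_law_cylinder:
  "emeasure (srw_law E x) {\<omega>. \<forall>i\<le>n. \<omega> i = a i} =
    (if a 0 = x then \<Prod>i<n. ennreal (pmf (pmf_of_set (E `` {a i})) (a (Suc i))) else 0)"
proof -
  let ?M = "\<lambda>_::nat. count_space UNIV :: 'a measure"
  let ?u = "\<lambda>_::nat. undefined :: 'a"
  define S where "S n = {\<omega> \<in> extensional {0..<n}. \<forall>i<n. \<omega> i = a i}" for n
  have "S n = PiE {0..<n} (\<lambda>i. {a i})" for n
    unfolding S_def set_eq_iff PiE_iff by auto
  moreover have "PiE {0..<n} (\<lambda>i. {a i}) \<in> sets (PiM {0..<n} ?M)" for n
    by (rule sets_PiM_I_finite) simp_all
  ultimately have S: "S n \<in> sets (PiM {0..<n} ?M)" for n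
    by metis
  have sp: "space (PiM {0..<n} ?M) = extensional {0..<n}" for n
    by (simp add: space_PiM PiE_def)
  have u: "?u \<in> space (PiM {0..<0} ?M)"
    unfolding sp by (simp add: extensional_def)
  have upd: "fun_upd \<omega> n -` S (Suc n) \<inter> UNIV = (if \<omega> \<in> S n then {a n} else {})"
    if "\<omega> \<in> extensional {0..<n}" for \<omega> n
    using that unfolding S_def by (auto simp: extensional_def less_Suc_eq)
  have eP: "emeasure (srw.eP E x n \<omega>) (S (Suc n)) =
      emeasure (srw_kernel E x n \<omega>) {a n} * indicator (S n) \<omega>"
    if "\<omega> \<in> space (PiM {0..<n} ?M)" for \<omega> n
    using that srw.emeasure_eP[OF that S[of "Suc n"], of E x] upd[of \<omega> n]
    by (simp only: sp space_count_space) (simp add: indicator_def)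
  have C: "emeasure (srw.C E x 0 (Suc n) ?u) (S (Suc n)) =
      (if a 0 = x then \<Prod>i<n. ennreal (pmf (pmf_of_set (E `` {a i})) (a (Suc i))) else 0)" for n
  proof (induction n)
    case 0
    have "srw.C E x 0 (Suc 0) ?u = srw.eP E x 0 ?u"
      unfolding srw.C.simps add_0 by (rule bind_return[OF srw.measurable_eP u])
    then have "emeasure (srw.C E x 0 (Suc 0) ?u) (S (Suc 0)) =
        emeasure (srw_kernel E x 0 ?u) {a 0} * indicator (S 0) ?u"
      using eP[OF u] by (simp only:)
    also have "\<dots> = (if a 0 = x then \<Prod>i<0. ennreal (pmf (pmf_of_set (E `` {a i})) (a (Suc i))) else 0)"
      by (simp add: srw_kernel_def S_def extensional_def split: split_indicator)
    finally show ?case .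
  next
    case (Suc n)
    let ?C = "srw.C E x 0 (Suc n) ?u"
    have sets_C: "sets ?C = sets (PiM {0..<Suc n} ?M)"
      using srw.sets_C[OF u, of E x "Suc n"] by (simp only: add_0)
    then have space_C: "space ?C = space (PiM {0..<Suc n} ?M)"
      by (rule sets_eq_imp_space_eq)
    have ne: "space ?C \<noteq> {}"
      unfolding space_C sp by (auto simp: extensional_def)
    have "emeasure (srw.C E x 0 (Suc (Suc n)) ?u) (S (Suc (Suc n))) =
        (\<integral>\<^sup>+\<omega>. emeasure (srw.eP E x (Suc n) \<omega>) (S (Suc (Suc n))) \<partial>?C)"
      unfolding srw.C.simps(2)[of E x 0 "Suc n"] add_0
      using srw.measurable_eP[of E x "Suc n"]
      by (intro emeasure_bind[OF ne _ S]) (simp only: measurable_cong_sets[OF sets_C refl])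
    also have "\<dots> = (\<integral>\<^sup>+\<omega>. ennreal (pmf (pmf_of_set (E `` {a n})) (a (Suc n))) *
        indicator (S (Suc n)) \<omega> \<partial>?C)"
    proof (rule nn_integral_cong)
      fix \<omega> assume "\<omega> \<in> space ?C"
      then show "emeasure (srw.eP E x (Suc n) \<omega>) (S (Suc (Suc n))) =
          ennreal (pmf (pmf_of_set (E `` {a n})) (a (Suc n))) * indicator (S (Suc n)) \<omega>"
        unfolding space_C
        by (subst eP) (auto simp: srw_kernel_def emeasure_pmf_single S_def split: split_indicator)
    qed
    also have "\<dots> = ennreal (pmf (pmf_of_set (E `` {a n})) (a (Suc n))) * emeasure ?C (S (Suc n))"
      by (intro nn_integral_cmult_indicator) (simp only: sets_C S)
    also note Suc
    finally show ?case
      by (simp add: mult.commute)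
  qed
  have emb: "{\<omega>. \<forall>i\<le>n. \<omega> i = a i} = prod_emb UNIV ?M {0..<Suc n} (S (Suc n))"
    by (auto simp: prod_emb_def space_PiM S_def less_Suc_eq_le)
  have "emeasure (srw_law E x) {\<omega>. \<forall>i\<le>n. \<omega> i = a i} =
      emeasure (srw.CI E x {0..<Suc n}) (S (Suc n))"
    unfolding srw_law_def emb by (rule srw.lim[OF finite_atLeastLessThan S])
  also have "\<dots> = emeasure (srw.C E x 0 (Suc n) ?u) (prod_emb {0..<Suc n} ?M {0..<Suc n} (S (Suc n)))"
    by (rule srw.emeasure_CI[OF subset_refl S])
  also have "prod_emb {0..<Suc n} ?M {0..<Suc n} (S (Suc n)) = S (Suc n)"
    using sets.sets_into_space[OF S[of "Suc n"]] by (intro prod_emb_id) (simp only: space_PiM)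
  also note C
  finally show ?thesis .
qed

definition transient_graph :: "'v set \<Rightarrow> ('v \<times> 'v) set \<Rightarrow> bool" where
  "transient_graph V E \<longleftrightarrow> (\<forall>x\<in>V. measure (srw_law E x) {X. \<exists>n\<ge>1. X n = x} < 1)"

definition equilibrium_measure :: "('v \<times> 'v) set \<Rightarrow> 'v set \<Rightarrow> 'v \<Rightarrow> real" where
  "equilibrium_measure E K x =
    (if x \<in> K then measure (srw_law E x) {X. \<forall>n\<ge>1. X n \<notin> K} else 0)"

definition capacity :: "('v \<times> 'v) set \<Rightarrow> 'v set \<Rightarrow> real" where
  "capacity E K = (\<Sum>x\<in>K. equilibrium_measure E K x)"


section \<open>Random interlacements\<close>

definition configuration_space :: "'v set \<Rightarrow> 'v set measure" where
  "configuration_space V =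
    sigma (Pow V) {{F. F \<subseteq> V \<and> F \<inter> K = {}} | K. K \<subseteq> V \<and> finite K}"

text \<open>The parameter \<open>I\<close> is the random set, a random variable on \<open>M\<close>.\<close>

definition random_interlacement ::
    "'v set \<Rightarrow> ('v \<times> 'v) set \<Rightarrow> real \<Rightarrow> 'w measure \<Rightarrow> ('w \<Rightarrow> 'v set) \<Rightarrow> bool" where
  "random_interlacement V E u M I \<longleftrightarrow>
    prob_space M \<and> I \<in> M \<rightarrow>\<^sub>M configuration_space V \<and>
    (\<forall>K. K \<subseteq> V \<and> finite K \<longrightarrow>
      measure M {\<omega> \<in> space M. I \<omega> \<inter> K = {}} = exp (- u * capacity E K))"

end

theory Submission
  imports Defs
begin

text \<open>
  Deleting from the interlacement all trajectories through a vertex \<open>x\<close> leaves the interlacement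
  conditioned to avoid \<open>x\<close>; the deleted ones are a Poisson number of independent pairs of walks
  from \<open>x\<close>, one of them conditioned not to return to \<open>x\<close>.  By this decomposition a null event for
  the interlacement remains null when points adjacent to it are added (a walk makes a detour), and
  when two walks from a common vertex are added.

  Since Green's function vanishes at infinity, infinite sets have infinite capacity, so a walk meets
  the interlacement infinitely often, and the interlacement is mixing, hence ergodic.  The Burton--Keane
  argument with coarse trifurcations, using insertion, shows that the interlacement is connected.
  Therefore a trajectory through \<open>x\<close> can be rerouted through the rest of the interlacement, so the
  vacant set can be enlarged by finite connected sets without leaving the support of its law.
  Joining vacant clusters in this way and applying Burton--Keane to the vacant set
  excludes two or more infinite clusters.
\<close>

section \<open>Vertex-transitive graphs\<close>

text \<open>The law is given only by avoidance probabilities; trajectories are not part of the data.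
  They are recovered from capacities: \<open>capacity E {x}\<close> times the probability that the
  trajectory through \<open>x\<close> misses \<open>K\<close> is
  \<open>capacity E (insert x K) - capacity E K\<close>, and its exponential is the generating
  function of a Poisson number. The obstacle is the lack of finite energy: every cluster of the
  interlacement is infinite, so single vertices cannot be added or removed at will, and vacating a
  vertex takes a rerouting of unbounded extent. Modifications are therefore stated qualitatively: an
  almost sure property survives the change, with an existential quantifier over the finite set that
  is changed. As there are only countably many finite sets, this suffices, but trifurcations have to
  be finite connected sets instead of vertices: one such set would have positive probability, and so
  would its translates. Amenability enters twice, for the interlacement, since rerouting uses its
  connectedness, and for the vacant set.\<close>

locale vt_graph =
  fixes V :: "'v set" and E :: "('v \<times> 'v) set"
  assumes graph: "graph V E" and connected: "connected_graph V E"
    and locally_finite: "locally_finite V E" and infinite_V: "infinite V"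
    and vertex_transitive: "vertex_transitive V E"
begin

lemma E_subset: "E \<subseteq> V \<times> V" and sym_E: "sym E" and irrefl_E: "irrefl E"
  using graph by (auto simp: graph_def)

lemma E_in_V: "(x, y) \<in> E \<Longrightarrow> x \<in> V" "(x, y) \<in> E \<Longrightarrow> y \<in> V"
  using E_subset by auto

lemma E_sym: "(x, y) \<in> E \<Longrightarrow> (y, x) \<in> E"
  using sym_E by (auto dest: symD)

lemma reachable: "x \<in> V \<Longrightarrow> y \<in> V \<Longrightarrow> (x, y) \<in> E\<^sup>*"
  using connected by (auto simp: connected_graph_def)

lemma V_nonempty: "V \<noteq> {}"
  using infinite_V by auto

lemma finite_nbs [simp, intro]: "finite (E `` {x})"
proof (cases "x \<in> V")
  case True
  then show ?thesis using locally_finite by (auto simp: locally_finite_def)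
next
  case False
  then have "E `` {x} = {}" using E_subset by auto
  then show ?thesis by simp
qed

lemma nbs_nonempty: "x \<in> V \<Longrightarrow> E `` {x} \<noteq> {}"
proof
  assume x: "x \<in> V" "E `` {x} = {}"
  have "\<exists>y. y \<in> V - {x}"
    using infinite_V by (metis equals0I finite.emptyI finite_Diff2 finite_insert)
  then obtain y where "y \<in> V" "y \<noteq> x"
    by auto
  with x reachable[of x y] show False
    by (metis Image_singleton_iff converse_rtranclE empty_iff)
qed

section \<open>Balls of the graph metric\<close>

definition gball :: "nat \<Rightarrow> 'v \<Rightarrow> 'v set" where
  "gball n x = {y. \<exists>k\<le>n. (x, y) \<in> E ^^ k}"

lemma relpow_sym: "(x, y) \<in> E ^^ n \<Longrightarrow> (y, x) \<in> E ^^ n"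
proof (induction n arbitrary: y)
  case (Suc n)
  then obtain z where "(x, z) \<in> E ^^ n" "(z, y) \<in> E" by auto
  with Suc.IH[of z] E_sym have "(z, x) \<in> E ^^ n" "(y, z) \<in> E" by auto
  then show ?case by (rule relpow_Suc_I2[rotated])
qed auto

lemma gball_0 [simp]: "gball 0 x = {x}"
  by (auto simp: gball_def)

lemma gball_self [simp]: "x \<in> gball n x"
  by (auto simp: gball_def intro: exI[of _ 0])

lemma gball_Suc: "gball (Suc n) x = gball n x \<union> E `` gball n x"
proof (intro equalityI subsetI)
  fix y assume "y \<in> gball (Suc n) x"
  then obtain k where k: "k \<le> Suc n" "(x, y) \<in> E ^^ k" by (auto simp: gball_def)
  show "y \<in> gball n x \<union> E `` gball n x"
  proof (cases k)
    case (Suc l)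
    then obtain z where "(x, z) \<in> E ^^ l" "(z, y) \<in> E" using k by auto
    then show ?thesis using k Suc by (auto simp: gball_def)
  qed (use k in \<open>auto simp: gball_def\<close>)
next
  fix y assume "y \<in> gball n x \<union> E `` gball n x"
  then show "y \<in> gball (Suc n) x"
  proof
    assume "y \<in> E `` gball n x"
    then obtain z k where "k \<le> n" "(x, z) \<in> E ^^ k" "(z, y) \<in> E" by (auto simp: gball_def)
    then show ?thesis by (auto simp: gball_def intro!: exI[of _ "Suc k"])
  qed (auto simp: gball_def intro: le_SucI)
qed

lemma gball_sym: "y \<in> gball n x \<longleftrightarrow> x \<in> gball n y"
  by (auto simp: gball_def dest: relpow_sym)

lemma gball_mono: "m \<le> n \<Longrightarrow> gball m x \<subseteq> gball n x"
  by (auto simp: gball_def intro: order_trans)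

lemma gball_trans: "y \<in> gball m x \<Longrightarrow> z \<in> gball n y \<Longrightarrow> z \<in> gball (m + n) x"
proof -
  assume "y \<in> gball m x" "z \<in> gball n y"
  then obtain k l where "k \<le> m" "(x, y) \<in> E ^^ k" "l \<le> n" "(y, z) \<in> E ^^ l"
    by (auto simp: gball_def)
  then have "(x, z) \<in> E ^^ (k + l)" by (auto simp: relpow_add)
  with \<open>k \<le> m\<close> \<open>l \<le> n\<close> show ?thesis by (auto simp: gball_def intro!: exI[of _ "k + l"])
qed

lemma gball_subset_V: "x \<in> V \<Longrightarrow> gball n x \<subseteq> V"
  by (induction n) (use E_subset in \<open>auto simp: gball_Suc\<close>)

lemma finite_gball [simp, intro]: "finite (gball n x)"
proof (induction n)
  case (Suc n)
  have "E `` gball n x = (\<Union>y\<in>gball n x. E `` {y})" by auto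
  then show ?case using Suc finite_nbs by (simp add: gball_Suc)
qed auto

lemma V_eq_Union_gball: "x \<in> V \<Longrightarrow> V = (\<Union>n. gball n x)"
proof (intro equalityI subsetI)
  fix y assume "x \<in> V" "y \<in> V"
  then show "y \<in> (\<Union>n. gball n x)"
    using reachable[of x y] by (auto simp: rtrancl_power gball_def)
qed (use gball_subset_V in auto)

lemma countable_V: "countable V"
proof -
  obtain x where "x \<in> V" using V_nonempty by auto
  then show ?thesis
    by (subst V_eq_Union_gball[of x]) (auto intro: uncountable_infinite countable_finite)
qed

lemma finite_subset_gball:
  assumes "x \<in> V" "finite A" "A \<subseteq> V"
  shows "\<exists>n. A \<subseteq> gball n x"
  using assms(2,3)
proof (induction A rule: finite_induct)
  case (insert a A)
  then obtain m n where "A \<subseteq> gball m x" "a \<in> gball n x"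
    using V_eq_Union_gball[OF \<open>x \<in> V\<close>] by auto
  then have "insert a A \<subseteq> gball (max m n) x"
    using gball_mono[of m "max m n" x] gball_mono[of n "max m n" x] by auto
  then show ?case by blast
qed auto

text \<open>An automorphism is extended by the identity outside \<open>V\<close>, which makes it a bijection of the
  whole type.\<close>

definition aut :: "('v \<Rightarrow> 'v) \<Rightarrow> bool" where
  "aut f \<longleftrightarrow> bij f \<and> (\<forall>x y. (f x, f y) \<in> E \<longleftrightarrow> (x, y) \<in> E) \<and> (\<forall>x. f x \<in> V \<longleftrightarrow> x \<in> V)"

lemma ex_aut:
  assumes "x \<in> V" "y \<in> V"
  obtains f where "aut f" "f x = y"
proof -
  obtain g where g: "automorphism V E g" "g x = y"
    using vertex_transitive assms unfolding vertex_transitive_def by blast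
  define f where "f z = (if z \<in> V then g z else z)" for z
  have bij: "bij_betw g V V" using g by (auto simp: automorphism_def)
  have "bij_betw f V V" using bij by (auto simp: f_def cong: bij_betw_cong)
  moreover have "bij_betw f (- V) (- V)" by (auto simp: f_def bij_betw_def inj_on_def)
  ultimately have "bij_betw f (V \<union> - V) (V \<union> - V)" by (rule bij_betw_combine) auto
  moreover have "f z \<in> V \<longleftrightarrow> z \<in> V" for z
    using bij by (auto simp: f_def dest: bij_betwE)
  moreover have "(f z, f w) \<in> E \<longleftrightarrow> (z, w) \<in> E" for z w
    using g(1) calculation(2)[of z] calculation(2)[of w] E_in_V[of z w] E_in_V[of "f z" "f w"]
    by (cases "z \<in> V \<and> w \<in> V") (auto simp: automorphism_def f_def)
  ultimately have "aut f" by (auto simp: aut_def)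
  moreover have "f x = y" using assms g by (simp add: f_def)
  ultimately show ?thesis by (rule that)
qed

lemma aut_bij: "aut f \<Longrightarrow> bij f" and aut_inj: "aut f \<Longrightarrow> inj f" and aut_surj: "aut f \<Longrightarrow> surj f"
  by (auto simp: aut_def bij_def)

lemma aut_E_iff: "aut f \<Longrightarrow> (f x, f y) \<in> E \<longleftrightarrow> (x, y) \<in> E"
  by (auto simp: aut_def)

lemma aut_V_iff: "aut f \<Longrightarrow> f x \<in> V \<longleftrightarrow> x \<in> V"
  by (auto simp: aut_def)

lemma aut_image_V: "aut f \<Longrightarrow> f ` V = V"
proof (intro equalityI subsetI)
  fix y assume f: "aut f" "y \<in> V"
  obtain x where "y = f x" using surjD[OF aut_surj[OF f(1)]] by blast
  then show "y \<in> f ` V" using f aut_V_iff by auto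
qed (auto simp: aut_V_iff)

lemma aut_inv: "aut f \<Longrightarrow> aut (inv f)"
proof -
  assume f: "aut f"
  have *: "f (inv f x) = x" for x using surj_f_inv_f[OF aut_surj[OF f]] .
  have "(inv f x, inv f y) \<in> E \<longleftrightarrow> (x, y) \<in> E" for x y
    using aut_E_iff[OF f, of "inv f x" "inv f y"] by (simp add: *)
  moreover have "inv f x \<in> V \<longleftrightarrow> x \<in> V" for x
    using aut_V_iff[OF f, of "inv f x"] by (simp add: *)
  ultimately show ?thesis
    using aut_bij[OF f] by (simp add: aut_def bij_imp_bij_inv)
qed

lemma aut_nbs: "aut f \<Longrightarrow> E `` {f x} = f ` (E `` {x})"
proof (intro equalityI subsetI)
  fix y assume f: "aut f" "y \<in> E `` {f x}"
  obtain z where "y = f z" using surjD[OF aut_surj[OF f(1)]] by blast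
  then show "y \<in> f ` (E `` {x})" using f by (auto simp: aut_E_iff)
qed (auto simp: aut_E_iff)

lemma aut_relpow: "aut f \<Longrightarrow> (f x, f y) \<in> E ^^ n \<longleftrightarrow> (x, y) \<in> E ^^ n"
proof (induction n arbitrary: y)
  case 0
  then show ?case by (simp add: inj_eq aut_inj)
next
  case (Suc n)
  show ?case
  proof
    assume "(f x, f y) \<in> E ^^ Suc n"
    then obtain z where "(f x, z) \<in> E ^^ n" "(z, f y) \<in> E" by auto
    moreover obtain w where "z = f w" using aut_surj[OF Suc.prems] by (metis surjD)
    ultimately show "(x, y) \<in> E ^^ Suc n" using Suc by (auto simp: aut_E_iff)
  next
    assume "(x, y) \<in> E ^^ Suc n"
    then obtain z where "(x, z) \<in> E ^^ n" "(z, y) \<in> E" by auto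
    then have "(f x, f z) \<in> E ^^ n" "(f z, f y) \<in> E" using Suc by (auto simp: aut_E_iff)
    then show "(f x, f y) \<in> E ^^ Suc n" by auto
  qed
qed

lemma aut_gball: "aut f \<Longrightarrow> gball n (f x) = f ` gball n x"
proof (intro equalityI subsetI)
  fix y assume f: "aut f" "y \<in> gball n (f x)"
  obtain z where "y = f z" using surjD[OF aut_surj[OF f(1)]] by blast
  then show "y \<in> f ` gball n x" using f by (auto simp: gball_def aut_relpow)
qed (auto simp: gball_def aut_relpow)

definition deg :: nat where "deg = card (E `` {SOME x. x \<in> V})"

lemma card_nbs: "x \<in> V \<Longrightarrow> card (E `` {x}) = deg"
proof -
  assume x: "x \<in> V"
  have o: "(SOME x. x \<in> V) \<in> V" using V_nonempty by (simp add: some_in_eq)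
  obtain f where "aut f" "f (SOME x. x \<in> V) = x" using ex_aut[OF o x] .
  then have "E `` {x} = f ` (E `` {SOME x. x \<in> V})" "inj f"
    using aut_nbs[of f "SOME x. x \<in> V"] by (auto simp: aut_inj)
  then show ?thesis
    by (simp add: deg_def card_image inj_on_subset)
qed

lemma deg_pos: "deg > 0"
proof -
  obtain x where "x \<in> V" using V_nonempty by auto
  then show ?thesis using card_nbs[of x] nbs_nonempty[of x] finite_nbs[of x]
    by (metis card_gt_0_iff)
qed

text \<open>Transitivity makes all balls of one radius equally large; the constants of the counting
  arguments come from here.\<close>

lemma card_gball: "\<exists>b>0. \<forall>x\<in>V. card (gball n x) = b"
proof -
  obtain o' where o: "o' \<in> V" using V_nonempty by auto
  have "card (gball n x) = card (gball n o')" if x: "x \<in> V" for x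
  proof -
    obtain f where "aut f" "f o' = x" by (rule ex_aut[OF o x])
    then have "gball n x = f ` gball n o'" "inj f"
      using aut_gball[of f n o'] by (auto simp: aut_inj)
    then show ?thesis by (simp add: card_image inj_on_subset)
  qed
  moreover have "card (gball n o') > 0" using gball_self[of o' n] by (auto simp: card_gt_0_iff simp del: gball_self)
  ultimately show ?thesis by blast
qed

end

section \<open>Simple random walk\<close>

abbreviation Path :: "(nat \<Rightarrow> 'v) measure" where
  "Path \<equiv> Pi\<^sub>M UNIV (\<lambda>_. count_space UNIV)"

abbreviation (input) shift :: "nat \<Rightarrow> (nat \<Rightarrow> 'v) \<Rightarrow> nat \<Rightarrow> 'v" where
  "shift n X \<equiv> \<lambda>i. X (i + n)"

text \<open>The total mass is read off from the cylinder over the empty index set, which is the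
  whole path space.\<close>

lemma prob_space_srw_law: "prob_space (srw_law E x)"
proof (rule prob_spaceI)
  have *: "{\<lambda>_::nat. undefined :: 'a} \<in> sets (Pi\<^sub>M {} (\<lambda>_. count_space UNIV))"
    by (simp add: sets_PiM_empty)
  interpret C: prob_space "srw.CI E x {}"
    by (rule srw.PF.prob_space_P) auto
  have "emeasure (srw_law E x) (prod_emb UNIV (\<lambda>_. count_space UNIV) {} {\<lambda>_. undefined}) =
      emeasure (srw.CI E x {}) {\<lambda>_. undefined}"
    unfolding srw_law_def by (rule srw.lim[OF _ *]) simp
  also have "\<dots> = 1"
    using C.emeasure_space_1 srw.PF.space_P[of "{}" E x] by (simp add: space_PiM)
  finally have "emeasure (srw_law E x) (prod_emb UNIV (\<lambda>_. count_space UNIV) {} {\<lambda>_. undefined}) = 1" .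
  moreover have "prod_emb UNIV (\<lambda>_::nat. count_space UNIV) {} {\<lambda>_. undefined :: 'a} = UNIV"
    by (auto simp: prod_emb_def space_PiM)
  ultimately show "emeasure (srw_law E x) (space (srw_law E x)) = 1" by simp
qed

lemma measurable_Path_component [measurable]: "(\<lambda>X. X i) \<in> Path \<rightarrow>\<^sub>M count_space UNIV"
  by (rule measurable_component_singleton) simp

lemma pred_Path_in [measurable]: "Measurable.pred Path (\<lambda>X. X i \<in> A)"
  by (rule measurable_compose[OF measurable_Path_component]) simp

lemma measurable_case_nat_Path: "case_nat x \<in> Path \<rightarrow>\<^sub>M Path"
  by (rule measurable_case_nat') auto

lemma measurable_shift_Path: "shift n \<in> Path \<rightarrow>\<^sub>M Path"
  by (rule measurable_PiM_single') auto

lemma pred_Path_shift [measurable]: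
  "B \<in> sets Path \<Longrightarrow> Measurable.pred Path (\<lambda>X. shift n X \<in> B)"
  by (rule measurable_compose[OF measurable_shift_Path]) simp

lemma pred_Path_case_nat [measurable]:
  "B \<in> sets Path \<Longrightarrow> Measurable.pred Path (\<lambda>X. case_nat x X \<in> B)"
  by (rule measurable_compose[OF measurable_case_nat_Path]) simp

lemma sets_Path_cylinder: "{X. \<forall>i\<le>n. X i = a i} \<in> sets Path"
proof -
  have "{X \<in> space Path. \<forall>i\<le>n. X i = a i} \<in> sets Path" by measurable
  then show ?thesis by (simp add: space_PiM)
qed

lemma srw_law_0: "AE X in srw_law E x. X 0 = x"
proof -
  interpret prob_space "srw_law E x" by (rule prob_space_srw_law)
  have "emeasure (srw_law E x) {X. \<forall>i\<le>0. X i = x} = 1"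
    by (subst srw_law_cylinder[of E x 0 "\<lambda>_. x"]) simp
  then have "prob {X. \<forall>i\<le>0. X i = x} = 1"
    by (simp add: emeasure_eq_measure)
  moreover have "{X. \<forall>i\<le>0. X i = x} \<in> events"
    using sets_Path_cylinder[of 0 "\<lambda>_. x"] by (simp only: sets_srw_law)
  ultimately show ?thesis
    by (simp add: prob_eq_1)
qed

text \<open>Both measures live on paths in the countable set \<open>V\<close>, so up to null sets
  every finite-dimensional event is a countable disjoint union of cylinders that fix the path up to
  time \<open>n\<close>; agreement on these suffices.\<close>

lemma path_measure_eqI:
  fixes V :: "'v set"
  assumes M: "prob_space M" "sets M = sets Path" and N: "prob_space N" "sets N = sets Path"
    and V: "countable V" "AE X in M. \<forall>i. X i \<in> V" "AE X in N. \<forall>i. X i \<in> V"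
    and cyl: "\<And>a n. (\<And>i. i \<le> n \<Longrightarrow> a i \<in> V) \<Longrightarrow>
      emeasure M {X. \<forall>i\<le>n. X i = a i} = emeasure N {X. \<forall>i\<le>n. X i = a i}"
  shows "M = N"
proof (rule measure_eqI_PiM_infinite[OF M(2) N(2)])
  show "finite_measure M" using M(1) by (simp add: prob_space.finite_measure)
  note [measurable_cong] = M(2) N(2)
  fix A :: "nat \<Rightarrow> 'v set" and J :: "nat set"
  assume J: "finite J"
  \<comment> \<open>The \<open>0\<close> keeps \<open>Max\<close> defined when \<open>J\<close> is
    empty.\<close>
  define n where "n = Max (insert 0 J)"
  have n: "i \<le> n" if "i \<in> J" for i using J that by (simp add: n_def)
  define T where "T = {a \<in> PiE {..n} (\<lambda>_. V). \<forall>i\<in>J. a i \<in> A i}"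
  have T: "countable T"
    unfolding T_def using V(1)
    by (intro countable_subset[OF _ countable_PiE[of "{..n}" "\<lambda>_. V"]]) auto
  define U where "U = (\<Union>a\<in>T. {X :: nat \<Rightarrow> 'v. \<forall>i\<le>n. X i = a i})"
  have U_eq: "X \<in> prod_emb UNIV (\<lambda>_. count_space UNIV) J (Pi\<^sub>E J A) \<longleftrightarrow> X \<in> U"
    if X: "\<forall>i. X i \<in> V" for X
  proof
    assume "X \<in> prod_emb UNIV (\<lambda>_. count_space UNIV) J (Pi\<^sub>E J A)"
    then have XA: "\<And>i. i \<in> J \<Longrightarrow> X i \<in> A i" by (auto simp: prod_emb_def PiE_iff)
    show "X \<in> U"
      unfolding U_def
      by (rule UN_I[of "restrict X {..n}"]) (use X XA n in \<open>auto simp: T_def\<close>)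
  next
    assume "X \<in> U"
    then show "X \<in> prod_emb UNIV (\<lambda>_. count_space UNIV) J (Pi\<^sub>E J A)"
      by (auto simp: U_def T_def prod_emb_def PiE_iff space_PiM n)
  qed
  have disj: "disjoint_family_on (\<lambda>a. {X :: nat \<Rightarrow> 'v. \<forall>i\<le>n. X i = a i}) T"
      unfolding disjoint_family_on_def
  proof (intro ballI impI)
    fix a b assume ab: "a \<in> T" "b \<in> T" "a \<noteq> b"
    then have "\<not> (\<forall>i\<le>n. a i = b i)"
      using PiE_ext[of a "{..n}" "\<lambda>_. V" b] by (auto simp: T_def)
    then show "{X. \<forall>i\<le>n. X i = a i} \<inter> {X. \<forall>i\<le>n. X i = b i} = {}" by auto
  qed
  have U: "emeasure M U = emeasure N U"
  proof -
    have "emeasure M U = (\<integral>\<^sup>+a. emeasure M {X. \<forall>i\<le>n. X i = a i} \<partial>count_space T)"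
      unfolding U_def using disj T M(2) by (intro emeasure_UN_countable) (auto simp: sets_Path_cylinder)
    also have "\<dots> = (\<integral>\<^sup>+a. emeasure N {X. \<forall>i\<le>n. X i = a i} \<partial>count_space T)"
      by (intro nn_integral_cong cyl) (auto simp: T_def PiE_iff)
    also have "\<dots> = emeasure N U"
      unfolding U_def using disj T N(2) by (intro emeasure_UN_countable[symmetric]) (auto simp: sets_Path_cylinder)
    finally show ?thesis .
  qed
  have Um: "U \<in> sets Path"
    unfolding U_def using T by (intro sets.countable_UN') (auto simp: sets_Path_cylinder)
  have emb: "prod_emb UNIV (\<lambda>_. count_space UNIV) J (Pi\<^sub>E J A) \<in> sets Path"
    using J by (intro measurable_prod_emb sets_PiM_I_finite) auto
  have "emeasure M (prod_emb UNIV (\<lambda>_. count_space UNIV) J (Pi\<^sub>E J A)) = emeasure M U"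
    using V(2) U_eq emb Um by (intro emeasure_eq_AE) auto
  also note U
  also have "emeasure N U = emeasure N (prod_emb UNIV (\<lambda>_. count_space UNIV) J (Pi\<^sub>E J A))"
    using V(3) U_eq emb Um by (intro emeasure_eq_AE) auto
  finally show "emeasure M (prod_emb UNIV (\<lambda>_. count_space UNIV) J (Pi\<^sub>E J A)) =
      emeasure N (prod_emb UNIV (\<lambda>_. count_space UNIV) J (Pi\<^sub>E J A))" .
qed

lemma space_Path [simp]: "space Path = UNIV"
  by (simp add: space_PiM)

lemma sets_Path_pred: "Measurable.pred Path P \<Longrightarrow> {X. P X} \<in> sets Path"
  by (simp add: pred_def)

lemma measure_srw_law_cong_AE:
  assumes "AE X in srw_law E x. P X \<longleftrightarrow> Q X" "Measurable.pred Path P" "Measurable.pred Path Q"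
  shows "measure (srw_law E x) {X. P X} = measure (srw_law E x) {X. Q X}"
  using assms(1) sets_Path_pred[OF assms(2)] sets_Path_pred[OF assms(3)]
  by (intro measure_eq_AE) (auto simp: sets_srw_law)

context vt_graph
begin

section \<open>Walks follow edges\<close>

fun walk_weight :: "'v \<Rightarrow> 'v list \<Rightarrow> real" where
  "walk_weight x [] = 1"
| "walk_weight x (y # ys) = pmf (pmf_of_set (E `` {x})) y * walk_weight y ys"

fun walks :: "nat \<Rightarrow> 'v \<Rightarrow> 'v list set" where
  "walks 0 x = {[]}"
| "walks (Suc n) x = (\<Union>y\<in>E `` {x}. (#) y ` walks n y)"

lemma walks_props:
  "finite (walks n x)" "ys \<in> walks n x \<Longrightarrow> length ys = n"
  "ys \<in> walks n x \<Longrightarrow> i < n \<Longrightarrow> ((x # ys) ! i, ys ! i) \<in> E"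
proof -
  show "finite (walks n x)" by (induction n arbitrary: x) auto
  show "length ys = n" if "ys \<in> walks n x"
    using that by (induction n arbitrary: x ys) auto
  show "((x # ys) ! i, ys ! i) \<in> E" if "ys \<in> walks n x" "i < n"
    using that
  proof (induction n arbitrary: x ys i)
    case (Suc n)
    then obtain y zs where "ys = y # zs" "(x, y) \<in> E" "zs \<in> walks n y" by auto
    then show ?case using Suc.IH[of zs y "i - 1"] Suc.prems(2) by (cases i) auto
  qed auto
qed

lemma sum_walk_weight: "x \<in> V \<Longrightarrow> (\<Sum>ys\<in>walks n x. walk_weight x ys) = 1"
proof (induction n arbitrary: x)
  case (Suc n)
  have "(\<Sum>ys\<in>walks (Suc n) x. walk_weight x ys) =
      (\<Sum>y\<in>E `` {x}. \<Sum>ys\<in>(#) y ` walks n y. walk_weight x ys)"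
    unfolding walks.simps by (intro sum.UNION_disjoint) (auto simp: walks_props)
  also have "\<dots> = (\<Sum>y\<in>E `` {x}. pmf (pmf_of_set (E `` {x})) y * (\<Sum>ys\<in>walks n y. walk_weight y ys))"
    by (simp add: sum.reindex sum_distrib_left)
  also have "\<dots> = (\<Sum>y\<in>E `` {x}. pmf (pmf_of_set (E `` {x})) y)"
    using Suc.IH E_in_V by (intro sum.cong) auto
  also have "\<dots> = 1"
    using nbs_nonempty[OF Suc.prems] by (intro sum_pmf_eq_1) (auto simp: set_pmf_of_set)
  finally show ?case .
qed simp

lemma emeasure_walk_cylinder:
  "emeasure (srw_law E x) {X. \<forall>i\<le>length ys. X i = (x # ys) ! i} = ennreal (walk_weight x ys)"
proof -
  have "(\<Prod>i<length ys. pmf (pmf_of_set (E `` {(x # ys) ! i})) (ys ! i)) = walk_weight x ys" for x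
  proof (induction ys arbitrary: x)
    case (Cons y ys)
    then show ?case
      by (simp add: prod.lessThan_Suc_shift del: prod.lessThan_Suc)
  qed simp
  then show ?thesis
    by (subst srw_law_cylinder) (simp add: prod_ennreal)
qed

text \<open>The cylinders of the finitely many walks of a given length are disjoint and their
  weights add up to one, so they exhaust the probability.\<close>

lemma AE_walk: "x \<in> V \<Longrightarrow> AE X in srw_law E x. X 0 = x \<and> (\<forall>i. (X i, X (Suc i)) \<in> E)"
proof -
  assume x: "x \<in> V"
  interpret prob_space "srw_law E x" by (rule prob_space_srw_law)
  define C where "C ys = {X :: nat \<Rightarrow> 'v. \<forall>i\<le>length ys. X i = (x # ys) ! i}" for ys
  have C [measurable]: "C ys \<in> sets (srw_law E x)" for ys
    unfolding C_def using sets_Path_cylinder by (simp add: sets_srw_law)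
  have "AE X in srw_law E x. (X n, X (Suc n)) \<in> E" for n
  proof -
    have "emeasure (srw_law E x) (\<Union>ys\<in>walks (Suc n) x. C ys) =
        (\<Sum>ys\<in>walks (Suc n) x. emeasure (srw_law E x) (C ys))"
    proof (rule sum_emeasure[symmetric])
      show "disjoint_family_on C (walks (Suc n) x)"
        unfolding disjoint_family_on_def
      proof (intro ballI impI)
        fix a b assume ab: "a \<in> walks (Suc n) x" "b \<in> walks (Suc n) x" "a \<noteq> b"
        then have len: "length a = Suc n" "length b = Suc n" by (blast intro: walks_props)+
        with ab obtain i where "i < Suc n" "a ! i \<noteq> b ! i"
          using nth_equalityI[of a b] by auto
        then have neq: "(x # a) ! Suc i \<noteq> (x # b) ! Suc i" and "Suc i \<le> Suc n" by auto
        have "X (Suc i) = (x # ys) ! Suc i" if "X \<in> C ys" "length ys = Suc n" for X ys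
        proof -
          have "\<forall>j\<le>Suc n. X j = (x # ys) ! j" using that(1) by (simp only: C_def mem_Collect_eq that(2))
          then show ?thesis using \<open>Suc i \<le> Suc n\<close> by blast
        qed
        from this[OF _ len(1)] this[OF _ len(2)] have "X \<in> C a \<Longrightarrow> X \<in> C b \<Longrightarrow> (x # a) ! Suc i = (x # b) ! Suc i" for X
          by (rule trans[OF sym])
        with neq show "C a \<inter> C b = {}" by blast
      qed
    qed (use walks_props(1)[of "Suc n" x] C in auto)
    also have "\<dots> = (\<Sum>ys\<in>walks (Suc n) x. ennreal (walk_weight x ys))"
      unfolding C_def emeasure_walk_cylinder ..
    also have "\<dots> = 1"
      using sum_walk_weight[OF x, of "Suc n"]
    proof (subst sum_ennreal)
      show "0 \<le> walk_weight x ys" for ys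
        by (induction ys arbitrary: x) auto
    qed (simp del: walks.simps)
    finally have "AE X in srw_law E x. X \<in> (\<Union>ys\<in>walks (Suc n) x. C ys)"
      using walks_props(1)[of "Suc n" x]
      by (subst prob_eq_1[symmetric]) (auto simp: emeasure_eq_measure simp del: walks.simps)
    then show ?thesis
    proof eventually_elim
      case (elim X)
      then obtain ys where ys: "ys \<in> walks (Suc n) x" "X \<in> C ys" by blast
      then have "length ys = Suc n" "((x # ys) ! n, ys ! n) \<in> E"
        using walks_props(3)[OF ys(1), of n] walks_props(2)[OF ys(1)] by auto
      moreover have "X n = (x # ys) ! n" "X (Suc n) = (x # ys) ! Suc n"
        using ys(2) calculation(1) by (auto simp: C_def)
      ultimately show ?case by simp
    qed
  qed
  then show ?thesis
    using srw_law_0[where E = E and x = x] by (simp add: AE_all_countable)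
qed

lemma AE_walk_in_V: "x \<in> V \<Longrightarrow> AE X in srw_law E x. \<forall>i. X i \<in> V"
  using AE_walk[of x] by (rule AE_mp) (auto intro!: AE_I2 dest: E_in_V)

text \<open>The Markov property at time one, from which the later Markov properties are derived; the
  two sides are compared on cylinders.\<close>

lemma srw_law_eq_bind:
  assumes x: "x \<in> V"
  shows "srw_law E x = measure_pmf (pmf_of_set (E `` {x})) \<bind> (\<lambda>y. distr (srw_law E y) Path (case_nat x))"
    (is "_ = ?B")
proof -
  have K: "(\<lambda>y. distr (srw_law E y) Path (case_nat x)) \<in>
      measure_pmf (pmf_of_set (E `` {x})) \<rightarrow>\<^sub>M subprob_algebra Path"
    by (auto simp: space_subprob_algebra sets_srw_law
        intro!: prob_space_imp_subprob_space prob_space.prob_space_distr prob_space_srw_law)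
  have em: "emeasure ?B A = (\<integral>\<^sup>+y. emeasure (srw_law E y) (case_nat x -` A) \<partial>measure_pmf (pmf_of_set (E `` {x})))"
    if A: "A \<in> sets Path" for A
    by (subst emeasure_bind[OF _ K A]) (auto simp: emeasure_distr A)
  have sB: "sets ?B = sets Path"
    by (rule sets_bind[of _ _ Path]) auto
  show ?thesis
  proof (rule path_measure_eqI[OF prob_space_srw_law _ _ _ countable_V])
    show "prob_space ?B"
      by (rule prob_space.prob_space_bind[OF prob_space_measure_pmf _ K])
        (auto intro!: AE_I2 prob_space.prob_space_distr prob_space_srw_law)
    show "AE X in ?B. \<forall>i. X i \<in> V"
    proof (subst AE_bind[OF K])
      have "AE Y in srw_law E y. \<forall>i. case_nat x Y i \<in> V" if "y \<in> E `` {x}" for y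
      proof -
        have "AE Y in srw_law E y. \<forall>i. Y i \<in> V" using that E_in_V by (intro AE_walk_in_V) auto
        then show ?thesis by eventually_elim (auto split: nat.split intro: x)
      qed
      moreover have "AE X in distr (srw_law E y) Path (case_nat x). \<forall>i. X i \<in> V"
        if "AE Y in srw_law E y. \<forall>i. case_nat x Y i \<in> V" for y
      proof (subst AE_distr_iff)
        show "case_nat x \<in> srw_law E y \<rightarrow>\<^sub>M Path"
          unfolding measurable_cong_sets[OF sets_srw_law refl] by (rule measurable_case_nat_Path)
        show "{X \<in> space Path. \<forall>i. X i \<in> V} \<in> sets Path" by measurable
      qed (rule that)
      ultimately show "AE y in measure_pmf (pmf_of_set (E `` {x})). AE X in distr (srw_law E y) Path (case_nat x). \<forall>i. X i \<in> V"
        using nbs_nonempty[OF x] by (simp add: AE_measure_pmf_iff set_pmf_of_set)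
    qed auto
    fix a :: "nat \<Rightarrow> 'v" and n
    assume "\<And>i. i \<le> n \<Longrightarrow> a i \<in> V"
    show "emeasure (srw_law E x) {X. \<forall>i\<le>n. X i = a i} = emeasure ?B {X. \<forall>i\<le>n. X i = a i}"
    proof (cases "a 0 = x")
      case False
      then have *: "case_nat x -` {X. \<forall>i\<le>n. X i = a i} = {}" by force
      show ?thesis
        unfolding em[OF sets_Path_cylinder] * srw_law_cylinder using False by simp
    next
      case True
      show ?thesis
      \<comment> \<open>A cylinder at time zero fixes only the starting point. Otherwise the first
        step splits off one factor of the product, and the shifted cylinder extends to time
        \<open>m\<close>.\<close>
      proof (cases n)
        case 0
        have "case_nat x -` {X. \<forall>i\<le>n. X i = a i} = space (srw_law E y)" for y using 0 True by auto
        then have *: "emeasure (srw_law E y) (case_nat x -` {X. \<forall>i\<le>n. X i = a i}) = 1" for y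
          using prob_space.emeasure_space_1[OF prob_space_srw_law[where E = E and x = y]] by (simp only:)
        show ?thesis
          unfolding em[OF sets_Path_cylinder] * srw_law_cylinder using 0 True by simp
      next
        case (Suc m)
        define c where "c = (\<Prod>i<m. ennreal (pmf (pmf_of_set (E `` {a (Suc i)})) (a (Suc (Suc i)))))"
        have "case_nat x -` {X. \<forall>i\<le>n. X i = a i} = {X. \<forall>i\<le>m. X i = (a \<circ> Suc) i}"
        proof (intro equalityI subsetI CollectI allI impI)
          fix X i assume "X \<in> case_nat x -` {X. \<forall>i\<le>n. X i = a i}" "i \<le> m"
          then have "case_nat x X (Suc i) = a (Suc i)" using Suc by blast
          then show "X i = (a \<circ> Suc) i" by simp
        next
          fix X assume "X \<in> {X. \<forall>i\<le>m. X i = (a \<circ> Suc) i}"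
          then show "X \<in> case_nat x -` {X. \<forall>i\<le>n. X i = a i}"
            using True Suc by (auto split: nat.split)
        qed
        then have *: "emeasure (srw_law E y) (case_nat x -` {X. \<forall>i\<le>n. X i = a i}) = c * indicator {a 1} y" for y
          using srw_law_cylinder[where E = E and x = y and n = m and a = "a \<circ> Suc"]
          by (auto simp: c_def indicator_def)
        have "emeasure ?B {X. \<forall>i\<le>n. X i = a i} = c * pmf (pmf_of_set (E `` {x})) (a 1)"
          unfolding em[OF sets_Path_cylinder] *
          by (simp add: nn_integral_cmult emeasure_pmf_single)
        then show ?thesis
          using True unfolding srw_law_cylinder Suc c_def
          by (simp add: prod.lessThan_Suc_shift mult.commute del: prod.lessThan_Suc)
      qed
    qed
  qed (use sB x AE_walk_in_V in \<open>auto simp: sets_srw_law\<close>)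
qed

lemma srw_step:
  assumes x: "x \<in> V" and B: "B \<in> sets Path"
  shows "measure (srw_law E x) B = (\<Sum>y\<in>E `` {x}. measure (srw_law E y) (case_nat x -` B)) / deg"
proof -
  have K: "(\<lambda>y. distr (srw_law E y) Path (case_nat x)) \<in>
      measure_pmf (pmf_of_set (E `` {x})) \<rightarrow>\<^sub>M subprob_algebra Path"
    by (auto simp: space_subprob_algebra sets_srw_law
        intro!: prob_space_imp_subprob_space prob_space.prob_space_distr prob_space_srw_law)
  have fin: "finite_measure (srw_law E y)" for y
    using prob_space_srw_law[where E = E and x = y] by (simp add: prob_space.finite_measure)
  have "emeasure (srw_law E x) B =
      (\<integral>\<^sup>+y. emeasure (srw_law E y) (case_nat x -` B) \<partial>measure_pmf (pmf_of_set (E `` {x})))"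
    by (subst srw_law_eq_bind[OF x], subst emeasure_bind[OF _ K B]) (auto simp: emeasure_distr B)
  also have "\<dots> = (\<Sum>y\<in>E `` {x}. emeasure (srw_law E y) (case_nat x -` B)) / deg"
    using nbs_nonempty[OF x] by (subst nn_integral_pmf_of_set) (auto simp: card_nbs[OF x])
  also have "\<dots> = ennreal ((\<Sum>y\<in>E `` {x}. measure (srw_law E y) (case_nat x -` B)) / deg)"
    using deg_pos by (simp add: finite_measure.emeasure_eq_measure[OF fin] sum_nonneg ennreal_of_nat_eq_real_of_nat divide_ennreal)
  finally show ?thesis
    by (simp add: finite_measure.emeasure_eq_measure[OF fin] sum_nonneg)
qed

abbreviation Pr :: "'v \<Rightarrow> ((nat \<Rightarrow> 'v) \<Rightarrow> bool) \<Rightarrow> real" where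
  "Pr x P \<equiv> measure (srw_law E x) {X. P X}"

lemma finite_measure_walk: "finite_measure (srw_law E x)"
  using prob_space_srw_law[where E = E and x = x] by (simp add: prob_space.finite_measure)

lemma sets_walk_pred: "Measurable.pred Path P \<Longrightarrow> {X. P X} \<in> sets (srw_law E x)"
  by (simp add: sets_srw_law sets_Path_pred)

lemma Pr_True [simp]: "Pr x (\<lambda>_. True) = 1"
  using prob_space.prob_space[OF prob_space_srw_law[where E = E and x = x]] by simp

lemma measure_walk_UNIV [simp]: "measure (srw_law E x) UNIV = 1"
  using prob_space.prob_space[OF prob_space_srw_law[where E = E and x = x]] by simp

lemma Pr_le_1: "Pr x P \<le> 1"
  by (rule prob_space.prob_le_1[OF prob_space_srw_law])

lemma Pr_mono:
  assumes "\<And>X. P X \<Longrightarrow> Q X" "Measurable.pred Path Q"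
  shows "Pr x P \<le> Pr x Q"
  using assms by (intro finite_measure.finite_measure_mono[OF finite_measure_walk] sets_walk_pred) auto

text \<open>The probability of a set is an average over the neighbours of \<open>x\<close>, so if it
  is zero, every term vanishes. \<open>P\<close> is arbitrary, so a null set covering its failures
  takes its place.\<close>

lemma AE_stepD:
  assumes x: "x \<in> V" and P: "AE X in srw_law E x. P X" and y: "(x, y) \<in> E"
  shows "AE Y in srw_law E y. P (case_nat x Y)"
proof -
  obtain N where N: "{X \<in> space (srw_law E x). \<not> P X} \<subseteq> N" "N \<in> null_sets (srw_law E x)"
    using P by (auto simp: eventually_ae_filter)
  have sN: "N \<in> sets Path" using N(2) by (auto simp: sets_srw_law)
  have "measure (srw_law E x) N = 0" using N(2) by (simp add: measure_eq_0_null_sets)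
  then have "(\<Sum>y\<in>E `` {x}. measure (srw_law E y) (case_nat x -` N)) = 0"
    using deg_pos by (simp add: srw_step[OF x sN])
  then have 0: "measure (srw_law E y) (case_nat x -` N) = 0"
    using y by (subst (asm) sum_nonneg_eq_0_iff) auto
  have "case_nat x -` N \<in> sets (srw_law E y)"
    using sets_Path_pred[OF pred_Path_case_nat[OF sN]] by (simp add: sets_srw_law vimage_def)
  then have "case_nat x -` N \<in> null_sets (srw_law E y)"
    using 0 by (simp add: null_sets_def finite_measure.emeasure_eq_measure[OF finite_measure_walk])
  then show ?thesis
    by (rule AE_I') (use N(1) in auto)
qed

text \<open>Failure of \<open>P\<close> forces \<open>shift 1 X\<close> into the exceptional null
  set that belongs to the first step \<open>X 1\<close>, and there are only finitely many first
  steps.\<close>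

lemma AE_stepI:
  assumes x: "x \<in> V" and P: "\<And>y. (x, y) \<in> E \<Longrightarrow> AE Y in srw_law E y. P (case_nat x Y)"
  shows "AE X in srw_law E x. P X"
proof -
  have "\<exists>N. {Y. \<not> P (case_nat x Y)} \<subseteq> N \<and> N \<in> null_sets (srw_law E y)" if "(x, y) \<in> E" for y
    using P[OF that] by (auto simp: eventually_ae_filter)
  then obtain N where N: "\<And>y. (x, y) \<in> E \<Longrightarrow> {Y. \<not> P (case_nat x Y)} \<subseteq> N y"
      "\<And>y. (x, y) \<in> E \<Longrightarrow> N y \<in> null_sets (srw_law E y)"
    by metis
  have sN: "N y \<in> sets Path" if "(x, y) \<in> E" for y
    using N(2)[OF that] by (auto simp: sets_srw_law)
  have "AE X in srw_law E x. \<not> (X 1 = y \<and> shift 1 X \<in> N y)" if y: "(x, y) \<in> E" for y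
  proof -
    let ?B = "{X. X 1 = y \<and> shift 1 X \<in> N y}"
    have [measurable]: "N y \<in> sets Path" by (rule sN[OF y])
    have B: "?B \<in> sets Path" by (rule sets_Path_pred) measurable
    have "measure (srw_law E z) (case_nat x -` ?B) = 0" for z
    proof -
      have "case_nat x -` ?B = {Y. Y 0 = y \<and> Y \<in> N y}" by auto
      moreover have "AE Y in srw_law E z. \<not> (Y 0 = y \<and> Y \<in> N y)"
      proof (cases "z = y")
        case True
        have "AE Y in srw_law E y. Y \<notin> N y" using N(2)[OF y] by (rule AE_not_in)
        then show ?thesis using True by auto
      next
        case False
        then show ?thesis using srw_law_0[where E = E and x = z] by auto
      qed
      moreover have "{Y. Y 0 = y \<and> Y \<in> N y} \<in> sets (srw_law E z)"
        by (rule sets_walk_pred) measurable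
      ultimately show ?thesis
        using measure_eq_AE[where M = "srw_law E z" and A = "{Y. Y 0 = y \<and> Y \<in> N y}" and B = "{}"] by auto
    qed
    then have "measure (srw_law E x) ?B = 0"
      unfolding srw_step[OF x B] by (simp only: sum.neutral_const div_0)
    then have "?B \<in> null_sets (srw_law E x)"
      unfolding null_sets_def mem_Collect_eq finite_measure.emeasure_eq_measure[OF finite_measure_walk] sets_srw_law
      using B by (simp only: ennreal_0 simp_thms)
    then show ?thesis by (rule AE_I') auto
  qed
  then have "AE X in srw_law E x. \<forall>y\<in>E `` {x}. \<not> (X 1 = y \<and> shift 1 X \<in> N y)"
    by (subst AE_finite_all) auto
  then show ?thesis using AE_walk[OF x]
  proof eventually_elim
    case (elim X)
    then have "(X 0, X (Suc 0)) \<in> E" by blast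
    with elim(2) have 1: "(x, X 1) \<in> E" by simp
    then have "shift 1 X \<notin> N (X 1)" using elim(1) by auto
    then have "P (case_nat x (shift 1 X))" using N(1)[OF 1] by auto
    moreover have "case_nat x (shift 1 X) = X" using elim(2) by (auto split: nat.split)
    ultimately show ?case by simp
  qed
qed

text \<open>Repeated first-step conditioning. The position at time \<open>n\<close> is unknown, so
  the property has to hold from every starting point; later predicates are made vacuously true for
  the undesired ones.\<close>

lemma AE_shift:
  assumes "\<And>z. z \<in> V \<Longrightarrow> AE X in srw_law E z. P X" "x \<in> V"
  shows "AE X in srw_law E x. \<forall>n. P (shift n X)"
proof -
  have "AE X in srw_law E x. P (shift n X)" for n
    using assms(2)
  proof (induction n arbitrary: x)
    case 0
    then show ?case using assms(1) by simp
  next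
    case (Suc n)
    show ?case
    proof (rule AE_stepI[OF Suc.prems])
      fix y assume "(x, y) \<in> E"
      then show "AE Y in srw_law E y. P (shift (Suc n) (case_nat x Y))"
        using Suc.IH[of y] E_in_V by simp
    qed
  qed
  then show ?thesis by (simp add: AE_all_countable)
qed

text \<open>\<open>vs\<close> lists the vertices of a walk from \<open>x\<close> to \<open>z\<close>
  without the endpoint \<open>z\<close>, so that prepending \<open>vs\<close> to a walk from
  \<open>z\<close> yields a walk from \<open>x\<close>.\<close>

fun chain :: "'v list \<Rightarrow> 'v \<Rightarrow> 'v \<Rightarrow> bool" where
  "chain [] x z \<longleftrightarrow> x = z"
| "chain (v # vs) x z \<longleftrightarrow> v = x \<and> (\<exists>y. (x, y) \<in> E \<and> chain vs y z)"

text \<open>The walk from \<open>x\<close> follows \<open>vs\<close> with positive probability, so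
  an event of full measure must contain almost every continuation from \<open>z\<close>. Detours,
  loops and connecting paths are attached to walks in this way.\<close>

lemma AE_prefix:
  "chain vs x z \<Longrightarrow> AE X in srw_law E x. P X \<Longrightarrow> AE Z in srw_law E z. P (foldr case_nat vs Z)"
proof (induction vs arbitrary: x P)
  case (Cons v vs)
  then obtain y where y: "v = x" "(x, y) \<in> E" "chain vs y z" by auto
  have "AE Y in srw_law E y. P (case_nat x Y)"
    using AE_stepD[OF _ Cons.prems(2) y(2)] E_in_V y(2) by auto
  from Cons.IH[OF y(3) this] show ?case using y(1) by simp
next
  case Nil
  then have xz: "x = z" by simp
  show ?case using Nil(2)[unfolded xz] unfolding foldr.simps id_apply .
qed

lemma range_prefix: "range (foldr case_nat vs Z) = set vs \<union> range Z"
proof (induction vs)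
  case (Cons v vs)
  have "range (case_nat v Y) = insert v (range Y)" for Y
  proof (intro equalityI subsetI)
    fix y assume "y \<in> range (case_nat v Y)"
    then obtain i where "y = case_nat v Y i" by auto
    then show "y \<in> insert v (range Y)" by (cases i) auto
  next
    fix y assume "y \<in> insert v (range Y)"
    then show "y \<in> range (case_nat v Y)"
      by (auto intro: range_eqI[of _ _ 0] range_eqI[of _ _ "Suc _"])
  qed
  with Cons show ?case by simp
qed simp

lemma chain_prefix:
  "(\<And>i. (X i, X (Suc i)) \<in> E) \<Longrightarrow> chain (map X [0..<n]) (X 0) (X n)"
proof (induction n arbitrary: X)
  case (Suc n)
  have "chain (map (shift 1 X) [0..<n]) (X 1) (X (Suc n))"
    using Suc.IH[of "shift 1 X"] Suc.prems by simp
  moreover have "[1..<Suc n] = map Suc [0..<n]"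
    by (simp only: map_Suc_upt One_nat_def)
  then have "map (shift 1 X) [0..<n] = map X [1..<Suc n]"
    by (simp only: map_map comp_def Suc_eq_plus1)
  ultimately show ?case
    using Suc.prems[of 0] by (simp add: upt_conv_Cons del: upt_Suc) auto
qed simp

subsection \<open>Taboo probabilities and reversibility\<close>

text \<open>\<open>taboo K n x y\<close> is the probability to be at \<open>y\<close> at time \<open>n + 1\<close> without visiting \<open>K\<close> at the
  times \<open>1, \<dots>, n\<close>.\<close>

fun taboo :: "'v set \<Rightarrow> nat \<Rightarrow> 'v \<Rightarrow> 'v \<Rightarrow> real" where
  "taboo K 0 x y = (if (x, y) \<in> E then 1 / deg else 0)"
| "taboo K (Suc n) x y = (\<Sum>z\<in>E `` {x} - K. taboo K n z y) / deg"

lemma taboo_nonneg: "taboo K n x y \<ge> 0"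
  by (induction n arbitrary: x) (auto intro!: sum_nonneg divide_nonneg_nonneg)

lemma taboo_Suc': "taboo K (Suc n) x y = (\<Sum>z\<in>E `` {y} - K. taboo K n x z) / deg"
proof (induction n arbitrary: x)
  case 0
  have "(\<Sum>z\<in>E `` {x} - K. taboo K 0 z y) = (\<Sum>z\<in>(E `` {x} - K) \<inter> E `` {y}. 1 / deg)"
    by (subst sum.inter_restrict) (auto intro!: sum.cong dest: E_sym)
  also have "(E `` {x} - K) \<inter> E `` {y} = (E `` {y} - K) \<inter> E `` {x}" by auto
  also have "(\<Sum>z\<in>(E `` {y} - K) \<inter> E `` {x}. 1 / deg) = (\<Sum>z\<in>E `` {y} - K. taboo K 0 x z)"
    by (subst sum.inter_restrict) (auto intro!: sum.cong)
  finally show ?case by simp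
next
  case (Suc n)
  have "taboo K (Suc (Suc n)) x y = (\<Sum>z\<in>E `` {x} - K. (\<Sum>w\<in>E `` {y} - K. taboo K n z w) / deg) / deg"
    unfolding taboo.simps(2)[of K "Suc n"] Suc ..
  also have "\<dots> = (\<Sum>w\<in>E `` {y} - K. (\<Sum>z\<in>E `` {x} - K. taboo K n z w) / deg) / deg"
    by (simp only: sum_divide_distrib[symmetric] sum.swap[of _ "E `` {y} - K"])
  finally show ?case by simp
qed

text \<open>Reversibility: all degrees equal \<open>deg\<close>, so a path and its reversal have the
  same weight. The decomposition at the last step, \<open>taboo_Suc'\<close>, is what the reversed
  recursion looks like.\<close>

lemma taboo_sym: "taboo K n x y = taboo K n y x"
proof (induction n arbitrary: x y)
  case 0
  then show ?case by (auto dest: E_sym)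
next
  case (Suc n)
  have "taboo K (Suc n) x y = (\<Sum>z\<in>E `` {x} - K. taboo K n y z) / deg"
    using Suc by simp
  then show ?case unfolding taboo_Suc'[of K n y x] .
qed

lemma taboo_aut: "aut f \<Longrightarrow> taboo (f ` K) n (f x) (f y) = taboo K n x y"
proof (induction n arbitrary: x)
  case 0
  then show ?case by (simp add: aut_E_iff)
next
  case (Suc n)
  have "E `` {f x} - f ` K = f ` (E `` {x} - K)"
    using Suc.prems by (simp add: aut_nbs image_set_diff aut_inj)
  moreover have "inj_on f (E `` {x} - K)"
    using aut_inj[OF Suc.prems] by (rule inj_on_subset) auto
  ultimately show ?case
    using Suc by (simp add: sum.reindex)
qed

text \<open>First-step analysis, by induction on the time. The endpoint \<open>y\<close> may itself
  lie in \<open>K\<close>, which is how first entrances into \<open>K\<close> are expressed.\<close>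

lemma markov_taboo:
  assumes "x \<in> V" "y \<in> V" and B [measurable]: "B \<in> sets Path"
  shows "Pr x (\<lambda>X. X (Suc n) = y \<and> (\<forall>i\<in>{1..n}. X i \<notin> K) \<and> shift (Suc n) X \<in> B) =
    taboo K n x y * measure (srw_law E y) B"
  using assms(1)
proof (induction n arbitrary: x)
  case 0
  have "measure (srw_law E z) {Y. Y 0 = y \<and> Y \<in> B} = (if z = y then measure (srw_law E y) B else 0)" for z
  proof (cases "z = y")
    case True
    have "Pr y (\<lambda>Y. Y 0 = y \<and> Y \<in> B) = Pr y (\<lambda>Y. Y \<in> B)"
      using srw_law_0[where E = E and x = y] by (intro measure_srw_law_cong_AE) auto
    then show ?thesis using True by simp
  next
    case False
    have "Pr z (\<lambda>Y. Y 0 = y \<and> Y \<in> B) = Pr z (\<lambda>Y. False)"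
      using srw_law_0[where E = E and x = z] False by (intro measure_srw_law_cong_AE) auto
    then show ?thesis using False by simp
  qed
  moreover have "case_nat x -` {X. X (Suc 0) = y \<and> (\<forall>i\<in>{1..0}. X i \<notin> K) \<and> shift (Suc 0) X \<in> B} =
      {Y. Y 0 = y \<and> Y \<in> B}"
    by auto
  ultimately show ?case
  proof (subst srw_step[OF 0])
    show "{X. X (Suc 0) = y \<and> (\<forall>i\<in>{1..0}. X i \<notin> K) \<and> shift (Suc 0) X \<in> B} \<in> sets Path"
      by (rule sets_Path_pred) measurable
  qed (simp add: sum.delta)
next
  case (Suc n)
  have *: "case_nat x -` {X. X (Suc (Suc n)) = y \<and> (\<forall>i\<in>{1..Suc n}. X i \<notin> K) \<and> shift (Suc (Suc n)) X \<in> B} =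
      {Y. Y 0 \<notin> K \<and> Y (Suc n) = y \<and> (\<forall>i\<in>{1..n}. Y i \<notin> K) \<and> shift (Suc n) Y \<in> B}"
  proof -
    have "(\<forall>i\<in>{1..Suc n}. case_nat x Y i \<notin> K) \<longleftrightarrow> Y 0 \<notin> K \<and> (\<forall>i\<in>{1..n}. Y i \<notin> K)" for Y
    proof -
      have "{1..Suc n} = insert 1 (Suc ` {1..n})" by (auto simp: image_Suc_atLeastAtMost)
      then show ?thesis by (simp del: image_Suc_atLeastAtMost)
    qed
    then show ?thesis by auto
  qed
  have z: "Pr z (\<lambda>Y. Y 0 \<notin> K \<and> Y (Suc n) = y \<and> (\<forall>i\<in>{1..n}. Y i \<notin> K) \<and> shift (Suc n) Y \<in> B) =
      (if z \<notin> K then taboo K n z y * measure (srw_law E y) B else 0)" if "z \<in> E `` {x}" for z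
  proof (cases "z \<in> K")
    case True
    have "Pr z (\<lambda>Y. Y 0 \<notin> K \<and> Y (Suc n) = y \<and> (\<forall>i\<in>{1..n}. Y i \<notin> K) \<and> shift (Suc n) Y \<in> B) = Pr z (\<lambda>Y. False)"
    proof (rule measure_srw_law_cong_AE)
      show "AE Y in srw_law E z. (Y 0 \<notin> K \<and> Y (Suc n) = y \<and> (\<forall>i\<in>{1..n}. Y i \<notin> K) \<and> shift (Suc n) Y \<in> B) \<longleftrightarrow> False"
        using srw_law_0[where E = E and x = z] by eventually_elim (use True in auto)
    qed measurable
    then show ?thesis using True by simp
  next
    case False
    have "Pr z (\<lambda>Y. Y 0 \<notin> K \<and> Y (Suc n) = y \<and> (\<forall>i\<in>{1..n}. Y i \<notin> K) \<and> shift (Suc n) Y \<in> B) =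
        Pr z (\<lambda>Y. Y (Suc n) = y \<and> (\<forall>i\<in>{1..n}. Y i \<notin> K) \<and> shift (Suc n) Y \<in> B)"
    proof (rule measure_srw_law_cong_AE)
      show "AE Y in srw_law E z. (Y 0 \<notin> K \<and> Y (Suc n) = y \<and> (\<forall>i\<in>{1..n}. Y i \<notin> K) \<and> shift (Suc n) Y \<in> B) \<longleftrightarrow>
          (Y (Suc n) = y \<and> (\<forall>i\<in>{1..n}. Y i \<notin> K) \<and> shift (Suc n) Y \<in> B)"
        using srw_law_0[where E = E and x = z] by eventually_elim (use False in auto)
    qed measurable
    then show ?thesis using Suc.IH[of z] that E_in_V False by auto
  qed
  have "Pr x (\<lambda>X. X (Suc (Suc n)) = y \<and> (\<forall>i\<in>{1..Suc n}. X i \<notin> K) \<and> shift (Suc (Suc n)) X \<in> B) =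
      (\<Sum>z\<in>E `` {x}. if z \<notin> K then taboo K n z y * measure (srw_law E y) B else 0) / deg"
  proof (subst srw_step[OF Suc.prems])
    show "{X. X (Suc (Suc n)) = y \<and> (\<forall>i\<in>{1..Suc n}. X i \<notin> K) \<and> shift (Suc (Suc n)) X \<in> B} \<in> sets Path"
      by (rule sets_Path_pred) measurable
  qed (simp only: * z cong: sum.cong)
  also have "(\<Sum>z\<in>E `` {x}. if z \<notin> K then taboo K n z y * measure (srw_law E y) B else 0) =
      (\<Sum>z\<in>E `` {x} - K. taboo K n z y * measure (srw_law E y) B)"
    by (intro sum.mono_neutral_cong_right) auto
  finally show ?case by (simp add: sum_distrib_right)
qed

section \<open>First entrances into a finite set\<close>

definition entrance :: "'v set \<Rightarrow> 'v \<Rightarrow> 'v \<Rightarrow> real" where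
  "entrance L x y = (\<Sum>n. taboo L n x y)"

text \<open>As \<open>y \<in> L\<close>, the first entrance into \<open>L\<close> can happen at
  \<open>y\<close> at one time only, so the taboo events for different \<open>n\<close> are disjoint
  and their probabilities add up. Summability comes from the same computation with the trivial
  event.\<close>

lemma
  assumes x: "x \<in> V" and y: "y \<in> L" "L \<subseteq> V" and B [measurable]: "B \<in> sets Path"
  shows entrance_at: "Pr x (\<lambda>X. \<exists>n. X (Suc n) = y \<and> (\<forall>i\<in>{1..n}. X i \<notin> L) \<and> shift (Suc n) X \<in> B) =
      entrance L x y * measure (srw_law E y) B"
    and summable_taboo: "summable (\<lambda>n. taboo L n x y)"
proof -
  have yV: "y \<in> V" using y by auto
  have *: "(\<lambda>n. taboo L n x y * measure (srw_law E y) B) sums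
      Pr x (\<lambda>X. \<exists>n. X (Suc n) = y \<and> (\<forall>i\<in>{1..n}. X i \<notin> L) \<and> shift (Suc n) X \<in> B)"
    if B [measurable]: "B \<in> sets Path" for B
  proof -
    let ?A = "\<lambda>n. {X. X (Suc n) = y \<and> (\<forall>i\<in>{1..n}. X i \<notin> L) \<and> shift (Suc n) X \<in> B}"
    have disj: "?A m \<inter> ?A n = {}" if "m < n" for m n
      using that y(1) by (auto intro!: bexI[of _ "Suc m"])
    have "disjoint_family ?A"
      unfolding disjoint_family_on_def using disj by (metis (no_types, lifting) Int_commute nat_neq_iff)
    moreover have "range ?A \<subseteq> sets (srw_law E x)"
      by (intro image_subsetI sets_walk_pred) measurable
    ultimately have "(\<lambda>n. measure (srw_law E x) (?A n)) sums measure (srw_law E x) (\<Union>n. ?A n)"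
      by (intro finite_measure.finite_measure_UNION finite_measure_walk)
    moreover have "(\<Union>n. ?A n) = {X. \<exists>n. X (Suc n) = y \<and> (\<forall>i\<in>{1..n}. X i \<notin> L) \<and> shift (Suc n) X \<in> B}"
      by auto
    ultimately show ?thesis
      by (simp only: markov_taboo[OF x yV B])
  qed
  show summ: "summable (\<lambda>n. taboo L n x y)"
    using *[OF sets.top] unfolding space_Path by (simp add: sums_iff)
  show "Pr x (\<lambda>X. \<exists>n. X (Suc n) = y \<and> (\<forall>i\<in>{1..n}. X i \<notin> L) \<and> shift (Suc n) X \<in> B) =
      entrance L x y * measure (srw_law E y) B"
    unfolding entrance_def by (rule sums_unique2[OF *[OF B] sums_mult2[OF summable_sums[OF summ]]])
qed

lemma entrance_nonneg: "x \<in> V \<Longrightarrow> y \<in> L \<Longrightarrow> L \<subseteq> V \<Longrightarrow> entrance L x y \<ge> 0"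
  unfolding entrance_def by (intro suminf_nonneg taboo_nonneg summable_taboo[OF _ _ _ sets.top])

lemma entrance_sym: "entrance L x y = entrance L y x"
  unfolding entrance_def by (simp only: taboo_sym[of L _ x y])

lemma entrance_aut: "aut f \<Longrightarrow> entrance (f ` L) (f x) (f y) = entrance L x y"
  by (simp add: entrance_def taboo_aut)

lemma first_entrance:
  assumes x: "x \<in> V" and L: "finite L" "L \<subseteq> V" and B [measurable]: "B \<in> sets Path"
  shows "Pr x (\<lambda>X. \<exists>n. X (Suc n) \<in> L \<and> (\<forall>i\<in>{1..n}. X i \<notin> L) \<and> shift (Suc n) X \<in> B) =
    (\<Sum>y\<in>L. entrance L x y * measure (srw_law E y) B)"
proof -
  let ?A = "\<lambda>y. {X. \<exists>n. X (Suc n) = y \<and> (\<forall>i\<in>{1..n}. X i \<notin> L) \<and> shift (Suc n) X \<in> B}"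
  have "measure (srw_law E x) (\<Union>y\<in>L. ?A y) = (\<Sum>y\<in>L. measure (srw_law E x) (?A y))"
  proof (rule finite_measure.finite_measure_finite_Union[OF finite_measure_walk L(1)])
    show "?A ` L \<subseteq> sets (srw_law E x)"
      by (intro image_subsetI sets_walk_pred) measurable
    have False if y: "y \<in> L" "z \<in> L" "y \<noteq> z" and X: "X (Suc m) = y" "\<forall>i\<in>{1..m}. X i \<notin> L"
        "X (Suc n) = z" "\<forall>i\<in>{1..n}. X i \<notin> L" for X :: "nat \<Rightarrow> 'v" and y z m n
    proof (cases m n rule: linorder_cases)
      case less
      then have "Suc m \<in> {1..n}" by auto
      then show ?thesis using X y by blast
    next
      case greater
      then have "Suc n \<in> {1..m}" by auto
      then show ?thesis using X y by blast
    qed (use X y in auto)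
    then show "disjoint_family_on ?A L"
      unfolding disjoint_family_on_def by (intro ballI impI) blast
  qed
  moreover have "(\<Union>y\<in>L. ?A y) = {X. \<exists>n. X (Suc n) \<in> L \<and> (\<forall>i\<in>{1..n}. X i \<notin> L) \<and> shift (Suc n) X \<in> B}"
    by auto
  ultimately show ?thesis
    using entrance_at[OF x _ L(2) B] by simp
qed

lemma exists_first_entrance:
  "(\<exists>n\<ge>1. X n \<in> L) \<longleftrightarrow> (\<exists>n. X (Suc n) \<in> L \<and> (\<forall>i\<in>{1..n}. X i \<notin> L))"
proof
  assume "\<exists>n\<ge>1. X n \<in> L"
  then obtain n where n: "n \<ge> 1" "X n \<in> L" by auto
  define m where "m = (LEAST n. n \<ge> 1 \<and> X n \<in> L)"
  have m: "m \<ge> 1 \<and> X m \<in> L" unfolding m_def by (rule LeastI[of _ n]) (use n in auto)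
  have "X i \<notin> L" if "i \<ge> 1" "i < m" for i
    using not_less_Least[of i "\<lambda>n. n \<ge> 1 \<and> X n \<in> L"] that by (auto simp: m_def)
  then show "\<exists>n. X (Suc n) \<in> L \<and> (\<forall>i\<in>{1..n}. X i \<notin> L)"
    using m by (intro exI[of _ "m - 1"]) auto
qed auto

lemma sum_entrance:
  assumes x: "x \<in> V" and L: "finite L" "L \<subseteq> V"
  shows "Pr x (\<lambda>X. \<forall>n\<ge>1. X n \<notin> L) = 1 - (\<Sum>y\<in>L. entrance L x y)"
proof -
  interpret prob_space "srw_law E x" by (rule prob_space_srw_law)
  have "Pr x (\<lambda>X. \<exists>n\<ge>1. X n \<in> L) = (\<Sum>y\<in>L. entrance L x y)"
    using first_entrance[OF x L sets.top] unfolding exists_first_entrance space_Path by simp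
  moreover have "{X. \<exists>n\<ge>1. X n \<in> L} \<in> events"
    by (rule sets_walk_pred) measurable
  then have "prob (space (srw_law E x) - {X. \<exists>n\<ge>1. X n \<in> L}) = 1 - prob {X. \<exists>n\<ge>1. X n \<in> L}"
    by (rule prob_compl)
  moreover have "space (srw_law E x) - {X. \<exists>n\<ge>1. X n \<in> L} = {X. \<forall>n\<ge>1. X n \<notin> L}" by auto
  ultimately show ?thesis by simp
qed

lemma Pr_partition:
  assumes S: "finite S" and Q: "\<And>s. s \<in> S \<Longrightarrow> Measurable.pred Path (Q s)"
    and P: "Measurable.pred Path P"
    and disj: "\<And>X s t. s \<in> S \<Longrightarrow> t \<in> S \<Longrightarrow> Q s X \<Longrightarrow> Q t X \<Longrightarrow> s = t"
    and eq: "AE X in srw_law E x. P X \<longleftrightarrow> (\<exists>s\<in>S. Q s X)"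
  shows "Pr x P = (\<Sum>s\<in>S. Pr x (Q s))"
proof -
  have "measure (srw_law E x) (\<Union>s\<in>S. {X. Q s X}) = (\<Sum>s\<in>S. Pr x (Q s))"
  proof (rule finite_measure.finite_measure_finite_Union[OF finite_measure_walk S])
    show "(\<lambda>s. {X. Q s X}) ` S \<subseteq> sets (srw_law E x)"
      using Q by (intro image_subsetI sets_walk_pred) auto
    show "disjoint_family_on (\<lambda>s. {X. Q s X}) S"
      unfolding disjoint_family_on_def using disj by blast
  qed
  moreover have "(\<Union>s\<in>S. {X. Q s X}) = {X. \<exists>s\<in>S. Q s X}" by auto
  moreover have "Pr x P = Pr x (\<lambda>X. \<exists>s\<in>S. Q s X)"
    using eq P by (rule measure_srw_law_cong_AE) (use S Q in \<open>auto intro!: pred_intros_finite\<close>)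
  ultimately show ?thesis by simp
qed

subsection \<open>Capacity\<close>

lemma equilibrium_measure_eq:
  "x \<in> K \<Longrightarrow> finite K \<Longrightarrow> K \<subseteq> V \<Longrightarrow> equilibrium_measure E K x = 1 - (\<Sum>y\<in>K. entrance K x y)"
  using sum_entrance[of x K] by (auto simp: equilibrium_measure_def)

lemma capacity_aut:
  assumes f: "aut f" and K: "finite K" "K \<subseteq> V"
  shows "capacity E (f ` K) = capacity E K"
proof -
  have inj: "inj_on f K" using aut_inj[OF f] by (rule inj_on_subset) auto
  have "f ` K \<subseteq> V" using K aut_V_iff[OF f] by auto
  then have "equilibrium_measure E (f ` K) (f x) = equilibrium_measure E K x" if "x \<in> K" for x
    using that K inj by (simp add: equilibrium_measure_eq sum.reindex entrance_aut[OF f])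
  then show ?thesis
    by (simp add: capacity_def sum.reindex[OF inj])
qed

text \<open>Stop a walk that avoids \<open>K\<close> at its first visit to \<open>insert x K\<close>
  after time zero: either there is none, or it is a visit to \<open>x\<close> and the continuation
  from \<open>x\<close> has to avoid \<open>K\<close> as well.\<close>

lemma avoid_split:
  assumes z: "z \<in> V" and x: "x \<in> V" "x \<notin> K" and K: "finite K" "K \<subseteq> V"
  shows "Pr z (\<lambda>X. \<forall>n\<ge>1. X n \<notin> K) = Pr z (\<lambda>X. \<forall>n\<ge>1. X n \<notin> insert x K) +
    entrance (insert x K) z x * Pr x (\<lambda>X. \<forall>n. X n \<notin> K)"
proof -
  let ?L = "insert x K"
  define B where "B = {X :: nat \<Rightarrow> 'v. \<forall>n. X n \<notin> K}"
  have B [measurable]: "B \<in> sets Path" unfolding B_def by (rule sets_Path_pred) measurable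
  \<comment> \<open>Both alternatives form one family indexed by \<open>bool\<close>, in the shape
    required by \<open>Pr_partition\<close>.\<close>
  define Q where "Q b X \<longleftrightarrow> (if b then \<forall>n\<ge>1. X n \<notin> ?L
    else \<exists>n. X (Suc n) = x \<and> (\<forall>i\<in>{1..n}. X i \<notin> ?L) \<and> shift (Suc n) X \<in> B)" for b X
  have Q_simps: "Q True = (\<lambda>X. \<forall>n\<ge>1. X n \<notin> ?L)"
    "Q False = (\<lambda>X. \<exists>n. X (Suc n) = x \<and> (\<forall>i\<in>{1..n}. X i \<notin> ?L) \<and> shift (Suc n) X \<in> B)"
    by (auto simp: Q_def fun_eq_iff)
  have "Pr z (\<lambda>X. \<forall>n\<ge>1. X n \<notin> K) = (\<Sum>b\<in>{True, False}. Pr z (Q b))"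
  proof (rule Pr_partition)
    show "Measurable.pred Path (Q b)" for b
      by (cases b) (simp_all only: Q_simps, measurable)
    have disj: "\<not> (Q True X \<and> Q False X)" for X
      unfolding Q_simps by (metis insertI1 le_add1 plus_1_eq_Suc)
    show "s = t" if "Q s X" "Q t X" for s t X
      using that disj by (cases s; cases t) auto
    have "(\<forall>n\<ge>1. X n \<notin> K) \<longleftrightarrow> (\<exists>b\<in>{True, False}. Q b X)" for X
    proof
      assume X: "\<forall>n\<ge>1. X n \<notin> K"
      show "\<exists>b\<in>{True, False}. Q b X"
      proof (cases "\<exists>n\<ge>1. X n \<in> ?L")
        case True
        then obtain n where n: "X (Suc n) \<in> ?L" "\<forall>i\<in>{1..n}. X i \<notin> ?L"
          unfolding exists_first_entrance by blast
        then have "X (Suc n) = x" using X by auto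
        then have "Q False X" unfolding Q_simps B_def using n X by auto
        then show ?thesis by blast
      next
        case False
        then have "Q True X" unfolding Q_simps by blast
        then show ?thesis by blast
      qed
    next
      assume "\<exists>b\<in>{True, False}. Q b X"
      then consider "Q True X" | "Q False X" by auto
      then show "\<forall>n\<ge>1. X n \<notin> K"
      proof cases
        case 2
        then obtain n where n: "X (Suc n) = x" "\<forall>i\<in>{1..n}. X i \<notin> ?L" "shift (Suc n) X \<in> B"
          unfolding Q_simps by blast
        show ?thesis
        proof (intro allI impI)
          fix m :: nat assume "m \<ge> 1"
          show "X m \<notin> K"
          proof (cases "m \<le> n")
            case True
            then show ?thesis using n(2) \<open>m \<ge> 1\<close> by auto
          next
            case False
            then have "X ((m - Suc n) + Suc n) \<notin> K" using n(3) unfolding B_def by blast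
            then show ?thesis using False by simp
          qed
        qed
      qed (auto simp: Q_simps)
    qed
    then show "AE X in srw_law E z. (\<forall>n\<ge>1. X n \<notin> K) \<longleftrightarrow> (\<exists>b\<in>{True, False}. Q b X)" by simp
  qed auto
  also have "\<dots> = Pr z (Q True) + Pr z (Q False)" by simp
  also have "Pr z (Q False) = entrance ?L z x * measure (srw_law E x) B"
    unfolding Q_simps using z x(1) K by (intro entrance_at) auto
  finally show ?thesis by (simp only: Q_simps(1) B_def)
qed

lemma Pr_avoid_from_0:
  assumes "x \<notin> K"
  shows "Pr x (\<lambda>X. \<forall>n. X n \<notin> K) = Pr x (\<lambda>X. \<forall>n\<ge>1. X n \<notin> K)"
proof (rule measure_srw_law_cong_AE)
  show "AE X in srw_law E x. (\<forall>n. X n \<notin> K) \<longleftrightarrow> (\<forall>n\<ge>1. X n \<notin> K)"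
    using srw_law_0[where E = E and x = x]
  proof eventually_elim
    case (elim X)
    have "X n \<notin> K" if "\<forall>n\<ge>1. X n \<notin> K" for n
      using that assms elim by (cases n) auto
    then show ?case by blast
  qed
qed measurable

text \<open>Reversibility enters through the symmetry of \<^const>\<open>entrance\<close>: the probability that a walk
  from \<open>K\<close> first returns to \<open>insert x K\<close> at \<open>x\<close>, summed over \<open>K\<close>, is the
  probability that a walk from \<open>x\<close> first returns to \<open>insert x K\<close> in \<open>K\<close>.\<close>

lemma capacity_insert:
  assumes x: "x \<in> V" "x \<notin> K" and K: "finite K" "K \<subseteq> V"
  shows "capacity E (insert x K) = capacity E K +
    equilibrium_measure E (insert x K) x * Pr x (\<lambda>X. \<forall>n. X n \<notin> K)"
proof -
  let ?L = "insert x K"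
  have L: "finite ?L" "?L \<subseteq> V" using x K by auto
  define e where "e = equilibrium_measure E ?L x"
  define h where "h = Pr x (\<lambda>X. \<forall>n. X n \<notin> K)"
  define r where "r = entrance ?L x x"
  define s where "s = (\<Sum>z\<in>K. entrance ?L x z)"
  have e1: "e = 1 - r - s"
    using equilibrium_measure_eq[of x ?L] L x K by (simp add: e_def r_def s_def)
  have eL: "e = Pr x (\<lambda>X. \<forall>n\<ge>1. X n \<notin> ?L)" by (simp add: e_def equilibrium_measure_def)
  \<comment> \<open>A walk from \<open>x\<close> that avoids \<open>K\<close> either never returns
    to \<open>?L\<close>, or it first returns at \<open>x\<close> and starts afresh.\<close>
  have h: "h = e + r * h"
    using avoid_split[OF x(1) x K] eL Pr_avoid_from_0[OF x(2)] by (simp add: h_def r_def)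
  have "equilibrium_measure E K z = equilibrium_measure E ?L z + entrance ?L z x * h" if "z \<in> K" for z
    using avoid_split[OF _ x K, of z] that K by (auto simp: equilibrium_measure_def h_def)
  then have "capacity E K = (\<Sum>z\<in>K. equilibrium_measure E ?L z) + (\<Sum>z\<in>K. entrance ?L z x) * h"
    by (simp add: capacity_def sum.distrib sum_distrib_right)
  also have "(\<Sum>z\<in>K. entrance ?L z x) = s"
    unfolding s_def by (intro sum.cong entrance_sym refl)
  finally have "capacity E K = (\<Sum>z\<in>K. equilibrium_measure E ?L z) + s * h" .
  moreover have "capacity E ?L = (\<Sum>z\<in>K. equilibrium_measure E ?L z) + e"
    using x K by (simp add: capacity_def e_def)
  \<comment> \<open>With \<open>e = 1 - r - s\<close> the return probability \<open>r\<close>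
    disappears: passing from \<open>K\<close> to \<open>?L\<close>, the capacity loses
    \<open>s * h\<close> on \<open>K\<close> and gains \<open>e\<close> at \<open>x\<close>, a net
    change of \<open>e * h\<close>.\<close>
  moreover have "e = s * h + e * h"
    using h unfolding e1 by (simp add: algebra_simps)
  ultimately show ?thesis by (simp add: e_def h_def)
qed

subsection \<open>Transition probabilities\<close>

abbreviation trans_prob :: "nat \<Rightarrow> 'v \<Rightarrow> 'v \<Rightarrow> real" where
  "trans_prob n x y \<equiv> Pr x (\<lambda>X. X n = y)"

lemma trans_prob_0: "trans_prob 0 x y = (if x = y then 1 else 0)"
proof -
  have "Pr x (\<lambda>X. X 0 = y) = Pr x (\<lambda>X. x = y)"
    using srw_law_0[where E = E and x = x] by (intro measure_srw_law_cong_AE) auto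
  then show ?thesis by simp
qed

lemma trans_prob_Suc: "x \<in> V \<Longrightarrow> y \<in> V \<Longrightarrow> trans_prob (Suc n) x y = taboo {} n x y"
  using markov_taboo[of x y UNIV n "{}"] sets.top[of Path] by simp

lemma trans_prob_sym: "x \<in> V \<Longrightarrow> y \<in> V \<Longrightarrow> trans_prob n x y = trans_prob n y x"
  by (cases n) (auto simp: trans_prob_0 trans_prob_Suc intro: taboo_sym)

lemma trans_prob_aut: "aut f \<Longrightarrow> x \<in> V \<Longrightarrow> y \<in> V \<Longrightarrow> trans_prob n (f x) (f y) = trans_prob n x y"
  using taboo_aut[of f "{}" _ x y]
  by (cases n) (auto simp: trans_prob_0 trans_prob_Suc aut_V_iff inj_eq aut_inj)

lemma AE_walk_ball:
  assumes "x \<in> V"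
  shows "AE X in srw_law E x. \<forall>n. X n \<in> gball n x"
  using AE_walk[OF assms]
proof eventually_elim
  case (elim X)
  have "X n \<in> gball n x" for n
    by (induction n) (use elim in \<open>auto simp: gball_Suc\<close>)
  then show ?case by blast
qed

lemma chapman_kolmogorov:
  assumes "x \<in> V" "y \<in> V" "finite S" "gball m x \<subseteq> S" "S \<subseteq> V"
  shows "trans_prob (m + n) x y = (\<Sum>z\<in>S. trans_prob m x z * trans_prob n z y)"
\<comment> \<open>Time zero is separate because \<open>markov_taboo\<close> speaks of positive
  times.\<close>
proof (cases m)
  case 0
  then have "x \<in> S" using assms(4) by auto
  then have "(\<Sum>z\<in>S. trans_prob m x z * trans_prob n z y) =
      (\<Sum>z\<in>S. if z = x then trans_prob n z y else 0)"
    using 0 by (intro sum.cong) (auto simp: trans_prob_0)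
  then show ?thesis using 0 \<open>x \<in> S\<close> assms(3) by simp
next
  case (Suc k)
  define B where "B = {X :: nat \<Rightarrow> 'v. X n = y}"
  have B [measurable]: "B \<in> sets Path" unfolding B_def by (rule sets_Path_pred) measurable
  have "trans_prob (m + n) x y = (\<Sum>z\<in>S. Pr x (\<lambda>X. X (Suc k) = z \<and> (\<forall>i\<in>{1..k}. X i \<notin> {}) \<and> shift (Suc k) X \<in> B))"
  proof (rule Pr_partition[OF assms(3)])
    show "AE X in srw_law E x. X (m + n) = y \<longleftrightarrow>
        (\<exists>z\<in>S. X (Suc k) = z \<and> (\<forall>i\<in>{1..k}. X i \<notin> {}) \<and> shift (Suc k) X \<in> B)"
      using AE_walk_ball[OF assms(1)]
    proof eventually_elim
      case (elim X)
      then have "X (Suc k) \<in> S" using assms(4) Suc by auto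
      then show ?case by (auto simp: B_def Suc add.commute)
    qed
    show "Measurable.pred Path (\<lambda>X. X (Suc k) = z \<and> (\<forall>i\<in>{1..k}. X i \<notin> {}) \<and> shift (Suc k) X \<in> B)" for z
      by measurable
    show "Measurable.pred Path (\<lambda>X. X (m + n) = y)" by measurable
  qed blast
  also have "\<dots> = (\<Sum>z\<in>S. taboo {} k x z * measure (srw_law E z) B)"
    using assms by (intro sum.cong markov_taboo) auto
  also have "\<dots> = (\<Sum>z\<in>S. trans_prob m x z * trans_prob n z y)"
  proof (rule sum.cong)
    fix z assume "z \<in> S"
    then have "trans_prob (Suc k) x z = taboo {} k x z" using assms by (intro trans_prob_Suc) auto
    then show "taboo {} k x z * measure (srw_law E z) B = trans_prob m x z * trans_prob n z y"
      by (simp only: Suc B_def)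
  qed simp
  finally show ?thesis .
qed

text \<open>By reversibility the left side is the inner product of the \<open>n\<close>-step
  distributions from \<open>x\<close> and from \<open>y\<close>. Bounding products by squares leaves
  diagonal terms, and these agree at all vertices by transitivity.\<close>

lemma trans_prob_even_le:
  assumes "x \<in> V" "y \<in> V" "w \<in> V"
  shows "trans_prob (n + n) x y \<le> trans_prob (n + n) w w"
proof -
  let ?S = "gball n x \<union> gball n y"
  have S: "finite ?S" "?S \<subseteq> V" using assms gball_subset_V by auto
  have diag: "trans_prob (n + n) v v = trans_prob (n + n) w w" if v: "v \<in> V" for v
  proof -
    obtain f where "aut f" "f w = v" by (rule ex_aut[OF assms(3) v])
    then show ?thesis using trans_prob_aut[of f w w] assms(3) by auto
  qed
  have sq: "trans_prob (n + n) v v = (\<Sum>z\<in>?S. (trans_prob n v z)\<^sup>2)" if "v \<in> {x, y}" for v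
  proof -
    have "trans_prob (n + n) v v = (\<Sum>z\<in>?S. trans_prob n v z * trans_prob n z v)"
      using that assms S by (intro chapman_kolmogorov) auto
    also have "\<dots> = (\<Sum>z\<in>?S. (trans_prob n v z)\<^sup>2)"
      unfolding power2_eq_square
      using that S(2) assms by (intro sum.cong arg_cong2[of _ _ _ _ "(*)"] trans_prob_sym refl) auto
    finally show ?thesis .
  qed
  have "trans_prob (n + n) x y = (\<Sum>z\<in>?S. trans_prob n x z * trans_prob n z y)"
    using assms S by (intro chapman_kolmogorov) auto
  also have "\<dots> = (\<Sum>z\<in>?S. trans_prob n x z * trans_prob n y z)"
    using S(2) assms by (intro sum.cong arg_cong2[of _ _ _ _ "(*)"] trans_prob_sym refl) auto
  also have "\<dots> \<le> (\<Sum>z\<in>?S. ((trans_prob n x z)\<^sup>2 + (trans_prob n y z)\<^sup>2) / 2)"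
  proof (rule sum_mono)
    fix z
    show "trans_prob n x z * trans_prob n y z \<le> ((trans_prob n x z)\<^sup>2 + (trans_prob n y z)\<^sup>2) / 2"
      using sum_squares_bound[of "trans_prob n x z" "trans_prob n y z"] by simp
  qed
  also have "\<dots> = (trans_prob (n + n) x x + trans_prob (n + n) y y) / 2"
    unfolding sq[OF insertI1] sq[OF insertI2[OF singletonI]]
    by (simp only: sum.distrib sum_divide_distrib[symmetric])
  also have "\<dots> = trans_prob (n + n) w w"
    by (subst diag[OF assms(1)], subst diag[OF assms(2)]) simp
  finally show ?thesis .
qed

text \<open>Averaging over the first step reduces odd times to even ones. Diagonal terms at odd
  times would be no bound, since they vanish on bipartite graphs.\<close>

lemma trans_prob_odd_le:
  assumes "x \<in> V" "y \<in> V" "w \<in> V"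
  shows "trans_prob (Suc (n + n)) x y \<le> trans_prob (n + n) w w"
proof -
  have S: "finite (gball 1 x)" "gball 1 x \<subseteq> V" using assms gball_subset_V by auto
  have "trans_prob (1 + (n + n)) x y = (\<Sum>z\<in>gball 1 x. trans_prob 1 x z * trans_prob (n + n) z y)"
    using assms S by (intro chapman_kolmogorov) auto
  also have "\<dots> \<le> (\<Sum>z\<in>gball 1 x. trans_prob 1 x z * trans_prob (n + n) w w)"
    using assms S by (intro sum_mono mult_left_mono trans_prob_even_le) auto
  also have "\<dots> = (\<Sum>z\<in>gball 1 x. trans_prob 1 x z) * trans_prob (n + n) w w"
    by (simp add: sum_distrib_right)
  also have "(\<Sum>z\<in>gball 1 x. trans_prob 1 x z) = Pr x (\<lambda>_. True)"
  proof (rule Pr_partition[symmetric])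
    show "AE X in srw_law E x. True \<longleftrightarrow> (\<exists>s\<in>gball 1 x. X 1 = s)"
      using AE_walk_ball[OF assms(1)] by eventually_elim auto
    show "Measurable.pred Path (\<lambda>X. X 1 = z)" for z by measurable
  qed auto
  finally show ?thesis by simp
qed

end

section \<open>Transience\<close>

locale transient_vt_graph = vt_graph V E for V :: "'v set" and E :: "('v \<times> 'v) set" +
  assumes transient: "transient_graph V E"
begin

section \<open>Summability of return probabilities\<close>

lemma return_prob_less_1: "x \<in> V \<Longrightarrow> entrance {x} x x < 1"
proof -
  assume x: "x \<in> V"
  have "Pr x (\<lambda>X. \<exists>n\<ge>1. X n = x) < 1" using transient x by (simp add: transient_graph_def)
  moreover have "Pr x (\<lambda>X. \<exists>n\<ge>1. X n = x) = entrance {x} x x"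
    using first_entrance[OF x, of "{x}", OF _ _ sets.top] x exists_first_entrance[of _ "{x}"]
    unfolding space_Path by simp
  ultimately show ?thesis by simp
qed

lemma equilibrium_measure_singleton_pos: "x \<in> V \<Longrightarrow> equilibrium_measure E {x} x > 0"
  using return_prob_less_1[of x] equilibrium_measure_eq[of x "{x}"] by simp

lemma renewal:
  assumes x: "x \<in> V"
  shows "trans_prob (Suc n) x x = (\<Sum>k\<le>n. taboo {x} k x x * trans_prob (n - k) x x)"
proof -
  have B [measurable]: "{X. X (n - k) = x} \<in> sets Path" for k
    by (rule sets_Path_pred) measurable
  define Q where "Q k X \<longleftrightarrow> X (Suc k) = x \<and> (\<forall>i\<in>{1..k}. X i \<notin> {x}) \<and> shift (Suc k) X \<in> {X. X (n - k) = x}"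
    for k X
  have "trans_prob (Suc n) x x = (\<Sum>k\<in>{..n}. Pr x (Q k))"
  proof (rule Pr_partition)
    show "Measurable.pred Path (Q k)" for k unfolding Q_def by measurable
    have no: False if "Q k X" "Q l X" "k < l" for k l X
    proof -
      have "Suc k \<in> {1..l}" using that(3) by auto
      then show False using that(1,2) unfolding Q_def by blast
    qed
    show "k = l" if "Q k X" "Q l X" for k l X
      using no[of k X l] no[of l X k] that by (cases k l rule: linorder_cases) auto
    have "X (Suc n) = x \<longleftrightarrow> (\<exists>k\<in>{..n}. Q k X)" for X
    proof
      assume n: "X (Suc n) = x"
      define k where "k = (LEAST k. X (Suc k) = x)"
      have k: "X (Suc k) = x" unfolding k_def using n by (rule LeastI)
      have "k \<le> n" unfolding k_def using n by (rule Least_le)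
      moreover have "X i \<noteq> x" if "i \<in> {1..k}" for i
      proof -
        obtain j where "i = Suc j" "j < k" using \<open>i \<in> {1..k}\<close> by (cases i) auto
        then show ?thesis using not_less_Least[of j "\<lambda>k. X (Suc k) = x"] unfolding k_def by blast
      qed
      ultimately have "Q k X" using k n by (auto simp: Q_def)
      with \<open>k \<le> n\<close> show "\<exists>k\<in>{..n}. Q k X" by auto
    qed (auto simp: Q_def)
    then show "AE X in srw_law E x. X (Suc n) = x \<longleftrightarrow> (\<exists>k\<in>{..n}. Q k X)" by blast
    show "Measurable.pred Path (\<lambda>X. X (Suc n) = x)" by measurable
  qed auto
  also have "\<dots> = (\<Sum>k\<in>{..n}. taboo {x} k x x * trans_prob (n - k) x x)"
    unfolding Q_def by (intro sum.cong refl markov_taboo x B)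
  finally show ?thesis .
qed

text \<open>Renewal at the first return gives \<open>S (Suc N) \<le> 1 + \<rho> * S N\<close> for
  the partial sums; as \<open>\<rho> < 1\<close> by transience, they stay below
  \<open>1 / (1 - \<rho>)\<close>.\<close>

lemma summable_trans_prob_diag:
  assumes x: "x \<in> V"
  shows "summable (\<lambda>n. trans_prob n x x)"
proof (rule summableI_nonneg_bounded)
  define \<rho> where "\<rho> = entrance {x} x x"
  have \<rho>: "\<rho> < 1" unfolding \<rho>_def by (rule return_prob_less_1[OF x])
  have summ: "summable (\<lambda>k. taboo {x} k x x)"
    using x by (intro summable_taboo[OF _ _ _ sets.top]) auto
  define S where "S N = (\<Sum>n<N. trans_prob n x x)" for N
  have S0: "S N \<ge> 0" for N unfolding S_def by (intro sum_nonneg) auto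
  have rec: "S (Suc N) \<le> 1 + \<rho> * S N" for N
  proof -
    have "S (Suc N) = 1 + (\<Sum>n<N. trans_prob (Suc n) x x)"
      unfolding S_def by (subst sum.lessThan_Suc_shift) (simp add: trans_prob_0)
    also have "(\<Sum>n<N. trans_prob (Suc n) x x) = (\<Sum>n<N. \<Sum>k\<le>n. taboo {x} k x x * trans_prob (n - k) x x)"
      by (simp only: renewal[OF x])
    also have "\<dots> = (\<Sum>(k,j)\<in>{(k,j). k + j < N}. taboo {x} k x x * trans_prob j x x)"
      by (rule sum.triangle_reindex[symmetric])
    \<comment> \<open>The triangle \<open>k + j < N\<close> is enlarged to a square, where the sum
      factorises.\<close>
    also have "\<dots> \<le> (\<Sum>(k,j)\<in>{..<N} \<times> {..<N}. taboo {x} k x x * trans_prob j x x)"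
      by (intro sum_mono2) (auto intro!: mult_nonneg_nonneg taboo_nonneg)
    also have "\<dots> = (\<Sum>k<N. taboo {x} k x x) * S N"
      by (simp add: S_def sum_product sum.cartesian_product)
    also have "\<dots> \<le> \<rho> * S N"
      unfolding \<rho>_def entrance_def
      by (intro mult_right_mono sum_le_suminf summ S0) (auto intro: taboo_nonneg)
    finally show ?thesis by simp
  qed
  have "S N \<le> 1 / (1 - \<rho>)" for N
  proof -
    have \<rho>0: "\<rho> \<ge> 0" unfolding \<rho>_def using x by (intro entrance_nonneg) auto
    have "S N \<le> S (Suc N)" by (simp add: S_def)
    also have "\<dots> \<le> 1 + \<rho> * S N" by (rule rec)
    finally have "S N * (1 - \<rho>) \<le> 1" by (simp add: algebra_simps)
    then show ?thesis using \<rho> by (simp add: pos_le_divide_eq)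
  qed
  then show "(\<Sum>n<N. trans_prob n x x) \<le> 1 / (1 - \<rho>)" for N
    by (simp add: S_def)
qed auto

text \<open>One summable sequence dominates all transition probabilities at once, so the hitting
  estimates below are uniform in the two vertices.\<close>

lemma trans_prob_uniform_bound:
  obtains a where "summable a" "\<And>n. a n \<ge> 0" "\<And>n x y. x \<in> V \<Longrightarrow> y \<in> V \<Longrightarrow> trans_prob n x y \<le> a n"
proof -
  obtain w where w: "w \<in> V" using V_nonempty by auto
  define p where "p n = trans_prob n w w" for n
  have p: "summable p" "p n \<ge> 0" for n
    unfolding p_def using summable_trans_prob_diag[OF w] by auto
  \<comment> \<open>An even time is bounded by its own return probability, an odd time by the
    preceding one; the sum of both covers either parity.\<close>
  define a where "a n = p n + p (n - 1)" for n
  have "summable (\<lambda>n. p (Suc n - 1))" using p by simp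
  then have "summable (\<lambda>n. p (n - 1))" by (subst (asm) summable_Suc_iff)
  then have "summable a" unfolding a_def using p by (intro summable_add) auto
  moreover have "a n \<ge> 0" for n unfolding a_def using p(2) by (intro add_nonneg_nonneg)
  moreover have "trans_prob n x y \<le> a n" if "x \<in> V" "y \<in> V" for n x y
  proof (cases "even n")
    case True
    then obtain k where "n = k + k" by (metis evenE mult_2)
    then have "trans_prob n x y \<le> p n" using trans_prob_even_le[OF that w] by (simp add: p_def)
    then show ?thesis using p(2)[of "n - 1"] by (simp add: a_def)
  next
    case False
    then obtain k where "n = Suc (k + k)" by (metis oddE mult_2 Suc_eq_plus1)
    then have "trans_prob n x y \<le> p (n - 1)" using trans_prob_odd_le[OF that w] by (simp add: p_def)
    then show ?thesis using p(2)[of n] by (simp add: a_def)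
  qed
  ultimately show ?thesis by (rule that)
qed

abbreviation hit :: "'v \<Rightarrow> 'v \<Rightarrow> real" where
  "hit x y \<equiv> Pr x (\<lambda>X. \<exists>n. X n = y)"

text \<open>A vertex outside the ball of radius \<open>R\<close> is not reached by time
  \<open>R\<close>, so hitting it costs at most a tail of the summable bound.\<close>

lemma hit_far_small:
  assumes "\<epsilon> > 0"
  obtains R where "\<And>x y. x \<in> V \<Longrightarrow> y \<in> V \<Longrightarrow> y \<notin> gball R x \<Longrightarrow> hit x y < \<epsilon>"
proof -
  obtain a where a: "summable a" "\<And>n. a n \<ge> 0"
    "\<And>n x y. x \<in> V \<Longrightarrow> y \<in> V \<Longrightarrow> trans_prob n x y \<le> a n"
    using trans_prob_uniform_bound by blast
  obtain R where R: "norm (\<Sum>i. a (i + R)) < \<epsilon>"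
    using suminf_exist_split[OF assms a(1)] by auto
  show ?thesis
  proof (rule that[of R])
    fix x y assume xy: "x \<in> V" "y \<in> V" "y \<notin> gball R x"
    let ?A = "\<lambda>n. {X. X (n + R) = y}"
    have sa: "summable (\<lambda>n. a (n + R))" using a(1) by (rule summable_ignore_initial_segment)
    have s: "summable (\<lambda>n. measure (srw_law E x) (?A n))"
      using sa by (rule summable_comparison_test') (use a(3)[OF xy(1,2)] in auto)
    have "hit x y = Pr x (\<lambda>X. \<exists>n. X (n + R) = y)"
    proof (rule measure_srw_law_cong_AE)
      show "AE X in srw_law E x. (\<exists>n. X n = y) \<longleftrightarrow> (\<exists>n. X (n + R) = y)"
        using AE_walk_ball[OF xy(1)]
      proof eventually_elim
        case (elim X)
        have "\<exists>m. X (m + R) = y" if "X n = y" for n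
        proof -
          have "n > R" using elim that xy(3) gball_mono[of n R x] by (metis linorder_not_le subset_iff)
          then have "X ((n - R) + R) = y" using that by simp
          then show ?thesis by blast
        qed
        then show ?case by blast
      qed
    qed measurable
    also have "{X. \<exists>n. X (n + R) = y} = (\<Union>n. ?A n)" by auto
    also have "measure (srw_law E x) (\<Union>n. ?A n) \<le> (\<Sum>n. measure (srw_law E x) (?A n))"
    proof (rule finite_measure.finite_measure_subadditive_countably[OF finite_measure_walk _ s])
      show "range ?A \<subseteq> sets (srw_law E x)"
        by (intro image_subsetI sets_walk_pred) measurable
    qed
    also have "\<dots> \<le> (\<Sum>n. a (n + R))" by (intro suminf_le a(3) xy s sa)
    also have "\<dots> < \<epsilon>" using R by simp
    finally show "hit x y < \<epsilon>" .
  qed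
qed

text \<open>The expected number of visits is finite, so Borel-Cantelli applies at each of the
  countably many vertices.\<close>

lemma AE_finite_visits: "x \<in> V \<Longrightarrow> AE X in srw_law E x. \<forall>y\<in>V. finite {n. X n = y}"
proof -
  assume x: "x \<in> V"
  obtain a where a: "summable a" "\<And>n. a n \<ge> 0"
    "\<And>n x y. x \<in> V \<Longrightarrow> y \<in> V \<Longrightarrow> trans_prob n x y \<le> a n"
    using trans_prob_uniform_bound by blast
  have "AE X in srw_law E x. finite {n. X n = y}" if y: "y \<in> V" for y
  proof -
    have "AE X in srw_law E x. \<forall>\<^sub>F n in sequentially. X \<in> space (srw_law E x) - {X. X n = y}"
    proof (rule borel_cantelli_AE1)
      show "{X. X n = y} \<in> sets (srw_law E x)" for n
        by (rule sets_walk_pred) measurable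
      show "emeasure (srw_law E x) {X. X n = y} < \<infinity>" for n
        by (simp add: finite_measure.emeasure_eq_measure[OF finite_measure_walk])
      show "summable (\<lambda>n. trans_prob n x y)"
        using a(1) by (rule summable_comparison_test') (use a(3)[OF x y] in auto)
    qed
    then show ?thesis
    proof eventually_elim
      case (elim X)
      then obtain N where "\<And>n. n \<ge> N \<Longrightarrow> X n \<noteq> y" by (auto simp: eventually_sequentially)
      then have "{n. X n = y} \<subseteq> {..<N}"         using linorder_not_le by blast
      then show ?case by (rule finite_subset) simp
    qed
  qed
  then show ?thesis using countable_V by (simp add: AE_ball_countable)
qed

lemma infinite_range_if_finite_visits:
  fixes X :: "nat \<Rightarrow> 'v"
  assumes "\<forall>y\<in>V. finite {n. X n = y}" "\<forall>n. X n \<in> V"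
  shows "infinite (X ` {m..})"
proof
  assume fin: "finite (X ` {m..})"
  have "{m..} \<subseteq> (\<Union>y\<in>X ` {m..}. {n. X n = y})" by auto
  moreover have "finite (\<Union>y\<in>X ` {m..}. {n. X n = y})"
    by (rule finite_UN_I[OF fin]) (use assms in auto)
  ultimately have "finite {m..}" by (rule finite_subset)
  then show False using infinite_Ici[of m] by blast
qed

lemma ex_last_visit:
  fixes X :: "nat \<Rightarrow> 'v"
  assumes "finite {n. X n = y}" "X n = y"
  obtains t where "X t = y" "t \<ge> n" "\<And>s. s > t \<Longrightarrow> X s \<noteq> y"
proof (rule that[of "Max {n. X n = y}"])
  show "X (Max {n. X n = y}) = y" using Max_in[OF assms(1)] assms(2) by auto
  show "n \<le> Max {n. X n = y}" using assms by (intro Max_ge) auto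
  show "X s \<noteq> y" if "s > Max {n. X n = y}" for s
  proof
    assume "X s = y"
    then have "s \<le> Max {n. X n = y}" by (intro Max_ge[OF assms(1)]) simp
    with that show False by simp
  qed
qed

subsection \<open>Capacity of distant sets\<close>

lemma hit_set_le:
  assumes "finite K"
  shows "Pr x (\<lambda>X. \<exists>n. X n \<in> K) \<le> (\<Sum>y\<in>K. hit x y)"
proof -
  have "Pr x (\<lambda>X. \<exists>n. X n \<in> K) = measure (srw_law E x) (\<Union>y\<in>K. {X. \<exists>n. X n = y})"
    by (rule arg_cong[of _ _ "measure (srw_law E x)"]) auto
  also have "\<dots> \<le> (\<Sum>y\<in>K. hit x y)"
  proof (rule finite_measure.finite_measure_subadditive_finite[OF finite_measure_walk assms])
    show "(\<lambda>y. {X. \<exists>n. X n = y}) ` K \<subseteq> sets (srw_law E x)"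
      by (intro image_subsetI sets_walk_pred) measurable
  qed
  finally show ?thesis .
qed

lemma Pr_diff_le:
  assumes "\<And>X. P X \<Longrightarrow> Q X \<or> R X" "Measurable.pred Path Q" "Measurable.pred Path R"
  shows "Pr x P \<le> Pr x Q + Pr x R"
proof -
  have "Pr x P \<le> Pr x (\<lambda>X. Q X \<or> R X)"
    using assms by (intro Pr_mono pred_intros_logic) auto
  also have "{X. Q X \<or> R X} = {X. Q X} \<union> {X. R X}" by auto
  also have "measure (srw_law E x) \<dots> \<le> Pr x Q + Pr x R"
    using assms by (intro measure_Un_le sets_walk_pred)
  finally show ?thesis .
qed

lemma equilibrium_measure_Un_le:
  assumes "x \<in> K"
  shows "equilibrium_measure E (K \<union> K') x \<le> equilibrium_measure E K x"
  using assms by (auto simp: equilibrium_measure_def intro!: Pr_mono) 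

lemma equilibrium_measure_Un_ge:
  assumes "x \<in> K" "finite K'"
  shows "equilibrium_measure E (K \<union> K') x \<ge> equilibrium_measure E K x - (\<Sum>y\<in>K'. hit x y)"
proof -
  have "Pr x (\<lambda>X. \<forall>n\<ge>1. X n \<notin> K) \<le> Pr x (\<lambda>X. \<forall>n\<ge>1. X n \<notin> K \<union> K') + Pr x (\<lambda>X. \<exists>n. X n \<in> K')"
    by (rule Pr_diff_le) (auto, measurable)
  also note hit_set_le[OF assms(2)]
  finally show ?thesis using assms by (simp add: equilibrium_measure_def)
qed

text \<open>Enlarging \<open>K\<close> by \<open>K'\<close> lowers each escape probability from
  \<open>K\<close> by at most the probability of hitting \<open>K'\<close>. Either set contributes
  an error of at most \<open>card K * card K' * \<epsilon>\<close>.\<close>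

lemma capacity_Un_far:
  fixes \<epsilon> :: real
  assumes K: "finite K" "finite K'" "K \<inter> K' = {}"
    and \<epsilon>: "\<And>x y. x \<in> K \<Longrightarrow> y \<in> K' \<Longrightarrow> hit x y \<le> \<epsilon>" "\<And>x y. x \<in> K \<Longrightarrow> y \<in> K' \<Longrightarrow> hit y x \<le> \<epsilon>"
  shows "\<bar>capacity E (K \<union> K') - (capacity E K + capacity E K')\<bar> \<le> 2 * card K * card K' * \<epsilon>"
proof -
  have *: "\<bar>(\<Sum>x\<in>K. equilibrium_measure E (K \<union> K') x) - capacity E K\<bar> \<le> card K * card K' * \<epsilon>"
    if K: "finite K'" and \<epsilon>: "\<And>x y. x \<in> K \<Longrightarrow> y \<in> K' \<Longrightarrow> hit x y \<le> \<epsilon>" for K K'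
  proof -
    have "\<bar>(\<Sum>x\<in>K. equilibrium_measure E (K \<union> K') x) - capacity E K\<bar> =
        \<bar>\<Sum>x\<in>K. equilibrium_measure E (K \<union> K') x - equilibrium_measure E K x\<bar>"
      by (simp add: capacity_def sum_subtractf)
    also have "\<dots> \<le> (\<Sum>x\<in>K. \<bar>equilibrium_measure E (K \<union> K') x - equilibrium_measure E K x\<bar>)"
      by (rule sum_abs)
    also have "\<dots> \<le> (\<Sum>x\<in>K. real (card K') * \<epsilon>)"
    proof (rule sum_mono)
      fix x assume x: "x \<in> K"
      have "(\<Sum>y\<in>K'. hit x y) \<le> card K' * \<epsilon>"
        using \<epsilon>[OF x] by (rule sum_bounded_above)
      then show "\<bar>equilibrium_measure E (K \<union> K') x - equilibrium_measure E K x\<bar> \<le> card K' * \<epsilon>"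
        using equilibrium_measure_Un_ge[OF x K] equilibrium_measure_Un_le[OF x, of K'] by simp
    qed
    finally show ?thesis by simp
  qed
  have "capacity E (K \<union> K') = (\<Sum>x\<in>K. equilibrium_measure E (K \<union> K') x) + (\<Sum>x\<in>K'. equilibrium_measure E (K' \<union> K) x)"
    unfolding capacity_def Un_commute[of K' K] using K by (intro sum.union_disjoint)
  then show ?thesis
    using *[of K' K] *[of K K'] K \<epsilon> by (simp add: algebra_simps)
qed

lemma ex_aut_far:
  assumes K: "finite K" "K \<subseteq> V" and K': "finite K'" "K' \<subseteq> V" and \<delta>: "\<delta> > 0"
  obtains f where "aut f" "K \<inter> f ` K' = {}"
    "\<And>x y. x \<in> K \<Longrightarrow> y \<in> f ` K' \<Longrightarrow> hit x y \<le> \<delta> \<and> hit y x \<le> \<delta>"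
proof -
  obtain R where R: "\<And>x y. x \<in> V \<Longrightarrow> y \<in> V \<Longrightarrow> y \<notin> gball R x \<Longrightarrow> hit x y < \<delta>"
    using hit_far_small[OF \<delta>] by blast
  obtain w where w: "w \<in> V" using V_nonempty by auto
  obtain r where r: "K \<union> K' \<subseteq> gball r w"
    using finite_subset_gball[OF w, of "K \<union> K'"] K K' by auto
  \<comment> \<open>Both sets have radius \<open>r\<close> around their centres and must end up more
    than \<open>R\<close> apart.\<close>
  obtain v where v: "v \<in> V" "v \<notin> gball (r + R + r) w"
    using infinite_V finite_gball[of "r + R + r" w] by (metis finite_subset subsetI)
  obtain f where f: "aut f" "f w = v" by (rule ex_aut[OF w v(1)])
  have far: "f y \<notin> gball R x" "x \<notin> gball R (f y)" if "x \<in> K" "y \<in> K'" for x y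
  proof -
    have x: "x \<in> gball r w" using r that by auto
    have "y \<in> gball r w" using r that by auto
    then have "f y \<in> gball r v" using aut_gball[OF f(1), of r w] f(2) by auto
    then have vy: "v \<in> gball r (f y)" by (simp add: gball_sym)
    show "f y \<notin> gball R x"
      using gball_trans[OF gball_trans[OF x] vy] v(2) by blast
    then show "x \<notin> gball R (f y)" by (simp add: gball_sym)
  qed
  have fV: "f ` K' \<subseteq> V" using K' aut_V_iff[OF f(1)] by auto
  have disj: "K \<inter> f ` K' = {}" using far gball_self by blast
  show ?thesis
  proof (rule that[OF f(1) disj])
    fix x y assume xy: "x \<in> K" "y \<in> f ` K'"
    then have "x \<in> V" "y \<in> V" "y \<notin> gball R x" "x \<notin> gball R y" using K fV far by auto
    then show "hit x y \<le> \<delta> \<and> hit y x \<le> \<delta>" using R less_imp_le by blast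
  qed
qed

text \<open>Points are added one at a time, so far away that the new point escapes with probability
  at least \<open>e / 2\<close> and avoids the old set with probability at least
  \<open>1 / 2\<close>; by \<open>capacity_insert\<close> each of them adds at least
  \<open>e / 4\<close>.\<close>

lemma capacity_infinite:
  assumes A: "A \<subseteq> V" "infinite A"
  shows "\<exists>K. finite K \<and> K \<subseteq> A \<and> capacity E K \<ge> c"
proof -
  obtain w where w: "w \<in> V" using V_nonempty by auto
  define e where "e = equilibrium_measure E {w} w"
  have e: "e > 0" unfolding e_def by (rule equilibrium_measure_singleton_pos[OF w])
  have e1: "e \<le> 1" unfolding e_def equilibrium_measure_def using Pr_le_1 by auto
  have ev: "equilibrium_measure E {v} v = e" if v: "v \<in> V" for v
  proof -
    obtain f where f: "aut f" "f w = v" by (rule ex_aut[OF w v])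
    show ?thesis using capacity_aut[OF f(1), of "{w}"] w f(2) by (simp add: capacity_def e_def)
  qed
  have step: "\<exists>v\<in>A. v \<notin> K \<and> capacity E (insert v K) \<ge> capacity E K + e / 4" if K: "finite K" "K \<subseteq> A" for K
  proof -
    \<comment> \<open>Chosen so that the new point hits \<open>K\<close> with probability at most
      \<open>card K * \<delta> \<le> e / 2\<close>; the denominator is positive also for empty
      \<open>K\<close>.\<close>
    define \<delta> where "\<delta> = e / (2 + 2 * card K)"
    have \<delta>: "\<delta> > 0" using e by (simp add: \<delta>_def add_pos_nonneg)
    obtain R where R: "\<And>x y. x \<in> V \<Longrightarrow> y \<in> V \<Longrightarrow> y \<notin> gball R x \<Longrightarrow> hit x y < \<delta>"
      using hit_far_small[OF \<delta>] by blast
    have "finite (\<Union>x\<in>K. gball R x)" using K by auto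
    then obtain v where v: "v \<in> A" "v \<notin> (\<Union>x\<in>K. gball R x)"
      using A(2) by (metis finite_subset subsetI)
    have vK: "v \<notin> K" using v(2) by auto
    have vV: "v \<in> V" using v A by auto
    have "hit v z \<le> \<delta>" if "z \<in> K" for z
      using R[of v z] v that A K vV by (auto simp: gball_sym[of z] intro!: less_imp_le)
    then have "(\<Sum>z\<in>K. hit v z) \<le> card K * \<delta>" by (rule sum_bounded_above)
    also have "\<dots> \<le> e / 2"
    proof -
      have "real (card K) * \<delta> = e / 2 * (card K / (1 + card K))"
        by (simp add: \<delta>_def field_simps)
      also have "\<dots> \<le> e / 2 * 1" using e by (intro mult_left_mono) (auto simp: divide_le_eq)
      finally show ?thesis by simp
    qed
    finally have s: "(\<Sum>z\<in>K. hit v z) \<le> e / 2" .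
    have "equilibrium_measure E ({v} \<union> K) v \<ge> e / 2"
      using equilibrium_measure_Un_ge[of v "{v}" K] K s ev[OF vV] by simp
    moreover have "Pr v (\<lambda>X. \<forall>n. X n \<notin> K) \<ge> 1 / 2"
    proof -
      have "Pr v (\<lambda>_. True) \<le> Pr v (\<lambda>X. \<forall>n. X n \<notin> K) + Pr v (\<lambda>X. \<exists>n. X n \<in> K)"
        by (rule Pr_diff_le) (auto, measurable)
      also note hit_set_le[OF K(1)]
      finally show ?thesis using s e1 by simp
    qed
    ultimately have "e / 2 * (1 / 2) \<le> equilibrium_measure E (insert v K) v * Pr v (\<lambda>X. \<forall>n. X n \<notin> K)"
      using e by (intro mult_mono) auto
    then have "capacity E (insert v K) \<ge> capacity E K + e / 4"
      using capacity_insert[OF vV vK K(1)] K A by auto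
    then show ?thesis using v vK by blast
  qed
  have "\<exists>K. finite K \<and> K \<subseteq> A \<and> capacity E K \<ge> n * (e / 4)" for n :: nat
  proof (induction n)
    case 0
    then show ?case by (intro exI[of _ "{}"]) (simp add: capacity_def)
  next
    case (Suc n)
    then obtain K where K: "finite K" "K \<subseteq> A" "capacity E K \<ge> n * (e / 4)" by auto
    with step[of K] obtain v where "v \<in> A" "capacity E (insert v K) \<ge> capacity E K + e / 4" by auto
    then show ?case using K by (intro exI[of _ "insert v K"]) (auto simp: algebra_simps)
  qed
  moreover obtain n where "real n \<ge> c / (e / 4)" using real_arch_simple by auto
  then have "n * (e / 4) \<ge> c" using e by (simp add: field_simps)
  ultimately show ?thesis by (meson order_trans)
qed

end

section \<open>Random configurations\<close>

text \<open>Later predicates on configurations contain almost sure statements about walks. To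
  iterate them, the inner statement must depend measurably on the configuration, which follows from
  measurability of the measure of sections.\<close>

lemma (in sigma_finite_measure) pred_AE:
  assumes "Measurable.pred (N \<Otimes>\<^sub>M M) (\<lambda>z. R (fst z) (snd z))"
  shows "Measurable.pred N (\<lambda>x. AE y in M. R x y)"
proof -
  define Q where "Q = {z \<in> space (N \<Otimes>\<^sub>M M). \<not> R (fst z) (snd z)}"
  have Q: "Q \<in> sets (N \<Otimes>\<^sub>M M)" unfolding Q_def using assms by measurable
  have "(AE y in M. R x y) \<longleftrightarrow> emeasure M (Pair x -` Q) = 0" if "x \<in> space N" for x
  proof (rule AE_iff_measurable)
    show "Pair x -` Q \<in> sets M" by (rule sets_Pair1[OF Q])
    show "{y \<in> space M. \<not> R x y} = Pair x -` Q"
      using that by (auto simp: Q_def space_pair_measure)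
  qed
  moreover have "Measurable.pred N (\<lambda>x. emeasure M (Pair x -` Q) = 0)"
    using measurable_emeasure_Pair[OF Q] by measurable
  ultimately show ?thesis by (simp cong: measurable_cong)
qed

context vt_graph
begin

section \<open>The space of configurations\<close>

abbreviation Conf :: "'v set measure" where "Conf \<equiv> configuration_space V"

definition missing :: "'v set \<Rightarrow> 'v set set" where
  "missing K = {F. F \<subseteq> V \<and> F \<inter> K = {}}"

definition missing_sets :: "'v set set set" where
  "missing_sets = {missing K | K. K \<subseteq> V \<and> finite K}"

lemma Conf_eq: "Conf = sigma (Pow V) missing_sets"
  by (simp add: configuration_space_def missing_sets_def missing_def)

lemma missing_sets_Pow: "missing_sets \<subseteq> Pow (Pow V)"
  by (auto simp: missing_sets_def missing_def)

lemma space_Conf [simp]: "space Conf = Pow V"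
  unfolding Conf_eq by (rule space_measure_of[OF missing_sets_Pow])

lemma sets_Conf: "sets Conf = sigma_sets (Pow V) missing_sets"
  unfolding Conf_eq by (rule sets_measure_of[OF missing_sets_Pow])

lemma Int_stable_missing: "Int_stable missing_sets"
proof (rule Int_stableI)
  fix A B assume "A \<in> missing_sets" "B \<in> missing_sets"
  then obtain K L where "A = missing K" "B = missing L" "K \<subseteq> V" "finite K" "L \<subseteq> V" "finite L"
    by (auto simp: missing_sets_def)
  then have "A \<inter> B = missing (K \<union> L)" "K \<union> L \<subseteq> V" "finite (K \<union> L)"
    by (auto simp: missing_def)
  then show "A \<inter> B \<in> missing_sets" unfolding missing_sets_def by blast
qed

lemma missing_in_sets: "K \<subseteq> V \<Longrightarrow> finite K \<Longrightarrow> missing K \<in> sets Conf"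
  unfolding sets_Conf missing_sets_def by (rule sigma_sets.Basic) blast

lemma missing_in_sets' [measurable]: "K \<subseteq> V \<Longrightarrow> missing K \<in> sets Conf"
proof -
  assume K: "K \<subseteq> V"
  then have "countable K" using countable_V countable_subset by blast
  then have "(\<Inter>x\<in>K. missing {x}) \<inter> missing {} \<in> sets Conf"
  proof (cases "K = {}")
    case False
    then have "(\<Inter>x\<in>K. missing {x}) \<in> sets Conf"
      using \<open>countable K\<close> K by (intro sets.countable_INT' missing_in_sets image_subsetI) auto
    then show ?thesis by (intro sets.Int missing_in_sets) auto
  qed (simp add: missing_in_sets)
  moreover have "(\<Inter>x\<in>K. missing {x}) \<inter> missing {} = missing K"
    by (auto simp: missing_def)
  ultimately show ?thesis by simp
qed

lemma pred_member [measurable]: "Measurable.pred Conf (\<lambda>F. x \<in> F)"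
proof (cases "x \<in> V")
  case True
  have "{F \<in> space Conf. x \<in> F} = space Conf - missing {x}"
    by (auto simp: missing_def)
  then show ?thesis
    unfolding pred_def using missing_in_sets[of "{x}"] True by (simp only:) (rule sets.compl_sets, simp)
next
  case False
  then have *: "{F \<in> space Conf. x \<in> F} = {}" by auto
  show ?thesis unfolding pred_def * by (rule sets.empty_sets)
qed

lemma measurable_Conf:
  assumes "\<And>m. m \<in> space M \<Longrightarrow> f m \<subseteq> V" "\<And>x. x \<in> V \<Longrightarrow> Measurable.pred M (\<lambda>m. x \<in> f m)"
  shows "f \<in> M \<rightarrow>\<^sub>M Conf"
  unfolding Conf_eq
proof (rule measurable_measure_of[OF missing_sets_Pow])
  show "f \<in> space M \<rightarrow> Pow V" using assms(1) by auto
  fix A assume "A \<in> missing_sets"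
  then obtain K where K: "A = missing K" "K \<subseteq> V" "finite K" by (auto simp: missing_sets_def)
  have "f -` A \<inter> space M = {m \<in> space M. \<forall>x\<in>K. x \<notin> f m}"
    using K assms(1) by (auto simp: missing_def)
  also have "\<dots> \<in> sets M"
    using K assms(2) by (intro sets.sets_Collect_finite_All sets.sets_Collect_neg) (auto simp: pred_def)
  finally show "f -` A \<inter> space M \<in> sets M" .
qed

lemma measurable_Conf_aut:
  assumes f: "aut f"
  shows "(`) f \<in> Conf \<rightarrow>\<^sub>M Conf"
proof (rule measurable_Conf[where f = "(`) f"])
  fix x assume x: "x \<in> V"
  have "x \<in> f ` F \<longleftrightarrow> inv f x \<in> F" for F
    using inv_f_f[OF aut_inj[OF f]] surj_f_inv_f[OF aut_surj[OF f]] by (metis image_iff)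
  then show "Measurable.pred Conf (\<lambda>m. x \<in> f ` m)"
    using pred_member[of "inv f x"] by (simp only:)
qed (use aut_V_iff[OF f] in auto)

lemma measurable_Conf_Un [measurable (raw)]:
  assumes [measurable]: "f \<in> M \<rightarrow>\<^sub>M Conf" "g \<in> M \<rightarrow>\<^sub>M Conf"
  shows "(\<lambda>m. f m \<union> g m) \<in> M \<rightarrow>\<^sub>M Conf"
proof (rule measurable_Conf)
  show "f m \<union> g m \<subseteq> V" if "m \<in> space M" for m
    using that assms[THEN measurable_space] by auto
  show "Measurable.pred M (\<lambda>m. x \<in> f m \<union> g m)" for x
    by simp
qed

lemma measurable_Conf_Diff [measurable (raw)]:
  assumes [measurable]: "f \<in> M \<rightarrow>\<^sub>M Conf" "g \<in> M \<rightarrow>\<^sub>M Conf"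
  shows "(\<lambda>m. f m - g m) \<in> M \<rightarrow>\<^sub>M Conf"
proof (rule measurable_Conf)
  show "f m - g m \<subseteq> V" if "m \<in> space M" for m
    using that assms[THEN measurable_space] by auto
  show "Measurable.pred M (\<lambda>m. x \<in> f m - g m)" for x
    by simp
qed

lemma measurable_Conf_const: "A \<subseteq> V \<Longrightarrow> (\<lambda>_. A) \<in> M \<rightarrow>\<^sub>M Conf"
  by (rule measurable_const) simp

text \<open>Paths range over the whole type; intersecting with \<open>V\<close> makes every trace a
  configuration, and for walks started in \<open>V\<close> almost surely nothing is lost.\<close>

definition trace :: "(nat \<Rightarrow> 'v) \<Rightarrow> 'v set" where
  "trace X = range X \<inter> V"

lemma trace_subset: "trace X \<subseteq> V" by (simp add: trace_def)

lemma measurable_trace [measurable]: "trace \<in> Path \<rightarrow>\<^sub>M Conf"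
proof (rule measurable_Conf)
  fix x assume x: "x \<in> V"
  have "(x \<in> trace X) = (\<exists>n. X n = x)" for X using x by (auto simp: trace_def)
  then show "Measurable.pred Path (\<lambda>X. x \<in> trace X)" by simp
qed (rule trace_subset)

text \<open>Avoidance events of finite sets are closed under intersection and generate the
  \<sigma>-algebra, so they determine a finite measure. Invariance of the law and its Poisson
  decomposition are both checked in this way.\<close>

lemma measure_Conf_eqI:
  assumes "finite_measure \<mu>" "finite_measure \<nu>" "sets \<mu> = sets Conf" "sets \<nu> = sets Conf"
    and "\<And>K. K \<subseteq> V \<Longrightarrow> finite K \<Longrightarrow> emeasure \<mu> (missing K) = emeasure \<nu> (missing K)"
  shows "\<mu> = \<nu>"
proof (rule measure_eqI_generator_eq[OF Int_stable_missing missing_sets_Pow])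
  show "emeasure \<mu> A = emeasure \<nu> A" if "A \<in> missing_sets" for A
    using that assms(5) by (auto simp: missing_sets_def)
  show "sets \<mu> = sigma_sets (Pow V) missing_sets" "sets \<nu> = sigma_sets (Pow V) missing_sets"
    using assms sets_Conf by auto
  have "Pow V = missing {}" by (auto simp: missing_def)
  then show "range (\<lambda>_::nat. Pow V) \<subseteq> missing_sets" by (auto simp: missing_sets_def)
  show "emeasure \<mu> (Pow V) \<noteq> \<infinity>"
    using assms(1) by (simp add: finite_measure.emeasure_finite)
qed auto

end

locale random_conf = vt_graph V E for V :: "'v set" and E :: "('v \<times> 'v) set" +
  fixes \<mu> :: "'v set measure"
  assumes prob_space_mu: "prob_space \<mu>" and sets_mu [measurable_cong]: "sets \<mu> = sets Conf"
begin

sublocale prob_space \<mu> by (rule prob_space_mu)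

lemma space_mu [simp]: "space \<mu> = Pow V"
  using sets_eq_imp_space_eq[OF sets_mu] by simp

end

locale invariant_conf = random_conf +
  assumes invariant: "aut f \<Longrightarrow> distr \<mu> Conf ((`) f) = \<mu>"
begin

lemma prob_aut:
  assumes "aut f" "Measurable.pred Conf P"
  shows "prob {F \<in> space \<mu>. P (f ` F)} = prob {F \<in> space \<mu>. P F}"
proof -
  have "prob {F \<in> space \<mu>. P F} = measure (distr \<mu> Conf ((`) f)) {F \<in> space \<mu>. P F}"
    by (simp only: invariant[OF assms(1)])
  also have "\<dots> = prob ((`) f -` {F \<in> space \<mu>. P F} \<inter> space \<mu>)"
    using measurable_Conf_aut[OF assms(1)] assms(2)
    by (intro measure_distr) (auto simp: measurable_cong_sets[OF sets_mu refl] pred_def)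
  also have "(`) f -` {F \<in> space \<mu>. P F} \<inter> space \<mu> = {F \<in> space \<mu>. P (f ` F)}"
    using aut_V_iff[OF assms(1)] by auto
  finally show ?thesis by simp
qed

end

locale ergodic_conf = invariant_conf +
  assumes ergodic: "Measurable.pred Conf P \<Longrightarrow> (\<And>f F. aut f \<Longrightarrow> F \<subseteq> V \<Longrightarrow> P (f ` F) \<longleftrightarrow> P F) \<Longrightarrow>
    (AE F in \<mu>. P F) \<or> (AE F in \<mu>. \<not> P F)"

section \<open>The interlacement law\<close>

locale interlacement = random_conf V E \<mu> + transient_vt_graph V E
  for V :: "'v set" and E :: "('v \<times> 'v) set" and \<mu> :: "'v set measure" +
  fixes u :: real
  assumes u_pos: "u > 0"
    and law: "K \<subseteq> V \<Longrightarrow> finite K \<Longrightarrow> measure \<mu> (missing K) = exp (- u * capacity E K)"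
begin

section \<open>Mixing and ergodicity of the interlacement\<close>

lemma AE_meets_infinite:
  assumes "A \<subseteq> V" "infinite A"
  shows "AE F in \<mu>. F \<inter> A \<noteq> {}"
proof -
  have le: "prob (missing A) \<le> \<epsilon>" if \<epsilon>: "\<epsilon> > 0" for \<epsilon>
  proof -
    \<comment> \<open>This much capacity makes the avoidance probability of \<open>K\<close> at most
      \<open>\<epsilon>\<close>.\<close>
    obtain K where K: "finite K" "K \<subseteq> A" "capacity E K \<ge> - ln \<epsilon> / u"
      using capacity_infinite[OF assms] by blast
    have "missing A \<subseteq> missing K" using K(2) by (auto simp: missing_def)
    moreover have "missing K \<in> events" using K assms(1) missing_in_sets[of K] by (simp add: sets_mu)
    ultimately have "prob (missing A) \<le> prob (missing K)" by (rule finite_measure_mono)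
    also have "\<dots> = exp (- u * capacity E K)"
      using K assms by (intro law) auto
    also have "\<dots> \<le> exp (ln \<epsilon>)"
      using K(3) u_pos by (simp add: field_simps)
    finally show ?thesis using \<epsilon> by simp
  qed
  have "prob (missing A) = 0"
    by (rule antisym[OF field_le_epsilon]) (use le in auto)
  then have "AE F in \<mu>. F \<notin> missing A"
    using missing_in_sets'[OF assms(1)] by (intro prob_eq_0[THEN iffD1]) (auto simp: sets_mu)
  then show ?thesis
    by (rule AE_mp) (auto simp: missing_def intro!: AE_I2)
qed

lemma invariance:
  assumes f: "aut f"
  shows "distr \<mu> Conf ((`) f) = \<mu>"
proof (rule measure_Conf_eqI)
  have m: "(`) f \<in> \<mu> \<rightarrow>\<^sub>M Conf" using measurable_Conf_aut[OF f] by (simp add: measurable_cong_sets[OF sets_mu refl])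
  show "finite_measure (distr \<mu> Conf ((`) f))"
    using prob_space_distr[OF m] by (simp add: prob_space.finite_measure)
  show "finite_measure \<mu>" by unfold_locales
  fix K assume K: "K \<subseteq> V" "finite K"
  have K': "inv f ` K \<subseteq> V" using K(1) aut_V_iff[OF aut_inv[OF f]] by auto
  have "(`) f -` missing K \<inter> space \<mu> = missing (inv f ` K)"
    unfolding bij_vimage_eq_inv_image[OF aut_bij[OF f], symmetric]
    using aut_V_iff[OF f] by (auto simp: missing_def)
  then show "emeasure (distr \<mu> Conf ((`) f)) (missing K) = emeasure \<mu> (missing K)"
    using K K' m capacity_aut[OF aut_inv[OF f] K(2,1)]
    by (simp add: emeasure_distr missing_in_sets emeasure_eq_measure law)
qed (simp_all add: sets_mu)

text \<open>Translates of \<open>K\<close> that move away from a growing ball have asymptotically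
  additive capacity, so avoidance probabilities factorise in the limit; a Dynkin argument extends
  this to all events \<open>D\<close>. The sequence \<open>f\<close> is fixed before
  \<open>D\<close>.\<close>

lemma mixing:
  assumes K: "finite K" "K \<subseteq> V"
  obtains f where "\<And>n::nat. aut (f n)"
    "\<And>D. D \<in> sets Conf \<Longrightarrow> (\<lambda>n. prob (D \<inter> missing (f n ` K))) \<longlonglongrightarrow> prob D * prob (missing K)"
proof -
  obtain w where w: "w \<in> V" using V_nonempty by auto
  have "\<forall>n. \<exists>f. aut f \<and> gball n w \<inter> f ` K = {} \<and>
      (\<forall>x\<in>gball n w. \<forall>y\<in>f ` K. hit x y \<le> 1 / Suc n \<and> hit y x \<le> 1 / Suc n)"
  proof
    fix n
    obtain f where "aut f" "gball n w \<inter> f ` K = {}"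
      "\<And>x y. x \<in> gball n w \<Longrightarrow> y \<in> f ` K \<Longrightarrow> hit x y \<le> 1 / Suc n \<and> hit y x \<le> 1 / Suc n"
      using ex_aut_far[OF finite_gball gball_subset_V[OF w] K, of "1 / Suc n" n] by auto
    then show "\<exists>f. aut f \<and> gball n w \<inter> f ` K = {} \<and>
      (\<forall>x\<in>gball n w. \<forall>y\<in>f ` K. hit x y \<le> 1 / Suc n \<and> hit y x \<le> 1 / Suc n)" by blast
  qed
  from choice[OF this] obtain f where "\<forall>n. aut (f n) \<and> gball n w \<inter> f n ` K = {} \<and>
      (\<forall>x\<in>gball n w. \<forall>y\<in>f n ` K. hit x y \<le> 1 / Suc n \<and> hit y x \<le> 1 / Suc n)" by blast
  then have f: "\<And>n. aut (f n)" "\<And>n. gball n w \<inter> f n ` K = {}"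
      "\<And>n x y. x \<in> gball n w \<Longrightarrow> y \<in> f n ` K \<Longrightarrow> hit x y \<le> 1 / Suc n \<and> hit y x \<le> 1 / Suc n"
    by blast+
  have fK: "finite (f n ` K)" "f n ` K \<subseteq> V" for n
    using K aut_V_iff[OF f(1)] by auto
  have fm: "missing (f n ` K) \<in> sets Conf" for n using fK by (rule missing_in_sets[rotated])
  have pK: "prob (missing (f n ` K)) = prob (missing K)" for n
    using K fK capacity_aut[OF f(1) K] by (simp add: law)
  have lim: "(\<lambda>n. prob (missing L \<inter> missing (f n ` K))) \<longlonglongrightarrow> prob (missing L) * prob (missing K)"
    if L: "finite L" "L \<subseteq> V" for L
  proof -
    obtain r where r: "L \<subseteq> gball r w" using finite_subset_gball[OF w L] by blast
    define c where "c n = capacity E (L \<union> f n ` K)" for n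
    have c: "(\<lambda>n. c n - (capacity E L + capacity E K)) \<longlonglongrightarrow> 0"
    proof (rule Lim_null_comparison)
      show "\<forall>\<^sub>F n in sequentially. norm (c n - (capacity E L + capacity E K)) \<le> 2 * card L * card K * (1 / Suc n)"
        using eventually_ge_at_top[of r]
      proof eventually_elim
        case (elim n)
        have L': "L \<subseteq> gball n w" using r gball_mono[OF elim] by blast
        have "\<bar>c n - (capacity E L + capacity E (f n ` K))\<bar> \<le> 2 * card L * card (f n ` K) * (1 / Suc n)"
          unfolding c_def
        proof (rule capacity_Un_far[OF L(1) fK(1)])
          show "L \<inter> f n ` K = {}" using L' f(2)[of n] by blast
          show "hit x y \<le> 1 / Suc n" "hit y x \<le> 1 / Suc n" if "x \<in> L" "y \<in> f n ` K" for x y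
            using f(3)[of x n y] L' that by blast+
        qed
        moreover have "card (f n ` K) = card K"
          by (rule card_image[OF inj_on_subset[OF aut_inj[OF f(1)] subset_UNIV]])
        moreover have "capacity E (f n ` K) = capacity E K" by (rule capacity_aut[OF f(1) K])
        ultimately show ?case by simp
      qed
      have "(\<lambda>n. real (2 * card L * card K) * (1 / real (Suc n))) \<longlonglongrightarrow> real (2 * card L * card K) * 0"
        using LIMSEQ_inverse_real_of_nat by (intro tendsto_mult_left) (simp add: inverse_eq_divide)
      then show "(\<lambda>n. 2 * card L * card K * (1 / real (Suc n))) \<longlonglongrightarrow> 0" by simp
    qed
    have "missing L \<inter> missing (f n ` K) = missing (L \<union> f n ` K)" for n
      by (auto simp: missing_def)
    then have "prob (missing L \<inter> missing (f n ` K)) = exp (- u * c n)" for n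
      using L fK by (simp add: law c_def)
    moreover have "(\<lambda>n. exp (- u * c n)) \<longlonglongrightarrow> exp (- u * (capacity E L + capacity E K))"
      using c by (intro tendsto_intros) (simp add: LIM_zero_iff)
    moreover have "exp (- u * (capacity E L + capacity E K)) = prob (missing L) * prob (missing K)"
      using L K by (simp add: law exp_add[symmetric] algebra_simps)
    ultimately show ?thesis by simp
  qed
  have "(\<lambda>n. prob (D \<inter> missing (f n ` K))) \<longlonglongrightarrow> prob D * prob (missing K)" if "D \<in> sets Conf" for D
    using Int_stable_missing missing_sets_Pow that[unfolded sets_Conf]
  proof (induction rule: sigma_sets_induct_disjoint)
    case (basic A)
    then show ?case using lim by (auto simp: missing_sets_def)
  next
    case (compl A)
    have A: "A \<in> events" using compl(1) by (simp add: sets_mu sets_Conf)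
    have "prob ((Pow V - A) \<inter> missing (f n ` K)) = prob (missing K) - prob (A \<inter> missing (f n ` K))" for n
    proof -
      have "(Pow V - A) \<inter> missing (f n ` K) = missing (f n ` K) - (A \<inter> missing (f n ` K))"
        by (auto simp: missing_def)
      then show ?thesis
        using A fm[of n] pK[of n] by (simp add: finite_measure_Diff sets_mu)
    qed
    moreover have "prob (Pow V - A) = 1 - prob A" using prob_compl[OF A] by simp
    moreover have "(\<lambda>n. prob (missing K) - prob (A \<inter> missing (f n ` K))) \<longlonglongrightarrow>
        prob (missing K) - prob A * prob (missing K)"
      by (intro tendsto_intros compl)
    ultimately show ?case by (simp add: left_diff_distrib)
  next
    case (union A)
    have A: "A i \<in> events" for i using union(2) by (auto simp: sets_mu sets_Conf)
    have sums: "(\<lambda>i. prob (A i)) sums prob (\<Union>i. A i)"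
      using A union(1) by (intro finite_measure_UNION) auto
    \<comment> \<open>Limit and infinite sum are exchanged by domination: the terms are bounded by
      the summable \<open>prob (A i)\<close>.\<close>
    have 1: "(\<lambda>n. \<Sum>i. prob (A i \<inter> missing (f n ` K))) \<longlonglongrightarrow> (\<Sum>i. prob (A i) * prob (missing K))"
    proof -
      have "\<forall>\<^sub>F (i, n) in at_top \<times>\<^sub>F sequentially. norm (prob (A i \<inter> missing (f n ` K))) \<le> prob (A i)"
        using A by (intro always_eventually) (auto intro!: finite_measure_mono)
      from tannerys_theorem[OF union(3) this] sums show ?thesis
        by (simp add: sums_iff)
    qed
    have 2: "(\<Sum>i. prob (A i \<inter> missing (f n ` K))) = prob ((\<Union>i. A i) \<inter> missing (f n ` K))" for n
    proof -
      have "(\<lambda>i. prob (A i \<inter> missing (f n ` K))) sums prob (\<Union>i. A i \<inter> missing (f n ` K))"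
        using A fm[of n] union(1) by (intro finite_measure_UNION) (auto simp: disjoint_family_on_def sets_mu)
      then show ?thesis by (simp add: sums_iff)
    qed
    have 3: "(\<Sum>i. prob (A i) * prob (missing K)) = prob (\<Union>i. A i) * prob (missing K)"
      using sums by (simp add: sums_iff suminf_mult2[symmetric])
    show ?case using 1 unfolding 2 3 .
  qed (simp)
  with f(1) show ?thesis by (rule that)
qed

text \<open>For an invariant event the limit in \<open>mixing\<close> is taken along a constant
  sequence. So the event is independent of every avoidance event, hence of all events, itself
  included.\<close>

lemma ergodicity:
  assumes P: "Measurable.pred Conf P" and inv: "\<And>f F. aut f \<Longrightarrow> F \<subseteq> V \<Longrightarrow> P (f ` F) \<longleftrightarrow> P F"
  shows "(AE F in \<mu>. P F) \<or> (AE F in \<mu>. \<not> P F)"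
proof -
  define B where "B = {F \<in> space \<mu>. P F}"
  have B: "B \<in> events" unfolding B_def using P by (simp add: pred_def sets_mu)
  have indep: "prob (B \<inter> missing K) = prob B * prob (missing K)" if K: "K \<subseteq> V" "finite K" for K
  proof -
    obtain f where f: "\<And>n::nat. aut (f n)"
      "\<And>D. D \<in> sets Conf \<Longrightarrow> (\<lambda>n. prob (D \<inter> missing (f n ` K))) \<longlonglongrightarrow> prob D * prob (missing K)"
      using mixing[OF K(2,1)] by blast
    have "prob (B \<inter> missing (f n ` K)) = prob (B \<inter> missing K)" for n
    proof -
      interpret inv: invariant_conf V E \<mu>
        by unfold_locales (rule invariance)
      have "f n ` K \<subseteq> V" using K aut_V_iff[OF f(1)] by auto
      then have m: "Measurable.pred Conf (\<lambda>F. P F \<and> F \<in> missing (f n ` K))"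
        using P missing_in_sets[of "f n ` K"] K by measurable
      have "prob (B \<inter> missing (f n ` K)) = prob {F \<in> space \<mu>. P F \<and> F \<in> missing (f n ` K)}"
        by (rule arg_cong[of _ _ prob]) (auto simp: B_def)
      also have "\<dots> = prob {F \<in> space \<mu>. P (f n ` F) \<and> f n ` F \<in> missing (f n ` K)}"
        by (rule inv.prob_aut[OF f(1) m, symmetric])
      also have "{F \<in> space \<mu>. P (f n ` F) \<and> f n ` F \<in> missing (f n ` K)} = B \<inter> missing K"
        using inv[OF f(1)] aut_V_iff[OF f(1)] inj_eq[OF aut_inj[OF f(1)]]
        by (auto simp: B_def missing_def)
      finally show ?thesis .
    qed
    with f(2)[of B] B have "(\<lambda>n::nat. prob (B \<inter> missing K)) \<longlonglongrightarrow> prob B * prob (missing K)"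
      by (simp add: sets_mu)
    then show ?thesis by (simp add: LIMSEQ_const_iff)
  qed
  have "prob (B \<inter> D) = prob B * prob D" if "D \<in> sets Conf" for D
    using Int_stable_missing missing_sets_Pow that[unfolded sets_Conf]
  proof (induction rule: sigma_sets_induct_disjoint)
    case (basic A)
    then show ?case using indep by (auto simp: missing_sets_def)
  next
    case (compl A)
    have A: "A \<in> events" using compl(1) by (simp add: sets_mu sets_Conf)
    have "B \<inter> (Pow V - A) = B - B \<inter> A" by (auto simp: B_def)
    then have "prob (B \<inter> (Pow V - A)) = prob B - prob (B \<inter> A)"
      using A B by (simp add: finite_measure_Diff)
    moreover have "prob (Pow V - A) = 1 - prob A" using prob_compl[OF A] by simp
    ultimately show ?case using compl by (simp add: right_diff_distrib)
  next
    case (union A)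
    have A: "A i \<in> events" for i using union(2) by (auto simp: sets_mu sets_Conf)
    have "(\<lambda>i. prob (A i)) sums prob (\<Union>i. A i)"
      using A union(1) by (intro finite_measure_UNION) auto
    moreover have "(\<lambda>i. prob (B \<inter> A i)) sums prob (\<Union>i. B \<inter> A i)"
      using A B union(1) by (intro finite_measure_UNION) (auto simp: disjoint_family_on_def)
    ultimately show ?case
      using union(3) by (simp add: sums_iff suminf_mult)
  qed simp
  from this[of B] B have "prob B = prob B * prob B" by (simp add: sets_mu)
  then consider "prob B = 0" | "prob B = 1" by auto
  then show ?thesis
  proof cases
    case 1
    then have "AE F in \<mu>. F \<notin> B" using prob_eq_0[OF B] by blast
    with AE_space have "AE F in \<mu>. \<not> P F" by eventually_elim (simp add: B_def)
    then show ?thesis ..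
  next
    case 2
    then have "AE F in \<mu>. F \<in> B" using prob_eq_1[OF B] by blast
    then have "AE F in \<mu>. P F" by eventually_elim (simp add: B_def)
    then show ?thesis ..
  qed
qed

sublocale ergodic_conf V E \<mu>
  by unfold_locales (use invariance ergodicity in auto)

section \<open>The trajectories through a vertex\<close>

abbreviation escape :: "'v \<Rightarrow> (nat \<Rightarrow> 'v) set" where
  "escape x \<equiv> {Y. \<forall>n\<ge>1. Y n \<noteq> x}"

definition escape_law :: "'v \<Rightarrow> (nat \<Rightarrow> 'v) measure" where
  "escape_law x = uniform_measure (srw_law E x) (escape x)"

text \<open>The trace of a bi-infinite trajectory for which time zero is one extreme visit to
  \<open>x\<close>: the half \<open>Y\<close> is conditioned not to return to \<open>x\<close>,
  while the half \<open>X\<close> is a free walk.\<close>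

definition traj_law :: "'v \<Rightarrow> 'v set measure" where
  "traj_law x = distr (escape_law x \<Otimes>\<^sub>M srw_law E x) Conf (\<lambda>(Y, X). trace X \<union> trace Y)"

text \<open>Plays the role of the law of the interlacement given that exactly \<open>n\<close>
  trajectories pass through \<open>x\<close>.\<close>

fun conf_law :: "'v \<Rightarrow> nat \<Rightarrow> 'v set measure" where
  "conf_law x 0 = uniform_measure \<mu> (missing {x})"
| "conf_law x (Suc n) = distr (conf_law x n \<Otimes>\<^sub>M traj_law x) Conf (\<lambda>(F, T). F \<union> T)"

lemma escape_prob: "x \<in> V \<Longrightarrow> measure (srw_law E x) (escape x) = capacity E {x}"
  by (simp add: capacity_def equilibrium_measure_def)

lemma capacity_singleton_pos: "x \<in> V \<Longrightarrow> capacity E {x} > 0"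
  using equilibrium_measure_singleton_pos by (simp add: capacity_def)

lemma emeasure_escape:
  assumes "x \<in> V"
  shows "emeasure (srw_law E x) (escape x) \<noteq> 0" "emeasure (srw_law E x) (escape x) < \<infinity>"
  using capacity_singleton_pos[OF assms] escape_prob[OF assms]
  by (auto simp: finite_measure.emeasure_eq_measure[OF finite_measure_walk])

lemma emeasure_missing_singleton:
  assumes "x \<in> V"
  shows "emeasure \<mu> (missing {x}) \<noteq> 0" "emeasure \<mu> (missing {x}) < \<infinity>"
  using law[of "{x}"] assms by (auto simp: emeasure_eq_measure)

lemma sets_escape_law [measurable_cong]: "sets (escape_law x) = sets Path"
  by (simp add: escape_law_def sets_srw_law)

lemma sets_traj_law [measurable_cong]: "sets (traj_law x) = sets Conf"
  by (simp add: traj_law_def)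

lemma sets_conf_law [measurable_cong]: "sets (conf_law x n) = sets Conf"
  by (cases n) (simp_all add: sets_mu)

lemma space_escape_law [simp]: "space (escape_law x) = UNIV"
  using sets_eq_imp_space_eq[OF sets_escape_law] by simp

lemma space_traj_law [simp]: "space (traj_law x) = Pow V"
  using sets_eq_imp_space_eq[OF sets_traj_law] by simp

lemma space_conf_law [simp]: "space (conf_law x n) = Pow V"
  using sets_eq_imp_space_eq[OF sets_conf_law] by simp

lemma prob_space_escape_law: "x \<in> V \<Longrightarrow> prob_space (escape_law x)"
  unfolding escape_law_def using emeasure_escape[of x] by (intro prob_space_uniform_measure) auto

lemma traj_map_measurable: "(\<lambda>(Y, X). trace X \<union> trace Y) \<in> escape_law x \<Otimes>\<^sub>M srw_law E x \<rightarrow>\<^sub>M Conf"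
  by measurable

lemma Un_map_measurable: "(\<lambda>(F, T). F \<union> T) \<in> conf_law x n \<Otimes>\<^sub>M traj_law x \<rightarrow>\<^sub>M Conf"
  by measurable

lemma prob_space_traj_law:
  assumes "x \<in> V"
  shows "prob_space (traj_law x)"
proof -
  interpret A: prob_space "escape_law x" by (rule prob_space_escape_law[OF assms])
  interpret B: prob_space "srw_law E x" by (rule prob_space_srw_law)
  interpret AB: pair_prob_space "escape_law x" "srw_law E x" ..
  show ?thesis unfolding traj_law_def by (rule AB.prob_space_distr[OF traj_map_measurable])
qed

lemma prob_space_conf_law:
  assumes x: "x \<in> V"
  shows "prob_space (conf_law x n)"
proof (induction n)
  case 0
  then show ?case
    using emeasure_missing_singleton[OF x] by (auto intro!: prob_space_uniform_measure)
next
  case (Suc n)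
  interpret A: prob_space "conf_law x n" by (rule Suc)
  interpret B: prob_space "traj_law x" by (rule prob_space_traj_law[OF x])
  interpret AB: pair_prob_space "conf_law x n" "traj_law x" ..
  show ?case unfolding conf_law.simps by (rule AB.prob_space_distr[OF Un_map_measurable])
qed

text \<open>The two walks avoid \<open>K\<close> independently. Up to normalisation the conditioned
  one contributes the equilibrium measure of \<open>insert x K\<close> at \<open>x\<close>, the free
  one the probability of avoiding \<open>K\<close>, and \<open>capacity_insert\<close> turns the
  product into a capacity difference.\<close>

lemma measure_traj_law:
  assumes x: "x \<in> V" and K: "K \<subseteq> V" "finite K"
  shows "capacity E {x} * measure (traj_law x) (missing K) = capacity E (insert x K) - capacity E K"
proof -
  interpret A: prob_space "escape_law x" by (rule prob_space_escape_law[OF x])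
  interpret B: prob_space "srw_law E x" by (rule prob_space_srw_law)
  interpret AB: pair_prob_space "escape_law x" "srw_law E x" ..
  define S where "S = {X :: nat \<Rightarrow> 'v. \<forall>n. X n \<notin> K}"
  have S: "S \<in> sets Path" unfolding S_def by (rule sets_Path_pred) measurable
  have "measure (traj_law x) (missing K) =
      AB.prob ((\<lambda>(Y, X). trace X \<union> trace Y) -` missing K \<inter> space (escape_law x \<Otimes>\<^sub>M srw_law E x))"
    unfolding traj_law_def by (rule measure_distr[OF traj_map_measurable missing_in_sets[OF K]])
  also have "(\<lambda>(Y, X). trace X \<union> trace Y) -` missing K \<inter> space (escape_law x \<Otimes>\<^sub>M srw_law E x) = S \<times> S"
  proof (intro set_eqI, clarify)
    fix Y X :: "nat \<Rightarrow> 'v"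
    have "trace Z \<inter> K = {} \<longleftrightarrow> Z \<in> S" for Z using K(1) by (auto simp: S_def trace_def)
    then show "(Y, X) \<in> (\<lambda>(Y, X). trace X \<union> trace Y) -` missing K \<inter> space (escape_law x \<Otimes>\<^sub>M srw_law E x) \<longleftrightarrow>
        (Y, X) \<in> S \<times> S"
      using trace_subset[of X] trace_subset[of Y]
      by (auto simp: missing_def space_pair_measure Int_Un_distrib2)
  qed
  also have "AB.prob (S \<times> S) = A.prob S * B.prob S"
    using S by (simp add: measure_def B.emeasure_pair_measure_Times sets_escape_law sets_srw_law enn2real_mult)
  also have "A.prob S = B.prob (escape x \<inter> S) / capacity E {x}"
    unfolding escape_law_def escape_prob[OF x, symmetric]
    using S emeasure_escape[OF x] by (intro measure_uniform_measure) (auto simp: sets_srw_law)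
  finally have eq: "capacity E {x} * measure (traj_law x) (missing K) = B.prob (escape x \<inter> S) * B.prob S"
    using capacity_singleton_pos[OF x] by simp
  show ?thesis
  proof (cases "x \<in> K")
    \<comment> \<open>The free walk starts in \<open>K\<close>, so both sides vanish.\<close>
    case True
    have "B.prob S = Pr x (\<lambda>_. False)" unfolding S_def
    proof (rule measure_srw_law_cong_AE)
      show "AE X in srw_law E x. (\<forall>n. X n \<notin> K) \<longleftrightarrow> False"
        using srw_law_0[where E = E and x = x] by eventually_elim (use True in auto)
    qed measurable
    then show ?thesis using eq True by (simp add: insert_absorb)
  next
    case False
    have "B.prob (escape x \<inter> S) = Pr x (\<lambda>X. (\<forall>n\<ge>1. X n \<noteq> x) \<and> (\<forall>n. X n \<notin> K))"
      by (rule arg_cong[of _ _ B.prob]) (auto simp: S_def)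
    also have "\<dots> = Pr x (\<lambda>X. \<forall>n\<ge>1. X n \<notin> insert x K)"
    proof (rule measure_srw_law_cong_AE)
      show "AE X in srw_law E x. ((\<forall>n\<ge>1. X n \<noteq> x) \<and> (\<forall>n. X n \<notin> K)) \<longleftrightarrow> (\<forall>n\<ge>1. X n \<notin> insert x K)"
        using srw_law_0[where E = E and x = x]
      proof eventually_elim
        case (elim X)
        have "X n \<notin> K" if "\<forall>n\<ge>1. X n \<notin> insert x K" for n
          using that False elim by (cases n) auto
        then show ?case by blast
      qed
    qed measurable
    also have "\<dots> = equilibrium_measure E (insert x K) x"
      by (simp add: equilibrium_measure_def)
    finally show ?thesis
      using eq capacity_insert[OF x False K(2,1)] by (simp add: S_def)
  qed
qed

lemma emeasure_conf_law:
  assumes x: "x \<in> V" and K: "K \<subseteq> V" "finite K"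
  shows "emeasure (conf_law x n) (missing K) =
    ennreal (exp (- u * (capacity E (insert x K) - capacity E {x})) * measure (traj_law x) (missing K) ^ n)"
proof (induction n)
  case 0
  have "missing {x} \<inter> missing K = missing (insert x K)" by (auto simp: missing_def)
  then have "measure (conf_law x 0) (missing K) = prob (missing (insert x K)) / prob (missing {x})"
    using emeasure_missing_singleton[OF x] x K
    by (simp add: measure_uniform_measure sets_mu missing_in_sets)
  also have "\<dots> = exp (- u * (capacity E (insert x K) - capacity E {x}))"
    using x K by (simp add: law exp_diff[symmetric] algebra_simps)
  finally show ?case
    using prob_space_conf_law[OF x, of 0]
    by (simp add: finite_measure.emeasure_eq_measure prob_space.finite_measure)
next
  case (Suc n)
  interpret A: prob_space "conf_law x n" by (rule prob_space_conf_law[OF x])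
  interpret B: prob_space "traj_law x" by (rule prob_space_traj_law[OF x])
  have "emeasure (conf_law x (Suc n)) (missing K) =
      emeasure (conf_law x n \<Otimes>\<^sub>M traj_law x) ((\<lambda>(F, T). F \<union> T) -` missing K \<inter> space (conf_law x n \<Otimes>\<^sub>M traj_law x))"
    unfolding conf_law.simps by (rule emeasure_distr[OF Un_map_measurable missing_in_sets[OF K]])
  also have "(\<lambda>(F, T). F \<union> T) -` missing K \<inter> space (conf_law x n \<Otimes>\<^sub>M traj_law x) = missing K \<times> missing K"
    by (auto simp: missing_def space_pair_measure)
  also have "emeasure (conf_law x n \<Otimes>\<^sub>M traj_law x) (missing K \<times> missing K) =
      emeasure (conf_law x n) (missing K) * emeasure (traj_law x) (missing K)"
    using missing_in_sets[OF K] by (intro B.emeasure_pair_measure_Times) (simp_all add: sets_conf_law sets_traj_law)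
  also have "\<dots> = ennreal (exp (- u * (capacity E (insert x K) - capacity E {x})) *
      measure (traj_law x) (missing K) ^ n * measure (traj_law x) (missing K))"
    unfolding Suc B.emeasure_eq_measure by (rule ennreal_mult[symmetric]) auto
  finally show ?case by (simp only: power_Suc2 mult.assoc)
qed

lemma conf_law_kernel: "x \<in> V \<Longrightarrow> conf_law x \<in> measure_pmf p \<rightarrow>\<^sub>M subprob_algebra Conf"
  using prob_space_imp_subprob_space[OF prob_space_conf_law]
  by (auto simp: space_subprob_algebra sets_conf_law)

text \<open>With \<open>c = u * capacity E {x}\<close>, summing over the Poisson number gives the
  avoidance probability without trajectories through \<open>x\<close>, times
  \<open>exp (- c) * exp (c * h)\<close>. By \<open>measure_traj_law\<close>, \<open>c * h\<close>
  is \<open>u\<close> times a capacity difference, and the exponents combine to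
  \<open>- u * capacity E L\<close>.\<close>

lemma law_eq_mixture:
  assumes x: "x \<in> V"
  shows "\<mu> = measure_pmf (poisson_pmf (u * capacity E {x})) \<bind> conf_law x" (is "_ = ?B")
proof -
  define c where "c = u * capacity E {x}"
  have c: "c > 0" using capacity_singleton_pos[OF x] u_pos by (simp add: c_def)
  note K = conf_law_kernel[OF x]
  have sB: "sets ?B = sets Conf"
    by (rule sets_bind) (auto simp: sets_conf_law)
  show ?thesis
  proof (rule measure_Conf_eqI[OF _ _ sets_mu sB])
    show "finite_measure \<mu>" by unfold_locales
    have "prob_space ?B"
      using prob_space_conf_law[OF x]
      by (intro prob_space.prob_space_bind[OF prob_space_measure_pmf _ K]) auto
    then show "finite_measure ?B" by (simp add: prob_space.finite_measure)
    fix L assume L: "L \<subseteq> V" "finite L"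
    define a where "a = exp (- u * (capacity E (insert x L) - capacity E {x}))"
    define h where "h = measure (traj_law x) (missing L)"
    have h: "h \<ge> 0" by (simp add: h_def)
    have "emeasure ?B (missing L) = (\<integral>\<^sup>+n. emeasure (conf_law x n) (missing L) \<partial>measure_pmf (poisson_pmf c))"
      unfolding c_def using missing_in_sets[OF L] by (intro emeasure_bind[OF _ K]) auto
    also have "\<dots> = (\<integral>\<^sup>+n. ennreal (c ^ n / fact n * exp (- c) * (a * h ^ n)) \<partial>count_space UNIV)"
      unfolding nn_integral_measure_pmf
      using c h by (intro nn_integral_cong) (simp add: emeasure_conf_law[OF x L] a_def h_def ennreal_mult[symmetric])
    also have "\<dots> = (\<Sum>n. ennreal (c ^ n / fact n * exp (- c) * (a * h ^ n)))"
      by (rule nn_integral_count_space_nat)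
    also have "\<dots> = ennreal (exp (c * h) * (exp (- c) * a))"
    proof (rule suminf_ennreal_eq)
      have "(\<lambda>n. (c * h) ^ n /\<^sub>R fact n * (exp (- c) * a)) sums (exp (c * h) * (exp (- c) * a))"
        by (intro sums_mult2 exp_converges)
      then show "(\<lambda>n. c ^ n / fact n * exp (- c) * (a * h ^ n)) sums (exp (c * h) * (exp (- c) * a))"
        by (simp add: power_mult_distrib field_simps)
    qed (use c h in \<open>simp add: a_def\<close>)
    also have "exp (c * h) * (exp (- c) * a) = exp (- u * capacity E L)"
    proof -
      have "c * h = u * (capacity E (insert x L) - capacity E L)"
        using measure_traj_law[OF x L] by (simp add: c_def h_def mult.assoc)
      then show ?thesis by (simp add: a_def c_def exp_add[symmetric] algebra_simps)
    qed
    finally show "emeasure \<mu> (missing L) = emeasure ?B (missing L)"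
      using law[OF L] by (simp add: emeasure_eq_measure)
  qed
qed

text \<open>\<open>attach x Q F\<close>: almost surely \<open>Q\<close> holds once a random trajectory through \<open>x\<close> is added to
  \<open>F\<close>.  The conditioning of the backward walk \<open>Y\<close> is written as an implication.\<close>

definition attach :: "'v \<Rightarrow> ('v set \<Rightarrow> bool) \<Rightarrow> 'v set \<Rightarrow> bool" where
  "attach x Q F \<longleftrightarrow> (AE Y in srw_law E x. (\<forall>n\<ge>1. Y n \<noteq> x) \<longrightarrow>
    (AE X in srw_law E x. Q (F \<union> (trace X \<union> trace Y))))"

lemma AE_traj_law:
  assumes x: "x \<in> V" and [measurable]: "Measurable.pred Conf S"
  shows "(AE T in traj_law x. S T) \<longleftrightarrow> (AE Y in srw_law E x. (\<forall>n\<ge>1. Y n \<noteq> x) \<longrightarrow>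
    (AE X in srw_law E x. S (trace X \<union> trace Y)))"
proof -
  interpret A: prob_space "escape_law x" by (rule prob_space_escape_law[OF x])
  interpret B: prob_space "srw_law E x" by (rule prob_space_srw_law)
  interpret AB: pair_prob_space "escape_law x" "srw_law E x" ..
  have "(AE T in traj_law x. S T) \<longleftrightarrow>
      (AE z in escape_law x \<Otimes>\<^sub>M srw_law E x. S (trace (snd z) \<union> trace (fst z)))"
    unfolding traj_law_def
    using assms(2) by (subst AE_distr_iff[OF traj_map_measurable]) (auto simp: split_beta' pred_def)
  also have "\<dots> \<longleftrightarrow> (AE Y in escape_law x. AE X in srw_law E x. S (trace X \<union> trace Y))"
    by (rule AB.AE_pair_iff[symmetric]) measurable
  also have "\<dots> \<longleftrightarrow> (AE Y in srw_law E x. Y \<in> escape x \<longrightarrow> (AE X in srw_law E x. S (trace X \<union> trace Y)))"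
    unfolding escape_law_def by (rule AE_uniform_measure[OF emeasure_escape[OF x]])
  finally show ?thesis by simp
qed

lemma attach_eq_AE_traj_law:
  assumes x: "x \<in> V" and [measurable]: "Measurable.pred Conf Q" and F: "F \<subseteq> V"
  shows "attach x Q F \<longleftrightarrow> (AE T in traj_law x. Q (F \<union> T))"
proof -
  have "(\<lambda>T. F \<union> T) \<in> Conf \<rightarrow>\<^sub>M Conf"
    using measurable_Conf_const[OF F] by (intro measurable_Conf_Un) auto
  then have "Measurable.pred Conf (\<lambda>T. Q (F \<union> T))"
    by (rule measurable_compose) fact
  then show ?thesis unfolding attach_def by (subst AE_traj_law[OF x]) auto
qed

lemma pred_attach:
  assumes x: "x \<in> V" and Q [measurable]: "Measurable.pred Conf Q"
  shows "Measurable.pred Conf (attach x Q)"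
proof -
  interpret B: prob_space "traj_law x" by (rule prob_space_traj_law[OF x])
  have "Measurable.pred (Conf \<Otimes>\<^sub>M traj_law x) (\<lambda>z. Q (fst z \<union> snd z))"
    by measurable
  then have "Measurable.pred Conf (\<lambda>F. AE T in traj_law x. Q (F \<union> T))"
    by (rule B.pred_AE)
  then show ?thesis
    using attach_eq_AE_traj_law[OF x Q] by (subst measurable_cong) auto
qed

text \<open>Fubini, one trajectory at a time: an almost sure statement with \<open>n\<close>
  trajectories becomes \<open>n\<close> nested statements, over \<open>\<mu>\<close> on the event
  that \<open>x\<close> is vacant.\<close>

lemma AE_conf_law:
  assumes x: "x \<in> V" and Q: "Measurable.pred Conf Q"
  shows "(AE F in conf_law x n. Q F) \<longleftrightarrow> (AE F in \<mu>. x \<notin> F \<longrightarrow> (attach x ^^ n) Q F)"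
  using Q
proof (induction n arbitrary: Q)
  case 0
  have "(AE F in conf_law x 0. Q F) \<longleftrightarrow> (AE F in \<mu>. F \<in> missing {x} \<longrightarrow> Q F)"
    unfolding conf_law.simps by (rule AE_uniform_measure[OF emeasure_missing_singleton[OF x]])
  also have "\<dots> \<longleftrightarrow> (AE F in \<mu>. x \<notin> F \<longrightarrow> (attach x ^^ 0) Q F)"
    by (rule AE_cong) (auto simp: missing_def)
  finally show ?case .
next
  case (Suc n)
  note [measurable] = Suc.prems
  interpret A: prob_space "conf_law x n" by (rule prob_space_conf_law[OF x])
  interpret B: prob_space "traj_law x" by (rule prob_space_traj_law[OF x])
  interpret AB: pair_prob_space "conf_law x n" "traj_law x" ..
  have "(AE F in conf_law x (Suc n). Q F) \<longleftrightarrow> (AE z in conf_law x n \<Otimes>\<^sub>M traj_law x. Q (fst z \<union> snd z))"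
    unfolding conf_law.simps
    using Suc.prems by (subst AE_distr_iff[OF Un_map_measurable]) (auto simp: split_beta' pred_def)
  also have "\<dots> \<longleftrightarrow> (AE F in conf_law x n. AE T in traj_law x. Q (F \<union> T))"
    by (rule AB.AE_pair_iff[symmetric]) measurable
  also have "\<dots> \<longleftrightarrow> (AE F in conf_law x n. attach x Q F)"
    by (rule AE_cong) (simp add: attach_eq_AE_traj_law[OF x Suc.prems])
  also have "\<dots> \<longleftrightarrow> (AE F in \<mu>. x \<notin> F \<longrightarrow> (attach x ^^ n) (attach x Q) F)"
    by (rule Suc.IH[OF pred_attach[OF x Suc.prems]])
  finally show ?case by (simp only: funpow_Suc_right comp_def)
qed

text \<open>All Poisson weights are positive, so what is almost sure for the mixture is almost sure
  for every number of trajectories.\<close>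

lemma AE_decomposition:
  assumes x: "x \<in> V" and Q: "Measurable.pred Conf Q"
  shows "(AE F in \<mu>. Q F) \<longleftrightarrow> (\<forall>n. AE F in \<mu>. x \<notin> F \<longrightarrow> (attach x ^^ n) Q F)"
proof -
  have "u * capacity E {x} > 0" using capacity_singleton_pos[OF x] u_pos by simp
  then have "(AE F in \<mu>. Q F) \<longleftrightarrow> (\<forall>n. AE F in conf_law x n. Q F)"
    by (subst law_eq_mixture[OF x], subst AE_bind[OF conf_law_kernel[OF x] Q])
      (simp add: AE_measure_pmf_iff)
  then show ?thesis by (simp only: AE_conf_law[OF x Q])
qed

lemma attach_mono:
  assumes "\<And>F. F \<subseteq> V \<Longrightarrow> Q F \<Longrightarrow> R F" "F \<subseteq> V" "attach x Q F"
  shows "attach x R F"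
  using assms(3) unfolding attach_def
proof eventually_elim
  case (elim Y)
  show ?case
  proof
    assume "\<forall>n\<ge>1. Y n \<noteq> x"
    with elim have "AE X in srw_law E x. Q (F \<union> (trace X \<union> trace Y))" by simp
    then show "AE X in srw_law E x. R (F \<union> (trace X \<union> trace Y))"
      by eventually_elim (use assms(1,2) trace_subset in auto)
  qed
qed

lemma attach_pow_mono:
  assumes "\<And>F. F \<subseteq> V \<Longrightarrow> Q F \<Longrightarrow> R F" "F \<subseteq> V" "(attach x ^^ n) Q F"
  shows "(attach x ^^ n) R F"
  using assms(2,3)
proof (induction n arbitrary: F)
  case (Suc n)
  then show ?case using attach_mono[of "(attach x ^^ n) Q" "(attach x ^^ n) R" F x] by simp
qed (use assms(1) in auto)

text \<open>If \<open>x\<close> is occupied, \<open>step\<close> is applied to the last of the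
  trajectories through \<open>x\<close>, and monotonicity carries the conclusion through the
  others.\<close>

lemma AE_from_attach:
  assumes x: "x \<in> V" and Q: "Measurable.pred Conf Q" "AE F in \<mu>. Q F" and R: "Measurable.pred Conf R"
    and zero: "AE F in \<mu>. x \<notin> F \<longrightarrow> R F"
    and step: "\<And>F. F \<subseteq> V \<Longrightarrow> attach x Q F \<Longrightarrow> attach x R F"
  shows "AE F in \<mu>. R F"
  unfolding AE_decomposition[OF x R]
proof
  fix n
  show "AE F in \<mu>. x \<notin> F \<longrightarrow> (attach x ^^ n) R F"
  proof (cases n)
    case 0
    then show ?thesis using zero by simp
  next
    case (Suc m)
    have "AE F in \<mu>. x \<notin> F \<longrightarrow> (attach x ^^ Suc m) Q F"
      using Q(2) AE_decomposition[OF x Q(1)] by blast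
    then show ?thesis using AE_space
    proof eventually_elim
      case (elim F)
      show ?case
      proof
        assume "x \<notin> F"
        with elim(1) have "(attach x ^^ m) (attach x Q) F" unfolding funpow_Suc_right comp_def by blast
        then have "(attach x ^^ m) (attach x R) F"
          using elim(2) step by (intro attach_pow_mono[of "attach x Q" "attach x R"]) auto
        then show "(attach x ^^ n) R F" by (simp only: Suc funpow_Suc_right comp_def)
      qed
    qed
  qed
qed

text \<open>Compares \<open>n\<close> trajectories with \<open>n + 1\<close>. Both numbers have
  positive probability, so almost every configuration tolerates one extra trajectory through
  \<open>x\<close>.\<close>

lemma AE_from_attach':
  assumes x: "x \<in> V" and Q: "Measurable.pred Conf Q" "AE F in \<mu>. Q F" and R: "Measurable.pred Conf R"
    and step: "\<And>F. F \<subseteq> V \<Longrightarrow> attach x Q F \<Longrightarrow> R F"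
  shows "AE F in \<mu>. R F"
  unfolding AE_decomposition[OF x R]
proof
  fix n
  have "AE F in \<mu>. x \<notin> F \<longrightarrow> (attach x ^^ Suc n) Q F"
    using Q(2) AE_decomposition[OF x Q(1)] by blast
  then show "AE F in \<mu>. x \<notin> F \<longrightarrow> (attach x ^^ n) R F" using AE_space
  proof eventually_elim
    case (elim F)
    show ?case
    proof
      assume "x \<notin> F"
      with elim(1) have "(attach x ^^ n) (attach x Q) F" unfolding funpow_Suc_right comp_def by blast
      then show "(attach x ^^ n) R F"
        using elim(2) step by (intro attach_pow_mono[of "attach x Q" R]) auto
    qed
  qed
qed

end

lemma pred_bex_countable:
  assumes "countable X" "\<And>i. i \<in> X \<Longrightarrow> Measurable.pred M (\<lambda>x. P x i)"
  shows "Measurable.pred M (\<lambda>x. \<exists>i\<in>X. P x i)"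
proof -
  have "{x \<in> space M. \<exists>i\<in>X. P x i} = (\<Union>i\<in>X. {x \<in> space M. P x i})" by auto
  also have "\<dots> \<in> sets M" using assms by (intro sets.countable_UN') (auto simp: pred_def)
  finally show ?thesis by (simp add: pred_def)
qed

lemma pred_ball_countable:
  assumes "countable X" "\<And>i. i \<in> X \<Longrightarrow> Measurable.pred M (\<lambda>x. P x i)"
  shows "Measurable.pred M (\<lambda>x. \<forall>i\<in>X. P x i)"
proof -
  have "Measurable.pred M (\<lambda>x. \<exists>i\<in>X. \<not> P x i)"
    using assms by (intro pred_bex_countable) auto
  then have "Measurable.pred M (\<lambda>x. \<not> (\<exists>i\<in>X. \<not> P x i))" by measurable
  then show ?thesis by simp
qed

section \<open>Clusters and their measurability\<close>

context vt_graph
begin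

text \<open>By reflexivity the cluster of a point outside \<open>F\<close> is that point alone, in
  particular finite.\<close>

definition cluster :: "'v set \<Rightarrow> 'v \<Rightarrow> 'v set" where
  "cluster F x = {y. (x, y) \<in> (Restr E F)\<^sup>*}"

lemma pred_connected [measurable]: "Measurable.pred Conf (\<lambda>F. (x, y) \<in> (Restr E F)\<^sup>*)"
proof -
  have "Measurable.pred Conf (\<lambda>F. (x, y) \<in> (Restr E F) ^^ n)" for n
  proof (induction n arbitrary: y)
    case (Suc n)
    have "(x, y) \<in> (Restr E F) ^^ Suc n \<longleftrightarrow>
        (\<exists>z\<in>V. (x, z) \<in> (Restr E F) ^^ n \<and> (z, y) \<in> E \<and> z \<in> F \<and> y \<in> F)" if "F \<in> space Conf" for F
      using that by (auto simp: relcomp_unfold)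
    moreover have "Measurable.pred Conf (\<lambda>F. \<exists>z\<in>V. (x, z) \<in> (Restr E F) ^^ n \<and> (z, y) \<in> E \<and> z \<in> F \<and> y \<in> F)"
    proof (rule pred_bex_countable[OF countable_V])
      fix z
      note [measurable] = Suc.IH[of z]
      show "Measurable.pred Conf (\<lambda>F. (x, z) \<in> (Restr E F) ^^ n \<and> (z, y) \<in> E \<and> z \<in> F \<and> y \<in> F)"
        by measurable
    qed
    ultimately show ?case by (subst measurable_cong) auto
  qed simp
  then show ?thesis unfolding rtrancl_power by measurable
qed

lemma cluster_subset_insert: "cluster F x \<subseteq> insert x F"
  by (auto simp: cluster_def elim: rtranclE)

lemma cluster_subset: "x \<in> F \<Longrightarrow> cluster F x \<subseteq> F"
  by (auto simp: cluster_def elim: rtranclE)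

lemma cluster_self: "x \<in> cluster F x"
  by (simp add: cluster_def)

text \<open>In a locally finite graph a cluster is infinite iff it leaves every ball, which is a
  countable condition on connections.\<close>

lemma pred_infinite_cluster [measurable]:
  assumes x: "x \<in> V"
  shows "Measurable.pred Conf (\<lambda>F. infinite (cluster F x))"
proof -
  have "infinite (cluster F x) \<longleftrightarrow> (\<forall>n. \<exists>z\<in>V. z \<notin> gball n x \<and> (x, z) \<in> (Restr E F)\<^sup>*)" if F: "F \<subseteq> V" for F
  proof
    have cV: "cluster F x \<subseteq> V"
      using F x cluster_subset_insert[of F x] by blast
    show "\<forall>n. \<exists>z\<in>V. z \<notin> gball n x \<and> (x, z) \<in> (Restr E F)\<^sup>*" if "infinite (cluster F x)"
    proof
      fix n
      obtain z where "z \<in> cluster F x" "z \<notin> gball n x"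
        using \<open>infinite (cluster F x)\<close> finite_subset[OF _ finite_gball[of n x]] by blast
      then show "\<exists>z\<in>V. z \<notin> gball n x \<and> (x, z) \<in> (Restr E F)\<^sup>*" using cV by (auto simp: cluster_def)
    qed
    show "infinite (cluster F x)" if "\<forall>n. \<exists>z\<in>V. z \<notin> gball n x \<and> (x, z) \<in> (Restr E F)\<^sup>*"
    proof
      assume "finite (cluster F x)"
      then obtain n where "cluster F x \<subseteq> gball n x" using finite_subset_gball[OF x _ cV] by blast
      with that show False by (auto simp: cluster_def)
    qed
  qed
  moreover have "Measurable.pred Conf (\<lambda>F. \<forall>n. \<exists>z\<in>V. z \<notin> gball n x \<and> (x, z) \<in> (Restr E F)\<^sup>*)"
    by (intro pred_intros_countable pred_bex_countable[OF countable_V]) measurable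
  ultimately show ?thesis by (subst measurable_cong) auto
qed

lemma pred_compose_Conf:
  "Measurable.pred Conf Q \<Longrightarrow> f \<in> M \<rightarrow>\<^sub>M Conf \<Longrightarrow> Measurable.pred M (\<lambda>m. Q (f m))"
  by (rule measurable_compose)

lemma trace_prefix: "trace (foldr case_nat vs X) = (set vs \<inter> V) \<union> trace X"
  unfolding trace_def range_prefix by auto

lemma Restr_path_chain:
  assumes "(y, z) \<in> (Restr E F)\<^sup>*"
  obtains vs where "chain vs y z" "set vs \<subseteq> F"
  using assms
proof (induction arbitrary: thesis rule: converse_rtrancl_induct)
  case base
  show ?case by (rule base[of "[]"]) auto
next
  case (step y w)
  obtain vs where "chain vs w z" "set vs \<subseteq> F" by (rule step.IH)
  then show ?case using step.hyps by (intro step.prems[of "y # vs"]) auto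
qed

end

section \<open>Adding points and walks to the interlacement\<close>

context interlacement
begin

text \<open>A walk from \<open>y\<close> begins with the detour \<open>y\<close>, \<open>x\<close>,
  \<open>y\<close> with positive probability. If \<open>y\<close> is occupied, some trajectory
  passes through it and can be given this detour, which adds nothing but \<open>x\<close>.\<close>

lemma AE_insert:
  assumes yx: "(y, x) \<in> E" and Q: "Measurable.pred Conf Q" "AE F in \<mu>. Q F"
  shows "AE F in \<mu>. y \<in> F \<longrightarrow> Q (insert x F)"
proof (rule AE_from_attach[OF _ Q])
  have y: "y \<in> V" "x \<in> V" using E_in_V yx by auto
  then show "y \<in> V" by simp
  have "(\<lambda>F. F \<union> {x}) \<in> Conf \<rightarrow>\<^sub>M Conf"
    using measurable_Conf_const[of "{x}"] y by (intro measurable_Conf_Un) auto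
  then have [measurable]: "Measurable.pred Conf (\<lambda>F. Q (insert x F))"
    using pred_compose_Conf[OF Q(1)] by simp
  show "Measurable.pred Conf (\<lambda>F. y \<in> F \<longrightarrow> Q (insert x F))" by measurable
  show "AE F in \<mu>. y \<notin> F \<longrightarrow> y \<in> F \<longrightarrow> Q (insert x F)" by simp
  fix F assume F: "F \<subseteq> V" "attach y Q F"
  show "attach y (\<lambda>F. y \<in> F \<longrightarrow> Q (insert x F)) F"
    unfolding attach_def using F(2)[unfolded attach_def]
  proof eventually_elim
    case (elim Y)
    show ?case
    proof
      assume "\<forall>n\<ge>1. Y n \<noteq> y"
      with elim have "AE X in srw_law E y. Q (F \<union> (trace X \<union> trace Y))" by simp
      moreover have "chain [y, x] y y" using yx E_sym by auto
      ultimately have "AE X in srw_law E y. Q (F \<union> (trace (foldr case_nat [y, x] X) \<union> trace Y))"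
        by (rule AE_prefix[rotated])
      then show "AE X in srw_law E y. y \<in> F \<union> (trace X \<union> trace Y) \<longrightarrow> Q (insert x (F \<union> (trace X \<union> trace Y)))"
        using srw_law_0[where E = E and x = y]
      proof eventually_elim
        case (elim X)
        have "y \<in> trace X" using elim(2) y by (auto simp: trace_def)
        then have "F \<union> (trace (foldr case_nat [y, x] X) \<union> trace Y) = insert x (F \<union> (trace X \<union> trace Y))"
          unfolding trace_prefix using y by auto
        then show ?case using elim(1) by simp
      qed
    qed
  qed
qed

text \<open>The free walk of a trajectory through \<open>x\<close> is connected to \<open>x\<close>
  and, by transience, visits infinitely many vertices.\<close>

lemma AE_infinite_cluster:
  assumes x: "x \<in> V"
  shows "AE F in \<mu>. x \<in> F \<longrightarrow> infinite (cluster F x)"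
proof (rule AE_from_attach[OF x, where Q = "\<lambda>_. True"])
  show "Measurable.pred Conf (\<lambda>F. x \<in> F \<longrightarrow> infinite (cluster F x))"
    using x by measurable
  show "AE F in \<mu>. x \<notin> F \<longrightarrow> x \<in> F \<longrightarrow> infinite (cluster F x)" by simp
  fix F assume "F \<subseteq> V"
  show "attach x (\<lambda>F. x \<in> F \<longrightarrow> infinite (cluster F x)) F"
    unfolding attach_def
  proof (rule AE_I2, rule impI)
    fix Y
    show "AE X in srw_law E x. x \<in> F \<union> (trace X \<union> trace Y) \<longrightarrow> infinite (cluster (F \<union> (trace X \<union> trace Y)) x)"
      using AE_walk[OF x] AE_finite_visits[OF x] AE_walk_in_V[OF x]
    proof eventually_elim
      case (elim X)
      let ?F = "F \<union> (trace X \<union> trace Y)"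
      have XF: "X n \<in> ?F" for n using elim(3) by (auto simp: trace_def)
      have "(x, X n) \<in> (Restr E ?F)\<^sup>*" for n
      proof (induction n)
        case (Suc n)
        moreover have "(X n, X (Suc n)) \<in> Restr E ?F" using elim(1) XF by auto
        ultimately show ?case by (rule rtrancl_into_rtrancl)
      qed (use elim(1) in simp)
      then have "X ` {0..} \<subseteq> cluster ?F x" by (auto simp: cluster_def)
      moreover have "infinite (X ` {0..})" by (rule infinite_range_if_finite_visits[OF elim(2,3)])
      ultimately have "infinite (cluster ?F x)" by (rule infinite_super)
      then show ?case ..
    qed
  qed
qed auto

text \<open>By transience the range of the walk after any time \<open>m\<close> is an infinite set,
  and the interlacement meets it. Fubini then exchanges the order of the two random objects.\<close>

lemma AE_walk_meets:
  assumes x: "x \<in> V"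
  shows "AE F in \<mu>. AE X in srw_law E x. \<forall>m. \<exists>s\<ge>m. X s \<in> F"
proof -
  interpret B: prob_space "srw_law E x" by (rule prob_space_srw_law)
  interpret AB: pair_prob_space \<mu> "srw_law E x" ..
  \<comment> \<open>Joint measurability is obtained by splitting over the countably many values of
    the walk at time \<open>s\<close>.\<close>
  have [measurable]: "Measurable.pred (Conf \<Otimes>\<^sub>M Path) (\<lambda>z. snd z s \<in> fst z)" for s
  proof -
    have "snd z s \<in> fst z \<longleftrightarrow> (\<exists>v\<in>V. snd z s = v \<and> v \<in> fst z)" if "z \<in> space (Conf \<Otimes>\<^sub>M Path)" for z
      using that by (auto simp: space_pair_measure)
    moreover have "Measurable.pred (Conf \<Otimes>\<^sub>M Path) (\<lambda>z. \<exists>v\<in>V. snd z s = v \<and> v \<in> fst z)"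
    proof (rule pred_bex_countable[OF countable_V])
      fix v :: 'v
      have "Measurable.pred Path (\<lambda>X. X s = v)" by measurable
      then have 1: "Measurable.pred (Conf \<Otimes>\<^sub>M Path) (\<lambda>z. snd z s = v)"
        by (rule measurable_compose[OF measurable_snd])
      have 2: "Measurable.pred (Conf \<Otimes>\<^sub>M Path) (\<lambda>z :: 'v set \<times> (nat \<Rightarrow> 'v). v \<in> fst z)"
        by (rule measurable_compose[OF measurable_fst pred_member])
      show "Measurable.pred (Conf \<Otimes>\<^sub>M Path) (\<lambda>z. snd z s = v \<and> v \<in> fst z)"
        using 1 2 by (rule pred_intros_logic)
    qed
    ultimately show ?thesis by (subst measurable_cong) auto
  qed
  have "Measurable.pred (Conf \<Otimes>\<^sub>M Path) (\<lambda>z. \<forall>m. \<exists>s\<ge>m. snd z s \<in> fst z)" by measurable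
  then have m: "{z \<in> space (\<mu> \<Otimes>\<^sub>M srw_law E x). \<forall>m. \<exists>s\<ge>m. snd z s \<in> fst z} \<in> sets (\<mu> \<Otimes>\<^sub>M srw_law E x)"
  proof -
    assume P: "Measurable.pred (Conf \<Otimes>\<^sub>M Path) (\<lambda>z. \<forall>m. \<exists>s\<ge>m. snd z s \<in> fst z)"
    have sets: "sets (\<mu> \<Otimes>\<^sub>M srw_law E x) = sets (Conf \<Otimes>\<^sub>M Path)"
      by (intro sets_pair_measure_cong sets_mu sets_srw_law)
    show ?thesis
      unfolding sets sets_eq_imp_space_eq[OF sets] using P unfolding pred_def .
  qed
  have "AE X in srw_law E x. AE F in \<mu>. \<forall>m. \<exists>s\<ge>m. X s \<in> F"
    using AE_finite_visits[OF x] AE_walk_in_V[OF x]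
  proof eventually_elim
    case (elim X)
    have "AE F in \<mu>. F \<inter> X ` {m..} \<noteq> {}" for m
      using elim infinite_range_if_finite_visits[OF elim] by (intro AE_meets_infinite) auto
    then have "AE F in \<mu>. \<forall>m. F \<inter> X ` {m..} \<noteq> {}" by (simp add: AE_all_countable)
    then show ?case by eventually_elim blast
  qed
  then show ?thesis using AB.AE_commute[OF m] by simp
qed

text \<open>A walk conditioned not to return to \<open>x\<close> may be replaced by an unconditioned one: its part
  before the last visit to \<open>x\<close> is a loop, which can be prepended to the other walk.\<close>

lemma attach_unconditioned:
  assumes x: "x \<in> V" and Q: "attach x Q F"
  shows "AE Z in srw_law E x. AE X in srw_law E x. Q (F \<union> (trace X \<union> trace Z))"
proof -
  \<comment> \<open>The condition \<open>Y 0 = x\<close> makes \<open>P\<close> trivial for walks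
    from other starting points, as \<open>AE_shift\<close> demands.\<close>
  define P where "P Y \<longleftrightarrow> Y 0 = x \<longrightarrow> (\<forall>n\<ge>1. Y n \<noteq> x) \<longrightarrow> (AE X in srw_law E x. Q (F \<union> (trace X \<union> trace Y)))" for Y
  have "AE Y in srw_law E z. P Y" for z
  proof (cases "z = x")
    case True
    have "AE Y in srw_law E x. P Y"
      using Q unfolding attach_def by eventually_elim (simp add: P_def)
    then show ?thesis unfolding True .
  next
    case False
    show ?thesis using srw_law_0[where E = E and x = z] by eventually_elim (use False in \<open>simp add: P_def\<close>)
  qed
  then have "AE Z in srw_law E x. \<forall>t. P (shift t Z)" by (intro AE_shift x)
  then show ?thesis using AE_walk[OF x] AE_finite_visits[OF x]
  proof eventually_elim
    case (elim Z)
    have "finite {n. Z n = x}" "Z 0 = x" using elim x by auto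
    then obtain t where t: "Z t = x" "\<And>s. s > t \<Longrightarrow> Z s \<noteq> x" by (rule ex_last_visit) blast
    have "AE X in srw_law E x. Q (F \<union> (trace X \<union> trace (shift t Z)))"
      using elim(1) t unfolding P_def by (auto dest!: spec[of _ t])
    moreover have "chain (map Z [0..<t]) x x"
      using chain_prefix[of Z t] elim(2) t(1) by simp
    ultimately have "AE X in srw_law E x. Q (F \<union> (trace (foldr case_nat (map Z [0..<t]) X) \<union> trace (shift t Z)))"
      by (rule AE_prefix[rotated])
    moreover have "set (map Z [0..<t]) \<inter> V \<union> trace (shift t Z) = trace Z"
    proof -
      have "Z n \<in> set (map Z [0..<t]) \<or> Z n \<in> range (shift t Z)" for n
        by (cases "n < t") (auto intro!: rev_image_eqI[of "n - t"])
      then show ?thesis by (auto simp: trace_def)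
    qed
    then have "trace (foldr case_nat (map Z [0..<t]) X) \<union> trace (shift t Z) = trace X \<union> trace Z" for X
      unfolding trace_prefix by blast
    ultimately show ?case by (simp only:)
  qed
qed

text \<open>One more trajectory through \<open>x\<close> is tolerated by
  \<open>AE_from_attach'\<close>; it contributes two walks from \<open>x\<close>, and
  \<open>attach_unconditioned\<close> frees the conditioned one.\<close>

lemma AE_add_walks:
  assumes x: "x \<in> V" and Q: "Measurable.pred Conf Q" "AE F in \<mu>. Q F"
  shows "AE F in \<mu>. AE Z in srw_law E x. AE X in srw_law E x. Q (F \<union> (trace X \<union> trace Z))"
proof (rule AE_from_attach'[OF x Q])
  note [measurable] = Q(1)
  interpret B: prob_space "srw_law E x" by (rule prob_space_srw_law)
  have "Measurable.pred ((Conf \<Otimes>\<^sub>M srw_law E x) \<Otimes>\<^sub>M srw_law E x) (\<lambda>z. Q (fst (fst z) \<union> (trace (snd z) \<union> trace (snd (fst z)))))"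
    by measurable
  then have "Measurable.pred (Conf \<Otimes>\<^sub>M srw_law E x) (\<lambda>z. AE X in srw_law E x. Q (fst z \<union> (trace X \<union> trace (snd z))))"
    by (rule B.pred_AE)
  then show "Measurable.pred Conf (\<lambda>F. AE Z in srw_law E x. AE X in srw_law E x. Q (F \<union> (trace X \<union> trace Z)))"
    by (rule B.pred_AE)
qed (rule attach_unconditioned[OF x])

text \<open>The second walk may start at any point \<open>z\<close> connected to \<open>y\<close>:
  the path from \<open>y\<close> to \<open>z\<close> runs in \<open>F\<close>, so prepending it to
  the walk does not change the union.\<close>

lemma AE_add_walks_connected:
  assumes Q: "Measurable.pred Conf Q" "AE F in \<mu>. Q F"
  shows "AE F in \<mu>. \<forall>y\<in>V. \<forall>z\<in>V. (y, z) \<in> (Restr E F)\<^sup>* \<longrightarrow>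
    (AE Z in srw_law E y. AE X in srw_law E z. Q (F \<union> (trace X \<union> trace Z)))"
proof -
  have "AE F in \<mu>. \<forall>y\<in>V. AE Z in srw_law E y. AE X in srw_law E y. Q (F \<union> (trace X \<union> trace Z))"
    using AE_add_walks[OF _ Q] countable_V by (simp add: AE_ball_countable)
  then show ?thesis
  proof eventually_elim
    case (elim F)
    show ?case
    proof (intro ballI impI)
      fix y z assume yz: "y \<in> V" "z \<in> V" "(y, z) \<in> (Restr E F)\<^sup>*"
      obtain vs where vs: "chain vs y z" "set vs \<subseteq> F" using Restr_path_chain[OF yz(3)] by blast
      have "AE Z in srw_law E y. AE X in srw_law E y. Q (F \<union> (trace X \<union> trace Z))" using elim yz by blast
      then show "AE Z in srw_law E y. AE X in srw_law E z. Q (F \<union> (trace X \<union> trace Z))"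
      proof eventually_elim
        case (elim Z)
        have "AE X in srw_law E z. Q (F \<union> (trace (foldr case_nat vs X) \<union> trace Z))"
          by (rule AE_prefix[OF vs(1) elim])
        moreover have "F \<union> (trace (foldr case_nat vs X) \<union> trace Z) = F \<union> (trace X \<union> trace Z)" for X
          unfolding trace_prefix using vs(2) by blast
        ultimately show ?case by (simp only:)
      qed
    qed
  qed
qed

text \<open>Rerouting removes more than the prescribed set, namely finite pieces of trajectories of
  unknown size, so only some finite superset \<open>W\<close> of \<open>K\<close> is asked
  for.\<close>

definition delete_set :: "'v set \<Rightarrow> ('v set \<Rightarrow> bool) \<Rightarrow> 'v set \<Rightarrow> bool" where
  "delete_set K Q F \<longleftrightarrow> (\<exists>W\<in>{W. finite W \<and> W \<subseteq> V}. K \<subseteq> W \<and> Q (F - W))"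

lemma pred_delete_set:
  assumes Q: "Measurable.pred Conf Q"
  shows "Measurable.pred Conf (delete_set K Q)"
  unfolding delete_set_def
proof (rule pred_bex_countable[OF countable_Collect_finite_subset[OF countable_V]])
  fix W assume "W \<in> {W. finite W \<and> W \<subseteq> V}"
  then have "(\<lambda>F. F - W) \<in> Conf \<rightarrow>\<^sub>M Conf"
    by (intro measurable_Conf_Diff measurable_Conf_const) auto
  note [measurable] = pred_compose_Conf[OF Q this]
  show "Measurable.pred Conf (\<lambda>F. K \<subseteq> W \<and> Q (F - W))" by measurable
qed

text \<open>A trajectory through \<open>x\<close> is cut at points of \<open>F\<close> before and after its visits to \<open>x\<close>.  As \<open>F\<close>
  is connected, the two remaining ends are joined inside \<open>F\<close>, so that the new configuration is
  again \<open>F\<close> with one trajectory added.\<close>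

lemma AE_attach_delete:
  assumes x: "x \<in> V" and Q: "Measurable.pred Conf Q" "AE F in \<mu>. Q F"
    and conn: "AE F in \<mu>. \<forall>y\<in>F. \<forall>z\<in>F. (y, z) \<in> (Restr E F)\<^sup>*"
  shows "AE F in \<mu>. x \<notin> F \<longrightarrow> attach x (delete_set {x} Q) F"
  using AE_add_walks_connected[OF Q] conn AE_walk_meets[OF x] AE_space
proof eventually_elim
  case (elim F)
  have F: "F \<subseteq> V" using elim(4) by simp
  show ?case
  proof
    assume xF: "x \<notin> F"
    have walks: "AE Z in srw_law E y. AE X in srw_law E z. Q (F \<union> (trace X \<union> trace Z))"
      if "y \<in> F" "z \<in> F" for y z
      using elim(1,2) that F by blast
    \<comment> \<open>For walks that do not start in \<open>F\<close> the property is vacuous, so it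
      holds along all shifts of \<open>Y\<close> and can be used at the random time when
      \<open>Y\<close> is cut.\<close>
    define P where "P Y \<longleftrightarrow> Y 0 \<in> F \<longrightarrow> (\<forall>z\<in>F. AE X in srw_law E z. Q (F \<union> (trace X \<union> trace Y)))" for Y
    have "AE Y in srw_law E y. P Y" for y
    proof (cases "y \<in> F")
      case True
      have "countable F" using F countable_V countable_subset by blast
      then have "AE Y in srw_law E y. \<forall>z\<in>F. AE X in srw_law E z. Q (F \<union> (trace X \<union> trace Y))"
        using walks[OF True] by (simp add: AE_ball_countable)
      then show ?thesis by eventually_elim (simp add: P_def)
    next
      case False
      show ?thesis using srw_law_0[where E = E and x = y]
        by eventually_elim (use False in \<open>simp add: P_def\<close>)
    qed
    then have "AE Y in srw_law E x. \<forall>s. P (shift s Y)" by (intro AE_shift x)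
    then have "AE Y in srw_law E x. AE X in srw_law E x. delete_set {x} Q (F \<union> (trace X \<union> trace Y))"
      using elim(3) AE_finite_visits[OF x]
    proof eventually_elim
      case (elim Y)
      obtain m where "\<forall>n\<in>{n. Y n = x}. n \<le> m"
        using elim(3) x unfolding finite_nat_set_iff_bounded_le by blast
      then have "\<And>n. Y n = x \<Longrightarrow> n \<le> m" by blast
      moreover obtain s where s: "s \<ge> Suc m" "Y s \<in> F" using elim(2) by blast
      ultimately have s': "x \<notin> trace (shift s Y)" by (force simp: trace_def)
      have PY: "\<forall>z\<in>F. AE X in srw_law E z. Q (F \<union> (trace X \<union> trace (shift s Y)))"
        using elim(1) s(2) unfolding P_def by (auto dest!: spec[of _ s])
      define P' where "P' X \<longleftrightarrow> X 0 \<in> F \<longrightarrow> Q (F \<union> (trace X \<union> trace (shift s Y)))" for X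
      have "AE X in srw_law E z. P' X" for z
      proof (cases "z \<in> F")
        case True
        then have "AE X in srw_law E z. Q (F \<union> (trace X \<union> trace (shift s Y)))" using PY by blast
        then show ?thesis by eventually_elim (simp add: P'_def)
      next
        case False
        show ?thesis using srw_law_0[where E = E and x = z]
          by eventually_elim (use False in \<open>simp add: P'_def\<close>)
      qed
      then have "AE X in srw_law E x. \<forall>t. P' (shift t X)" by (intro AE_shift x)
      then show ?case
        using \<open>AE X in srw_law E x. \<forall>m. \<exists>s\<ge>m. X s \<in> F\<close> AE_finite_visits[OF x]
      proof eventually_elim
        case (elim X)
        obtain k where "\<forall>n\<in>{n. X n = x}. n \<le> k"
          using elim(3) x unfolding finite_nat_set_iff_bounded_le by blast
        then have "\<And>n. X n = x \<Longrightarrow> n \<le> k" by blast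
        moreover obtain t where t: "t \<ge> Suc k" "X t \<in> F" using elim(2) by blast
        ultimately have t': "x \<notin> trace (shift t X)" by (force simp: trace_def)
        let ?G = "F \<union> (trace X \<union> trace Y)" and ?G' = "F \<union> (trace (shift t X) \<union> trace (shift s Y))"
        have QG': "Q ?G'" using elim(1) t(2) unfolding P'_def by (auto dest!: spec[of _ t])
        have x': "x \<notin> ?G'" using xF s' t' by simp
        have sub: "trace (shift n Z) \<subseteq> trace Z" "trace Z - trace (shift n Z) \<subseteq> Z ` {..<n}" for n Z
        proof -
          show "trace (shift n Z) \<subseteq> trace Z" by (auto simp: trace_def)
          have "Z i \<in> Z ` {..<n} \<or> Z i \<in> range (shift n Z)" for i
            by (cases "i < n") (auto intro!: rev_image_eqI[of "i - n"])
          then show "trace Z - trace (shift n Z) \<subseteq> Z ` {..<n}" by (auto simp: trace_def)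
        qed
        have "trace (shift t X) \<subseteq> trace X" "trace (shift s Y) \<subseteq> trace Y"
          by (rule sub(1))+
        then have G: "?G' \<subseteq> ?G" by blast
        \<comment> \<open>Only finitely many vertices are lost when the initial segments are cut
          off; \<open>x\<close> can be put into \<open>W\<close> because it is not in
          \<open>?G'\<close>.\<close>
        define W where "W = insert x (?G - ?G')"
        have "trace X - trace (shift t X) \<subseteq> X ` {..<t}" "trace Y - trace (shift s Y) \<subseteq> Y ` {..<s}"
          by (rule sub(2))+
        then have "?G - ?G' \<subseteq> X ` {..<t} \<union> Y ` {..<s}" by blast
        then have "finite W" unfolding W_def by (auto intro: finite_subset)
        moreover have "W \<subseteq> V" unfolding W_def using x F trace_subset by blast
        moreover have "?G - W = ?G'" unfolding W_def using G x' by blast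
        ultimately show ?case unfolding delete_set_def using QG' by (intro bexI[of _ W]) (auto simp: W_def)
      qed
    qed
    then show "attach x (delete_set {x} Q) F"
      unfolding attach_def by eventually_elim simp
  qed
qed

text \<open>A deletion made before a trajectory \<open>T\<close> is attached can be made afterwards
  instead: \<open>W - T\<close> is removed together with the later deletion, which spares the points
  that \<open>T\<close> brings back.\<close>

lemma delete_attach:
  assumes F: "F \<subseteq> V" and D: "delete_set {x} (attach x (delete_set {x} Q)) F"
  shows "attach x (delete_set {x} Q) F"
proof -
  obtain W where W: "finite W" "W \<subseteq> V" "attach x (delete_set {x} Q) (F - W)"
    using D by (auto simp: delete_set_def)
  have del: "delete_set {x} Q (F \<union> T)" if T: "delete_set {x} Q (F - W \<union> T)" for T
  proof -
    obtain W' where W': "finite W'" "W' \<subseteq> V" "x \<in> W'" "Q ((F - W \<union> T) - W')"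
      using T unfolding delete_set_def by blast
    have "(F \<union> T) - (W' \<union> (W - T)) = (F - W \<union> T) - W'" by blast
    then show ?thesis
      unfolding delete_set_def using W W' by (intro bexI[of _ "W' \<union> (W - T)"]) auto
  qed
  show ?thesis
    unfolding attach_def using W(3)[unfolded attach_def]
  proof eventually_elim
    case (elim Y)
    show ?case
    proof
      assume "\<forall>n\<ge>1. Y n \<noteq> x"
      with elim have "AE X in srw_law E x. delete_set {x} Q (F - W \<union> (trace X \<union> trace Y))" by simp
      then show "AE X in srw_law E x. delete_set {x} Q (F \<union> (trace X \<union> trace Y))"
        by eventually_elim (rule del)
    qed
  qed
qed

text \<open>Induction on the number of trajectories through \<open>x\<close>. One of them is
  rerouted by \<open>AE_attach_delete\<close>, which is recorded in the almost sure property
  \<open>Q1\<close>; the induction hypothesis for \<open>Q1\<close> removes the others, and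
  \<open>delete_attach\<close> moves their deletion behind the attachment of the last one.\<close>

lemma AE_delete:
  assumes x: "x \<in> V" and Q: "Measurable.pred Conf Q" "AE F in \<mu>. Q F"
    and conn: "AE F in \<mu>. \<forall>y\<in>F. \<forall>z\<in>F. (y, z) \<in> (Restr E F)\<^sup>*"
  shows "AE F in \<mu>. delete_set {x} Q F"
  unfolding AE_decomposition[OF x pred_delete_set[OF Q(1)]]
proof
  fix n
  show "AE F in \<mu>. x \<notin> F \<longrightarrow> (attach x ^^ n) (delete_set {x} Q) F"
    using Q
  proof (induction n arbitrary: Q)
    case 0
    show ?case using 0(2)
    proof eventually_elim
      case (elim F)
      have "delete_set {x} Q F" if "x \<notin> F"
        unfolding delete_set_def
      proof (rule bexI[of _ "{x}"])
        show "{x} \<subseteq> {x} \<and> Q (F - {x})" using that elim by simp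
      qed (use x in simp)
      then show ?case unfolding funpow.simps id_apply by blast
    qed
  next
    case (Suc n)
    define Q1 where "Q1 F \<longleftrightarrow> x \<notin> F \<longrightarrow> attach x (delete_set {x} Q) F" for F
    have [measurable]: "Measurable.pred Conf (attach x (delete_set {x} Q))"
      by (intro pred_attach x pred_delete_set Suc.prems)
    have "Measurable.pred Conf Q1" unfolding Q1_def by measurable
    moreover have "AE F in \<mu>. Q1 F"
      unfolding Q1_def by (rule AE_attach_delete[OF x Suc.prems conn])
    ultimately have "AE F in \<mu>. x \<notin> F \<longrightarrow> (attach x ^^ n) (delete_set {x} Q1) F" by (rule Suc.IH)
    then show ?case using AE_space
    proof eventually_elim
      case (elim F)
      \<comment> \<open>The set deleted for \<open>Q1\<close> contains \<open>x\<close>, so the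
        premise of \<open>Q1\<close> that \<open>x\<close> is vacant is met.\<close>
      have *: "attach x (delete_set {x} Q) F" if "F \<subseteq> V" "delete_set {x} Q1 F" for F
      proof (rule delete_attach[OF that(1)])
        show "delete_set {x} (attach x (delete_set {x} Q)) F"
          using that(2) unfolding delete_set_def[of "{x}" Q1] delete_set_def[of "{x}" "attach x (delete_set {x} Q)"] Q1_def by blast
      qed
      show ?case
      proof
        assume "x \<notin> F"
        with elim(1) have "(attach x ^^ n) (delete_set {x} Q1) F" by blast
        then have "(attach x ^^ n) (attach x (delete_set {x} Q)) F"
          using elim(2) * by (intro attach_pow_mono[of "delete_set {x} Q1" "attach x (delete_set {x} Q)"]) auto
        then show "(attach x ^^ Suc n) (delete_set {x} Q) F" unfolding funpow_Suc_right comp_def .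
      qed
    qed
  qed
qed

end

section \<open>Clusters and trifurcations\<close>

context vt_graph
begin

section \<open>Connected sets and clusters\<close>

definition conn_set :: "'v set \<Rightarrow> bool" where
  "conn_set A \<longleftrightarrow> (\<forall>a\<in>A. \<forall>b\<in>A. (a, b) \<in> (Restr E A)\<^sup>*)"

lemma Restr_sym: "(x, y) \<in> (Restr E F)\<^sup>* \<Longrightarrow> (y, x) \<in> (Restr E F)\<^sup>*"
proof -
  have "sym (Restr E F)" using sym_E by (auto simp: sym_def)
  then show "(x, y) \<in> (Restr E F)\<^sup>* \<Longrightarrow> (y, x) \<in> (Restr E F)\<^sup>*"
    using sym_rtrancl by (blast dest: symD)
qed

lemma Restr_mono: "A \<subseteq> B \<Longrightarrow> (x, y) \<in> (Restr E A)\<^sup>* \<Longrightarrow> (x, y) \<in> (Restr E B)\<^sup>*"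
  by (rule rtrancl_mono[THEN subsetD, rotated]) auto

lemma cluster_mono: "A \<subseteq> B \<Longrightarrow> cluster A x \<subseteq> cluster B x"
  unfolding cluster_def using Restr_mono by blast

lemma cluster_eq: "y \<in> cluster F x \<Longrightarrow> cluster F y = cluster F x"
proof -
  assume "y \<in> cluster F x"
  then have xy: "(x, y) \<in> (Restr E F)\<^sup>*" by (simp add: cluster_def)
  show "cluster F y = cluster F x"
    unfolding cluster_def
    by (rule Collect_cong, rule iffI) (rule rtrancl_trans[OF xy], assumption, rule rtrancl_trans[OF Restr_sym[OF xy]], assumption)
qed

lemma cluster_eq_if_meet: "cluster F x \<inter> cluster F y \<noteq> {} \<Longrightarrow> cluster F x = cluster F y"
proof -
  assume "cluster F x \<inter> cluster F y \<noteq> {}"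
  then obtain z where "z \<in> cluster F x" "z \<in> cluster F y" by auto
  then show ?thesis using cluster_eq[of z F x] cluster_eq[of z F y] by simp
qed

lemma conn_set_cluster:
  assumes "x \<in> F"
  shows "conn_set (cluster F x)"
proof -
  have "(x, y) \<in> (Restr E (cluster F x))\<^sup>*" if "y \<in> cluster F x" for y
    using that unfolding cluster_def[of F x] mem_Collect_eq
  proof (induction rule: rtrancl_induct)
    case (step y z)
    then have "y \<in> cluster F x" "z \<in> cluster F x"
      by (auto simp: cluster_def intro: rtrancl_into_rtrancl)
    then show ?case using step by (auto simp: cluster_def intro: rtrancl_into_rtrancl)
  qed simp
  then show ?thesis unfolding conn_set_def using rtrancl_trans[OF Restr_sym] by blast
qed

lemma conn_set_subset_cluster:
  assumes "conn_set A" "A \<subseteq> F" "A \<inter> cluster F x \<noteq> {}"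
  shows "A \<subseteq> cluster F x"
proof
  fix b assume "b \<in> A"
  obtain a where a: "a \<in> A" "a \<in> cluster F x" using assms(3) by auto
  then have "(a, b) \<in> (Restr E A)\<^sup>*" using assms(1) \<open>b \<in> A\<close> by (auto simp: conn_set_def)
  then have "b \<in> cluster F a" using Restr_mono[OF assms(2)] by (auto simp: cluster_def)
  then show "b \<in> cluster F x" using cluster_eq[OF a(2)] by simp
qed

lemma cluster_eq_Diff:
  assumes "A \<subseteq> B" "a \<in> F - A" "cluster (F - A) a \<inter> B = {}"
  shows "cluster (F - B) a = cluster (F - A) a"
proof
  show "cluster (F - B) a \<subseteq> cluster (F - A) a" using assms by (intro cluster_mono) auto
  have "cluster (F - A) a \<subseteq> F - B" using cluster_subset[OF assms(2)] assms(3) by auto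
  then show "cluster (F - A) a \<subseteq> cluster (F - B) a"
    using conn_set_cluster[OF assms(2)] cluster_self[of a "F - A"] cluster_self[of a "F - B"]
    by (intro conn_set_subset_cluster) blast+
qed

text \<open>\<open>a\<close> is the last vertex before the path first enters
  \<open>L\<close>.\<close>

lemma exit_path:
  assumes "(y, l) \<in> (Restr E F)\<^sup>*" "l \<in> L" "y \<in> F - L"
  shows "\<exists>a. (y, a) \<in> (Restr E (F - L))\<^sup>* \<and> a \<in> F - L \<and> (\<exists>l'\<in>L \<inter> F. (a, l') \<in> E)"
  using assms
proof (induction rule: converse_rtrancl_induct)
  case (step y z)
  show ?case
  proof (cases "z \<in> L")
    case True
    then show ?thesis using step by auto
  next
    case False
    then obtain a where a: "(z, a) \<in> (Restr E (F - L))\<^sup>*" "a \<in> F - L" "\<exists>l'\<in>L \<inter> F. (a, l') \<in> E"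
      using step by auto
    moreover have "(y, z) \<in> Restr E (F - L)" using step False by auto
    ultimately show ?thesis by (meson converse_rtrancl_into_rtrancl)
  qed
qed auto

lemma boundary_point:
  assumes "conn_set C" "C \<subseteq> V" "a \<in> C" "a \<in> A" "b \<in> C" "b \<notin> A"
  shows "\<exists>d\<in>C. d \<in> vertex_boundary V E A"
proof -
  have "(a, b) \<in> (Restr E C)\<^sup>*" using assms by (auto simp: conn_set_def)
  then show ?thesis using assms(4)
  proof (induction rule: converse_rtrancl_induct)
    case base
    then show ?case using assms by simp
  next
    case (step y z)
    show ?case
    proof (cases "z \<in> A")
      case False
      then have "y \<in> C" "y \<in> vertex_boundary V E A"
        using step assms(2) by (auto simp: vertex_boundary_def)
      then show ?thesis by blast
    qed (use step in auto)
  qed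
qed

section \<open>Branches at finite connected sets\<close>

definition branches :: "'v set \<Rightarrow> 'v set \<Rightarrow> 'v set set" where
  "branches L F = {cluster (F - L) a | a. a \<in> F - L \<and> (\<exists>l\<in>L. (l, a) \<in> E) \<and> infinite (cluster (F - L) a)}"

lemma branchE:
  assumes "B \<in> branches L F"
  obtains a l where "B = cluster (F - L) a" "a \<in> F - L" "l \<in> L" "(l, a) \<in> E" "infinite B"
  using assms unfolding branches_def by blast

lemma branch_disjoint: "B \<in> branches L F \<Longrightarrow> B \<subseteq> F - L"
  using cluster_subset by (elim branchE) simp

lemma branch_absorbs:
  assumes "B \<in> branches L F" "conn_set M" "M \<subseteq> F" "M \<inter> L = {}" "M \<inter> B \<noteq> {}"
  shows "M \<subseteq> B"
proof -
  obtain a where "B = cluster (F - L) a" using assms(1) by (rule branchE)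
  then show ?thesis using assms conn_set_subset_cluster[of M "F - L" a] by blast
qed

lemma branch_extend:
  assumes "B \<in> branches L F" "L \<subseteq> L'" "B \<inter> L' = {}"
  shows "B \<in> branches L' F"
proof -
  obtain a l where a: "B = cluster (F - L) a" "a \<in> F - L" "l \<in> L" "(l, a) \<in> E" "infinite B"
    using assms(1) by (rule branchE)
  have "cluster (F - L') a = B" unfolding a(1)
    by (rule cluster_eq_Diff[OF assms(2) a(2)]) (use a(1) assms(3) in simp)
  moreover have "a \<in> F - L'" using a(1,2) assms(3) cluster_self by fastforce
  ultimately show ?thesis
    unfolding branches_def using a assms(2) by (intro CollectI exI[of _ a]) auto
qed

definition three_branches :: "'v set \<Rightarrow> 'v set \<Rightarrow> bool" where
  "three_branches L F \<longleftrightarrow> (\<exists>B1 B2 B3. {B1, B2, B3} \<subseteq> branches L F \<and> B1 \<noteq> B2 \<and> B1 \<noteq> B3 \<and> B2 \<noteq> B3)"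

lemma three_branches_avoid:
  assumes "three_branches L F"
  obtains B1 B2 where "B1 \<in> branches L F" "B2 \<in> branches L F" "B1 \<noteq> B2" "B1 \<noteq> C" "B2 \<noteq> C"
  using assms unfolding three_branches_def by (metis insert_subset)

text \<open>Take a branch containing as few members of \<open>\<S>\<close> as possible, but at least one: the branches
  of that member which point away are contained in it.\<close>

lemma leaf:
  assumes \<S>: "finite \<S>" "\<S> \<noteq> {}" "pairwise disjnt \<S>"
    and mem: "\<And>L. L \<in> \<S> \<Longrightarrow> L \<noteq> {} \<and> conn_set L \<and> L \<subseteq> F \<and> three_branches L F"
  shows "\<exists>L\<in>\<S>. \<exists>B1\<in>branches L F. \<exists>B2\<in>branches L F. B1 \<noteq> B2 \<and> B1 \<inter> \<Union>\<S> = {} \<and> B2 \<inter> \<Union>\<S> = {}"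
proof (cases "\<exists>L\<in>\<S>. \<exists>B\<in>branches L F. B \<inter> \<Union>\<S> \<noteq> {}")
  case False
  obtain L where L: "L \<in> \<S>" using \<S>(2) by auto
  obtain B1 B2 where "B1 \<in> branches L F" "B2 \<in> branches L F" "B1 \<noteq> B2"
    using three_branches_avoid[of L F] mem[OF L] by metis
  with False L show ?thesis by blast
next
  case True
  define cnt where "cnt B = card {M \<in> \<S>. M \<subseteq> B}" for B
  define P where "P z \<longleftrightarrow> fst z \<in> \<S> \<and> snd z \<in> branches (fst z) F \<and> snd z \<inter> \<Union>\<S> \<noteq> {}" for z
  obtain L0 B0 where "L0 \<in> \<S>" "B0 \<in> branches L0 F" "B0 \<inter> \<Union>\<S> \<noteq> {}" using True by blast
  then have "P (L0, B0)" by (simp add: P_def)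
  then obtain z where z: "P z" "\<And>y. P y \<Longrightarrow> cnt (snd z) \<le> cnt (snd y)"
    using ex_has_least_nat[of P "(L0, B0)" "\<lambda>z. cnt (snd z)"] by blast
  obtain L B where zLB: "z = (L, B)" by (cases z)
  have LB: "L \<in> \<S>" "B \<in> branches L F" "B \<inter> \<Union>\<S> \<noteq> {}" using z(1) by (auto simp: P_def zLB)
  obtain M where M: "M \<in> \<S>" "M \<inter> B \<noteq> {}" using LB(3) by auto
  have "M \<noteq> L" using branch_disjoint[OF LB(2)] M(2) by auto
  then have disj: "M \<inter> L = {}" using \<S>(3) M(1) LB(1) by (auto simp: pairwise_def disjnt_def)
  have MB: "M \<subseteq> B" by (rule branch_absorbs[OF LB(2) _ _ disj M(2)]) (use mem[OF M(1)] in blast)+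
  obtain l where l: "l \<in> L" using mem[OF LB(1)] by auto
  have lFM: "l \<in> F - M" using l disj mem[OF LB(1)] by auto
  \<comment> \<open>At most one of three branches of \<open>M\<close> is the component of
    \<open>F - M\<close> that contains \<open>L\<close>; two others point away from
    \<open>L\<close>.\<close>
  obtain B1 B2 where B: "B1 \<in> branches M F" "B2 \<in> branches M F" "B1 \<noteq> B2"
      "B1 \<noteq> cluster (F - M) l" "B2 \<noteq> cluster (F - M) l"
    using three_branches_avoid[of M F "cluster (F - M) l"] mem[OF M(1)] by metis
  have "B' \<inter> \<Union>\<S> = {}" if B': "B' \<in> branches M F" "B' \<noteq> cluster (F - M) l" for B'
  proof (rule ccontr)
    assume meet: "B' \<inter> \<Union>\<S> \<noteq> {}"
    obtain a m where a: "B' = cluster (F - M) a" "a \<in> F - M" "m \<in> M" "(m, a) \<in> E"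
      using B'(1) by (rule branchE)
    have B'L: "B' \<inter> L = {}"
    proof (rule ccontr)
      assume "B' \<inter> L \<noteq> {}"
      then have "L \<subseteq> B'"
        using B'(1) mem[OF LB(1)] disj by (intro branch_absorbs[of B' M F L]) auto
      then have "l \<in> cluster (F - M) a" using l a(1) by auto
      then show False using cluster_eq B'(2) a(1) by simp
    qed
    obtain b where b: "B = cluster (F - L) b" using LB(2) by (rule branchE)
    have aB': "a \<in> B'" using a(1) cluster_self by simp
    have "m \<in> cluster (F - L) b" using a(3) MB b by auto
    moreover have "(m, a) \<in> Restr E (F - L)"
      using a(2,3,4) B'L aB' disj mem[OF M(1)] by auto
    ultimately have "a \<in> cluster (F - L) b"
      by (auto simp: cluster_def intro: rtrancl_into_rtrancl)
    then have B'B: "B' \<subseteq> B"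
      using conn_set_cluster[OF a(2)] branch_disjoint[OF B'(1)] B'L aB' unfolding b
      by (intro conn_set_subset_cluster) (auto simp: a(1)[symmetric])
    have "P (M, B')" using M(1) B'(1) meet by (simp add: P_def)
    from z(2)[OF this] have le: "cnt B \<le> cnt B'" by (simp add: zLB)
    have "\<not> M \<subseteq> B'" using branch_disjoint[OF B'(1)] mem[OF M(1)] by auto
    \<comment> \<open>\<open>M\<close> lies in \<open>B\<close> but not in \<open>B'\<close>, so
      \<open>B'\<close> contains strictly fewer members, against the minimality of
      \<open>B\<close>.\<close>
    then have "{M \<in> \<S>. M \<subseteq> B'} \<subset> {M \<in> \<S>. M \<subseteq> B}" using B'B MB M(1) by auto
    then have "cnt B' < cnt B" unfolding cnt_def using \<S>(1) by (intro psubset_card_mono) auto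
    with le show False by simp
  qed
  then show ?thesis using M(1) B by blast
qed

text \<open>Remove a leaf \<open>L\<close>. Of the branches found for the remaining sets, at most
  one contains \<open>L\<close> and is discarded, while the two free branches of \<open>L\<close>
  are gained, so the guaranteed number grows by one.\<close>

lemma many_branches:
  assumes "finite \<S>" "pairwise disjnt \<S>"
    and "\<And>L. L \<in> \<S> \<Longrightarrow> L \<noteq> {} \<and> conn_set L \<and> L \<subseteq> F \<and> three_branches L F"
  shows "\<exists>\<D>. finite \<D> \<and> \<D> \<subseteq> branches (\<Union>\<S>) F \<and> card \<S> \<le> card \<D>"
  using assms
proof (induction "card \<S>" arbitrary: \<S>)
  case 0
  then show ?case by (intro exI[of _ "{}"]) auto
next
  case (Suc n)
  then have "\<S> \<noteq> {}" by auto
  then obtain L B1 B2 where L: "L \<in> \<S>" and B: "B1 \<in> branches L F" "B2 \<in> branches L F" "B1 \<noteq> B2"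
      "B1 \<inter> \<Union>\<S> = {}" "B2 \<inter> \<Union>\<S> = {}"
    using leaf[OF Suc.prems(1) _ Suc.prems(2,3)] by blast
  define \<S>' where "\<S>' = \<S> - {L}"
  have card: "card \<S>' = n" "card \<S> = Suc n" using Suc.hyps(2) L Suc.prems(1) by (auto simp: \<S>'_def)
  have dis: "L \<inter> \<Union>\<S>' = {}"
    using Suc.prems(2) L by (auto simp: pairwise_def disjnt_def \<S>'_def)
  have un: "\<Union>\<S> = L \<union> \<Union>\<S>'" using L by (auto simp: \<S>'_def)
  have "\<exists>\<D>. finite \<D> \<and> \<D> \<subseteq> branches (\<Union>\<S>') F \<and> card \<S>' \<le> card \<D>"
  proof (rule Suc.hyps(1))
    show "pairwise disjnt \<S>'" using Suc.prems(2) by (rule pairwise_subset) (auto simp: \<S>'_def)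
  qed (use card Suc.prems in \<open>auto simp: \<S>'_def\<close>)
  then obtain \<D>' where D': "finite \<D>'" "\<D>' \<subseteq> branches (\<Union>\<S>') F" "n \<le> card \<D>'"
    using card by auto
  define \<D> where "\<D> = {D \<in> \<D>'. D \<inter> L = {}}"
  have LF: "L \<subseteq> F" "conn_set L" "L \<noteq> {}" using Suc.prems(3)[OF L] by auto
  have "card (\<D>' - \<D>) \<le> 1"
  proof -
    have abs: "L \<subseteq> D" if "D \<in> \<D>' - \<D>" for D
    proof (rule branch_absorbs[OF _ LF(2,1) dis])
      show "D \<in> branches (\<Union>\<S>') F" using that D'(2) by blast
      show "L \<inter> D \<noteq> {}" using that by (auto simp: \<D>_def)
    qed
    have "D1 = D2" if D12: "D1 \<in> \<D>' - \<D>" "D2 \<in> \<D>' - \<D>" for D1 D2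
    proof -
      have br: "D1 \<in> branches (\<Union>\<S>') F" "D2 \<in> branches (\<Union>\<S>') F" using D12 D'(2) by auto
      obtain a1 where a1: "D1 = cluster (F - \<Union>\<S>') a1" using br(1) by (rule branchE)
      obtain a2 where a2: "D2 = cluster (F - \<Union>\<S>') a2" using br(2) by (rule branchE)
      have "D1 \<inter> D2 \<noteq> {}" using abs[OF D12(1)] abs[OF D12(2)] LF(3) by blast
      then show ?thesis unfolding a1 a2 by (rule cluster_eq_if_meet)
    qed
    then have "\<forall>D1\<in>\<D>' - \<D>. \<forall>D2\<in>\<D>' - \<D>. D1 = D2" by blast
    then show ?thesis using D'(1) card_le_Suc0_iff_eq[of "\<D>' - \<D>"] by simp
  qed
  moreover have "card \<D>' = card \<D> + card (\<D>' - \<D>)"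
  proof -
    have "\<D>' \<inter> \<D> = \<D>" by (auto simp: \<D>_def)
    then show ?thesis using card_Int_Diff[OF D'(1), of \<D>] by simp
  qed
  ultimately have cD: "n \<le> card \<D> + 1" using D'(3) by simp
  \<comment> \<open>A free branch of \<open>L\<close> touches \<open>L\<close>, so as a component of
    the complement of the other sets it would contain points of \<open>L\<close>; hence it is not
    among the branches kept.\<close>
  have new: "B' \<notin> \<D>" if B': "B' \<in> branches L F" "B' \<inter> \<Union>\<S> = {}" for B'
  proof
    assume "B' \<in> \<D>"
    then have "B' \<in> branches (\<Union>\<S>') F" "B' \<inter> L = {}" using D'(2) by (auto simp: \<D>_def)
    obtain a l where a: "B' = cluster (F - L) a" "a \<in> F - L" "l \<in> L" "(l, a) \<in> E"
      using B'(1) by (rule branchE)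
    obtain b where b: "B' = cluster (F - \<Union>\<S>') b" using \<open>B' \<in> branches (\<Union>\<S>') F\<close> by (rule branchE)
    have "a \<in> B'" using a(1) cluster_self by simp
    moreover have "(a, l) \<in> Restr E (F - \<Union>\<S>')"
      using a LF(1) dis B'(2) \<open>a \<in> B'\<close> un E_sym by auto
    ultimately have "l \<in> B'" unfolding b by (auto simp: cluster_def intro: rtrancl_into_rtrancl)
    then show False using \<open>B' \<inter> L = {}\<close> a(3) by auto
  qed
  show ?case
  proof (intro exI conjI)
    show "finite (\<D> \<union> {B1, B2})" using D'(1) by (simp add: \<D>_def)
    have "D \<in> branches (\<Union>\<S>) F" if "D \<in> \<D>" for D
    proof (rule branch_extend)
      show *: "D \<in> branches (\<Union>\<S>') F" using that D'(2) unfolding \<D>_def by blast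
      show "\<Union>\<S>' \<subseteq> \<Union>\<S>" unfolding un by blast
      show "D \<inter> \<Union>\<S> = {}" using branch_disjoint[OF *] that unfolding un \<D>_def by blast
    qed
    moreover have "B1 \<in> branches (\<Union>\<S>) F" "B2 \<in> branches (\<Union>\<S>) F"
      using B L by (blast intro: branch_extend[of _ L])+
    ultimately show "\<D> \<union> {B1, B2} \<subseteq> branches (\<Union>\<S>) F" by auto
    have "B1 \<notin> \<D>" "B2 \<notin> \<D>" using new B by auto
    then have "card (\<D> \<union> {B1, B2}) = card \<D> + 2"
      using B(3) D'(1) by (simp add: \<D>_def)
    then show "card \<S> \<le> card (\<D> \<union> {B1, B2})" using cD card by simp
  qed
qed

text \<open>Each branch starts next to a member, hence inside \<open>A\<close>, and is infinite,
  hence leaves \<open>A\<close> through the boundary. Different branches are disjoint, so they use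
  different boundary points.\<close>

lemma card_trifurcations_le:
  assumes A: "finite A" and F: "F \<subseteq> V" and \<S>: "finite \<S>" "pairwise disjnt \<S>"
    and mem: "\<And>L. L \<in> \<S> \<Longrightarrow> L \<noteq> {} \<and> conn_set L \<and> L \<subseteq> F \<and> three_branches L F"
    and nb: "\<And>L. L \<in> \<S> \<Longrightarrow> E `` L \<subseteq> A"
  shows "card \<S> \<le> card (vertex_boundary V E A)"
proof -
  obtain \<D> where D: "finite \<D>" "\<D> \<subseteq> branches (\<Union>\<S>) F" "card \<S> \<le> card \<D>"
    using many_branches[OF \<S> mem] by blast
  have "\<exists>d\<in>D. d \<in> vertex_boundary V E A" if DD: "D \<in> \<D>" for D
  proof -
    obtain a l where a: "D = cluster (F - \<Union>\<S>) a" "a \<in> F - \<Union>\<S>" "l \<in> \<Union>\<S>" "(l, a) \<in> E" "infinite D"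
      using subsetD[OF D(2) DD] by (rule branchE)
    have "D - A \<noteq> {}" using Diff_infinite_finite[OF A a(5)] by (rule infinite_imp_nonempty)
    then obtain b where b: "b \<in> D" "b \<notin> A" by blast
    show ?thesis
    proof (rule boundary_point)
      show "conn_set D" unfolding a(1) by (rule conn_set_cluster[OF a(2)])
      show "D \<subseteq> V" unfolding a(1) using cluster_subset[OF a(2)] F by blast
      show "a \<in> D" unfolding a(1) by (rule cluster_self)
      show "a \<in> A" using a(3,4) nb by blast
    qed (use b in auto)
  qed
  then obtain g where g: "\<And>D. D \<in> \<D> \<Longrightarrow> g D \<in> D \<and> g D \<in> vertex_boundary V E A" by metis
  have "inj_on g \<D>"
  proof (rule inj_onI)
    fix D1 D2 assume D12: "D1 \<in> \<D>" "D2 \<in> \<D>" "g D1 = g D2"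
    obtain a1 where a1: "D1 = cluster (F - \<Union>\<S>) a1" using subsetD[OF D(2) D12(1)] by (rule branchE)
    obtain a2 where a2: "D2 = cluster (F - \<Union>\<S>) a2" using subsetD[OF D(2) D12(2)] by (rule branchE)
    have "g D1 \<in> D1 \<inter> D2" using g[OF D12(1)] g[OF D12(2)] D12(3) by simp
    then have "D1 \<inter> D2 \<noteq> {}" by blast
    then show "D1 = D2" unfolding a1 a2 by (rule cluster_eq_if_meet)
  qed
  moreover have "finite (vertex_boundary V E A)" using A by (simp add: vertex_boundary_def)
  ultimately have "card \<D> \<le> card (vertex_boundary V E A)"
    using g by (intro card_inj_on_le[of g]) auto
  with D(3) show ?thesis by simp
qed

end

section \<open>The Burton--Keane argument\<close>

context vt_graph
begin

section \<open>Counting in finite sets with small boundary\<close>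

lemma boundary_near:
  assumes "(x, y) \<in> E ^^ k" "x \<in> A" "A \<subseteq> V" "y \<in> V - A"
  shows "\<exists>z\<in>vertex_boundary V E A. x \<in> gball k z"
  using assms(1,2)
proof (induction k arbitrary: x)
  case 0
  then show ?case using assms by auto
next
  case (Suc k)
  then obtain w where w: "(x, w) \<in> E" "(w, y) \<in> E ^^ k" by (meson relpow_Suc_D2)
  show ?case
  proof (cases "w \<in> A")
    case True
    then obtain z where z: "z \<in> vertex_boundary V E A" "w \<in> gball k z" using Suc.IH w by blast
    then have "x \<in> gball (Suc k) z" using w(1) E_sym by (auto simp: gball_Suc)
    then show ?thesis using z by blast
  next
    case False
    then have "x \<in> vertex_boundary V E A"
      using w(1) Suc.prems(2) E_in_V by (auto simp: vertex_boundary_def)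
    then show ?thesis by (intro bexI[of _ x]) auto
  qed
qed

text \<open>A point of \<open>A\<close> whose \<open>r\<close>-ball leaves \<open>A\<close> lies
  within distance \<open>r\<close> of the boundary, so balls around the boundary points cover all
  such points.\<close>

lemma card_bulk_ge:
  assumes A: "finite A" "A \<subseteq> V" and b: "\<And>x. x \<in> V \<Longrightarrow> card (gball r x) = b"
  shows "card A \<le> card {x \<in> A. gball r x \<subseteq> A} + b * card (vertex_boundary V E A)"
proof -
  let ?D = "vertex_boundary V E A"
  have D: "finite ?D" "?D \<subseteq> V" using A by (auto simp: vertex_boundary_def)
  have "A - {x \<in> A. gball r x \<subseteq> A} \<subseteq> (\<Union>z\<in>?D. gball r z)"
  proof
    fix x assume x: "x \<in> A - {x \<in> A. gball r x \<subseteq> A}"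
    then obtain y k where y: "y \<notin> A" "(x, y) \<in> E ^^ k" "k \<le> r" by (auto simp: gball_def)
    then have "y \<in> V" using x A gball_subset_V[of x r] by (auto simp: gball_def)
    then obtain z where "z \<in> ?D" "x \<in> gball k z"
      using boundary_near[OF y(2) _ A(2)] x y(1) by auto
    then show "x \<in> (\<Union>z\<in>?D. gball r z)" using gball_mono[OF y(3)] by blast
  qed
  then have "card (A - {x \<in> A. gball r x \<subseteq> A}) \<le> card (\<Union>z\<in>?D. gball r z)"
    using D by (intro card_mono) auto
  also have "\<dots> \<le> (\<Sum>z\<in>?D. card (gball r z))" by (rule card_UN_le[OF D(1)])
  also have "\<dots> = b * card ?D" using b D(2) by (simp add: subset_iff)
  finally have "card (A - {x \<in> A. gball r x \<subseteq> A}) \<le> b * card ?D" .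
  moreover have "card A = card (A \<inter> {x \<in> A. gball r x \<subseteq> A}) + card (A - {x \<in> A. gball r x \<subseteq> A})"
    by (rule card_Int_Diff[OF A(1)])
  moreover have "A \<inter> {x \<in> A. gball r x \<subseteq> A} = {x \<in> A. gball r x \<subseteq> A}" by blast
  ultimately show ?thesis by simp
qed

text \<open>Translates of a finite set may overlap, whereas the count of branches needs disjoint
  sets. A maximal disjoint subfamily suffices: balls of radius \<open>R + R\<close> around its
  centres cover \<open>T\<close>.\<close>

lemma card_le_disjoint_subfamily:
  assumes T: "finite T" "T \<subseteq> V" and b: "\<And>x. x \<in> V \<Longrightarrow> card (gball (R + R) x) = b"
    and L: "\<And>x. x \<in> T \<Longrightarrow> L x \<noteq> {} \<and> L x \<subseteq> gball R x"
    and bound: "\<And>S. S \<subseteq> T \<Longrightarrow> pairwise disjnt (L ` S) \<Longrightarrow> card (L ` S) \<le> m"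
  shows "card T \<le> b * m"
proof -
  define P where "P S \<longleftrightarrow> S \<subseteq> T \<and> (\<forall>x\<in>S. \<forall>y\<in>S. x \<noteq> y \<longrightarrow> L x \<inter> L y = {})" for S
  have "finite {S. P S}"
    by (rule finite_subset[of _ "Pow T"]) (use T in \<open>auto simp: P_def\<close>)
  moreover have "{} \<in> {S. P S}" by (simp add: P_def)
  ultimately obtain S where "S \<in> {S. P S}" "\<forall>S'\<in>{S. P S}. S \<subseteq> S' \<longrightarrow> S = S'"
    using finite_has_maximal2[of "{S. P S}" "{}"] by blast
  then have S: "P S" "\<And>S'. P S' \<Longrightarrow> S \<subseteq> S' \<Longrightarrow> S' = S" by auto
  have ST: "S \<subseteq> T" using S(1) by (simp add: P_def)
  have "T \<subseteq> (\<Union>s\<in>S. gball (R + R) s)"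
  proof
    fix x assume x: "x \<in> T"
    have "\<exists>s\<in>S. L x \<inter> L s \<noteq> {}"
    proof (rule ccontr)
      assume no: "\<not> (\<exists>s\<in>S. L x \<inter> L s \<noteq> {})"
      then have "P (insert x S)" using S(1) x unfolding P_def by blast
      then have "x \<in> S" using S(2)[of "insert x S"] by blast
      then show False using no L[OF x] by blast
    qed
    then obtain s v where s: "s \<in> S" "v \<in> L x" "v \<in> L s" by blast
    then have "v \<in> gball R s" "x \<in> gball R v"
      using L[OF x] L[of s] ST gball_sym[of v R x] by blast+
    then show "x \<in> (\<Union>s\<in>S. gball (R + R) s)" using s(1) gball_trans by blast
  qed
  then have "card T \<le> card (\<Union>s\<in>S. gball (R + R) s)"
    using finite_subset[OF ST T(1)] by (intro card_mono) auto
  also have "\<dots> \<le> (\<Sum>s\<in>S. card (gball (R + R) s))"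
    by (rule card_UN_le[OF finite_subset[OF ST T(1)]])
  also have "\<dots> = b * card S" using b ST T(2) by (simp add: subset_iff)
  finally have "card T \<le> b * card S" .
  moreover have "card S = card (L ` S)"
  proof (rule card_image[symmetric], rule inj_onI, rule ccontr)
    fix x y assume xy: "x \<in> S" "y \<in> S" "L x = L y" "x \<noteq> y"
    have "L x \<inter> L y = {}" using S(1) xy(1,2,4) by (simp add: P_def)
    moreover have "L x \<noteq> {}" using L[of x] ST xy(1) by blast
    ultimately show False using xy(3) by simp
  qed
  moreover have "card (L ` S) \<le> m"
  proof (rule bound[OF ST])
    show "pairwise disjnt (L ` S)"
    proof (rule pairwiseI)
      fix A B assume "A \<in> L ` S" "B \<in> L ` S" "A \<noteq> B"
      then obtain x y where "A = L x" "B = L y" "x \<in> S" "y \<in> S" "x \<noteq> y" by auto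
      then show "disjnt A B" using S(1) by (simp add: P_def disjnt_def)
    qed
  qed
  ultimately show ?thesis by (metis mult_le_mono2 order_trans)
qed

definition arm :: "'v set \<Rightarrow> 'v set \<Rightarrow> 'v \<Rightarrow> bool" where
  "arm L F v \<longleftrightarrow> v \<in> F - L \<and> (\<exists>l\<in>L. (l, v) \<in> E) \<and> infinite (cluster (F - L) v)"

text \<open>The three branches are represented by vertices \<open>a\<close>, \<open>b\<close>,
  \<open>c\<close>, so that only countable quantifiers occur and the event is measurable.\<close>

definition trifurcation :: "'v set \<Rightarrow> 'v set \<Rightarrow> bool" where
  "trifurcation L F \<longleftrightarrow> conn_set L \<and> L \<subseteq> F \<and> (\<exists>a\<in>V. \<exists>b\<in>V. \<exists>c\<in>V. arm L F a \<and> arm L F b \<and> arm L F c \<and>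
    (a, b) \<notin> (Restr E (F - L))\<^sup>* \<and> (a, c) \<notin> (Restr E (F - L))\<^sup>* \<and> (b, c) \<notin> (Restr E (F - L))\<^sup>*)"

lemma trifurcation_three_branches:
  assumes "trifurcation L F"
  shows "L \<noteq> {} \<and> conn_set L \<and> L \<subseteq> F \<and> three_branches L F"
proof -
  obtain a b c where abc: "arm L F a" "arm L F b" "arm L F c"
    "(a, b) \<notin> (Restr E (F - L))\<^sup>*" "(a, c) \<notin> (Restr E (F - L))\<^sup>*" "(b, c) \<notin> (Restr E (F - L))\<^sup>*"
    using assms unfolding trifurcation_def by blast
  have br: "cluster (F - L) v \<in> branches L F" if "arm L F v" for v
    using that unfolding branches_def arm_def by blast
  have ne: "cluster (F - L) v \<noteq> cluster (F - L) w" if "(v, w) \<notin> (Restr E (F - L))\<^sup>*" for v w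
    using that cluster_self[of w "F - L"] by (auto simp: cluster_def)
  have "three_branches L F"
    unfolding three_branches_def
    by (intro exI[of _ "cluster (F - L) a"] exI[of _ "cluster (F - L) b"] exI[of _ "cluster (F - L) c"] conjI ne abc)
      (use br abc in blast)
  moreover have "L \<noteq> {}" using abc(1) unfolding arm_def by blast
  ultimately show ?thesis using assms by (simp add: trifurcation_def)
qed

lemma pred_trifurcation:
  assumes L: "finite L" "L \<subseteq> V"
  shows "Measurable.pred Conf (trifurcation L)"
proof -
  have d: "(\<lambda>F. F - L) \<in> Conf \<rightarrow>\<^sub>M Conf"
    using L by (intro measurable_Conf_Diff measurable_Conf_const) auto
  have arm: "Measurable.pred Conf (\<lambda>F. arm L F v)" if v: "v \<in> V" for v
  proof -
    note [measurable] = pred_compose_Conf[OF pred_infinite_cluster[OF v] d]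
    show ?thesis unfolding arm_def Diff_iff by measurable
  qed
  have sub: "Measurable.pred Conf (\<lambda>F. L \<subseteq> F)"
  proof -
    have "Measurable.pred Conf (\<lambda>F. \<forall>x\<in>L. x \<in> F)"
      using L(1) by (intro pred_intros_finite) auto
    then show ?thesis by (simp only: subset_eq)
  qed
  have "Measurable.pred Conf (\<lambda>F. \<exists>a\<in>V. \<exists>b\<in>V. \<exists>c\<in>V. arm L F a \<and> arm L F b \<and> arm L F c \<and>
    (a, b) \<notin> (Restr E (F - L))\<^sup>* \<and> (a, c) \<notin> (Restr E (F - L))\<^sup>* \<and> (b, c) \<notin> (Restr E (F - L))\<^sup>*)"
  proof (intro pred_bex_countable[OF countable_V])
    fix a b c assume v: "a \<in> V" "b \<in> V" "c \<in> V"
    note [measurable] = arm[OF v(1)] arm[OF v(2)] arm[OF v(3)] pred_compose_Conf[OF pred_connected d]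
    show "Measurable.pred Conf (\<lambda>F. arm L F a \<and> arm L F b \<and> arm L F c \<and>
      (a, b) \<notin> (Restr E (F - L))\<^sup>* \<and> (a, c) \<notin> (Restr E (F - L))\<^sup>* \<and> (b, c) \<notin> (Restr E (F - L))\<^sup>*)"
      by measurable
  qed
  note [measurable] = this sub
  show ?thesis unfolding trifurcation_def by measurable
qed

lemma aut_connected:
  assumes f: "aut f"
  shows "(f x, f y) \<in> (Restr E (f ` F))\<^sup>* \<longleftrightarrow> (x, y) \<in> (Restr E F)\<^sup>*"
proof -
  have fwd: "(f x, f y) \<in> (Restr E (f ` F))\<^sup>*" if "(x, y) \<in> (Restr E F)\<^sup>*" "aut f" for x y F f
    using that(1)
  proof (induction rule: rtrancl_induct)
    case (step y z)
    then have "(f y, f z) \<in> Restr E (f ` F)" using aut_E_iff[OF that(2)] by auto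
    with step.IH show ?case by (rule rtrancl_into_rtrancl)
  qed simp
  have inv: "inv f (f v) = v" for v using aut_inj[OF f] by simp
  have "inv f ` f ` F = F" by (auto simp: image_image inv)
  then show ?thesis
    using fwd[OF _ f] fwd[OF _ aut_inv[OF f], of "f x" "f y" "f ` F"] by (auto simp: inv)
qed

lemma cluster_aut: "aut f \<Longrightarrow> cluster (f ` F) (f x) = f ` cluster F x"
proof -
  assume f: "aut f"
  show ?thesis
  proof (intro equalityI subsetI)
    fix y assume "y \<in> cluster (f ` F) (f x)"
    moreover obtain z where "y = f z" using surjD[OF aut_surj[OF f]] by blast
    ultimately show "y \<in> f ` cluster F x" using aut_connected[OF f] by (auto simp: cluster_def)
  qed (use aut_connected[OF f] in \<open>auto simp: cluster_def\<close>)
qed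

lemma infinite_cluster_aut: "aut f \<Longrightarrow> infinite (cluster (f ` F) (f x)) \<longleftrightarrow> infinite (cluster F x)"
  using finite_image_iff[OF inj_on_subset[OF aut_inj subset_UNIV]] by (simp add: cluster_aut)

lemma conn_set_aut: "aut f \<Longrightarrow> conn_set (f ` L) \<longleftrightarrow> conn_set L"
  by (simp add: conn_set_def aut_connected)

lemma trifurcation_aut_imp:
  assumes f: "aut f" and T: "trifurcation L F"
  shows "trifurcation (f ` L) (f ` F)"
proof -
  obtain a b c where abc: "a \<in> V" "b \<in> V" "c \<in> V" "arm L F a" "arm L F b" "arm L F c"
    "(a, b) \<notin> (Restr E (F - L))\<^sup>*" "(a, c) \<notin> (Restr E (F - L))\<^sup>*" "(b, c) \<notin> (Restr E (F - L))\<^sup>*"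
    using T unfolding trifurcation_def by blast
  have diff: "f ` F - f ` L = f ` (F - L)" by (rule image_set_diff[OF aut_inj[OF f], symmetric])
  have arm: "arm (f ` L) (f ` F) (f v)" if "arm L F v" for v
    using that aut_E_iff[OF f] infinite_cluster_aut[OF f] unfolding arm_def diff by blast
  have "conn_set (f ` L)" "f ` L \<subseteq> f ` F" using T conn_set_aut[OF f] by (auto simp: trifurcation_def)
  moreover have "f a \<in> V" "f b \<in> V" "f c \<in> V" using abc aut_V_iff[OF f] by auto
  moreover have "(f a, f b) \<notin> (Restr E (f ` F - f ` L))\<^sup>*" "(f a, f c) \<notin> (Restr E (f ` F - f ` L))\<^sup>*"
      "(f b, f c) \<notin> (Restr E (f ` F - f ` L))\<^sup>*"
    unfolding diff aut_connected[OF f] by (rule abc)+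
  ultimately show ?thesis
    unfolding trifurcation_def using arm abc(4-6) by blast
qed

lemma trifurcation_aut:
  assumes f: "aut f"
  shows "trifurcation (f ` L) (f ` F) \<longleftrightarrow> trifurcation L F"
proof
  have inv: "inv f ` f ` A = A" for A by (simp add: image_image aut_inj[OF f])
  show "trifurcation L F" if "trifurcation (f ` L) (f ` F)"
    using trifurcation_aut_imp[OF aut_inv[OF f] that] by (simp add: inv)
qed (rule trifurcation_aut_imp[OF f])

lemma amenable_boundary:
  assumes "amenable V E" "\<epsilon> > 0"
  shows "\<exists>A. A \<subseteq> V \<and> finite A \<and> A \<noteq> {} \<and> real (card (vertex_boundary V E A)) < \<epsilon> * real (card A)"
proof (rule ccontr)
  assume no: "\<not> ?thesis"
  let ?\<A> = "{A. A \<subseteq> V \<and> finite A \<and> A \<noteq> {}}"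
  have "\<epsilon> \<le> (INF A\<in>?\<A>. real (card (vertex_boundary V E A)) / real (card A))"
  proof (rule cINF_greatest)
    obtain w where "w \<in> V" using V_nonempty by auto
    then have "{w} \<in> ?\<A>" by simp
    then show "?\<A> \<noteq> {}" by blast
    fix A assume A: "A \<in> ?\<A>"
    then have "card A > 0" by (simp add: card_gt_0_iff)
    moreover have "\<epsilon> * real (card A) \<le> real (card (vertex_boundary V E A))"
    proof (rule ccontr)
      assume "\<not> ?thesis"
      then have "real (card (vertex_boundary V E A)) < \<epsilon> * real (card A)" by simp
      with A no show False by blast
    qed
    ultimately show "\<epsilon> \<le> real (card (vertex_boundary V E A)) / real (card A)"
      by (simp add: pos_le_divide_eq)
  qed
  then show False using assms by (simp add: amenable_def vertex_isoperimetric_const_def)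
qed

end

lemma (in prob_space) sum_prob_le:
  assumes "finite A" "\<And>x. x \<in> A \<Longrightarrow> S x \<in> events"
    and "\<And>\<omega>. \<omega> \<in> space M \<Longrightarrow> real (card {x \<in> A. \<omega> \<in> S x}) \<le> c"
  shows "(\<Sum>x\<in>A. prob (S x)) \<le> c"
proof -
  have "(\<Sum>x\<in>A. prob (S x)) = (\<Sum>x\<in>A. expectation (indicator (S x)))"
    using assms(2) by (intro sum.cong) auto
  also have "\<dots> = expectation (\<lambda>\<omega>. \<Sum>x\<in>A. indicator (S x) \<omega>)"
    using assms(2) by (intro Bochner_Integration.integral_sum[symmetric]) (auto simp: emeasure_eq_measure)
  also have "\<dots> \<le> expectation (\<lambda>_. c)"
  proof (rule integral_mono)
    show "integrable M (\<lambda>\<omega>. \<Sum>x\<in>A. indicator (S x) \<omega> :: real)"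
      using assms(2) by (intro Bochner_Integration.integrable_sum) (auto simp: emeasure_eq_measure)
    fix \<omega> assume "\<omega> \<in> space M"
    have "(\<Sum>x\<in>A. indicator (S x) \<omega>) = real (card {x \<in> A. \<omega> \<in> S x})"
      using assms(1) by (simp add: indicator_def sum.If_cases Int_def)
    then show "(\<Sum>x\<in>A. indicator (S x) \<omega>) \<le> c" using assms(3)[OF \<open>\<omega> \<in> space M\<close>] by simp
  qed simp
  finally show ?thesis by (simp add: prob_space)
qed

context invariant_conf
begin

text \<open>If a fixed \<open>L\<close> were a trifurcation with probability \<open>p > 0\<close>,
  so would be each of its translates. The expected number of trifurcations among those inside a
  finite set \<open>A\<close> would then be \<open>p\<close> times the size of the bulk of
  \<open>A\<close>, while the count of branches bounds it by a multiple of the boundary. Amenability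
  makes this impossible.\<close>

lemma AE_no_trifurcation:
  assumes "amenable V E"
  shows "AE F in \<mu>. \<forall>L. finite L \<longrightarrow> L \<subseteq> V \<longrightarrow> \<not> trifurcation L F"
proof -
  have "AE F in \<mu>. \<not> trifurcation L F" if L: "finite L" "L \<subseteq> V" for L
  proof -
    define p where "p = prob {F \<in> space \<mu>. trifurcation L F}"
    have ev: "{F \<in> space \<mu>. trifurcation K F} \<in> events" if "finite K" "K \<subseteq> V" for K
      using pred_trifurcation[OF that] by (simp add: pred_def sets_mu)
    have "p = 0"
    proof (rule ccontr)
      assume "p \<noteq> 0"
      then have p: "p > 0" by (simp add: p_def zero_less_measure_iff)
      have "L \<noteq> {}"
      proof
        assume "L = {}"
        then have "{F \<in> space \<mu>. trifurcation L F} = {}" using trifurcation_three_branches by blast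
        then have "p = 0" unfolding p_def by (simp only: measure_empty)
        with p show False by simp
      qed
      then obtain w where w: "w \<in> L" by auto
      then have wV: "w \<in> V" using L by auto
      obtain R where R: "L \<subseteq> gball R w" using finite_subset_gball[OF wV L] by blast
      have "\<forall>x\<in>V. \<exists>f. aut f \<and> f w = x"
      proof
        fix x assume x: "x \<in> V"
        obtain f where "aut f" "f w = x" by (rule ex_aut[OF wV x])
        then show "\<exists>f. aut f \<and> f w = x" by blast
      qed
      \<comment> \<open>Several automorphisms may move \<open>w\<close> to \<open>x\<close>; one is
        chosen for each \<open>x\<close>, so that the translates are indexed by vertices.\<close>
      from bchoice[OF this] obtain \<phi> where \<phi>: "\<And>x. x \<in> V \<Longrightarrow> aut (\<phi> x)" "\<And>x. x \<in> V \<Longrightarrow> \<phi> x w = x" by blast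
      define K where "K x = \<phi> x ` L" for x
      have K: "finite (K x)" "K x \<subseteq> V" "K x \<noteq> {}" "K x \<subseteq> gball R x" if "x \<in> V" for x
      proof -
        show "finite (K x)" "K x \<noteq> {}" using L w by (auto simp: K_def)
        have "K x \<subseteq> \<phi> x ` gball R w" using R by (auto simp: K_def)
        also have "\<dots> = gball R x" using aut_gball[OF \<phi>(1)[OF that], of R w] \<phi>(2)[OF that] by simp
        finally show "K x \<subseteq> gball R x" .
        then show "K x \<subseteq> V" using gball_subset_V[OF that] by blast
      qed
      have pK: "prob {F \<in> space \<mu>. trifurcation (K x) F} = p" if x: "x \<in> V" for x
        using prob_aut[OF \<phi>(1)[OF x] pred_trifurcation[OF K(1,2)[OF x]]] trifurcation_aut[OF \<phi>(1)[OF x]]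
        by (simp add: K_def p_def)
      obtain b1 where b1: "\<And>x. x \<in> V \<Longrightarrow> card (gball (Suc R) x) = b1" using card_gball[of "Suc R"] by blast
      obtain b2 where b2: "\<And>x. x \<in> V \<Longrightarrow> card (gball (R + R) x) = b2" using card_gball[of "R + R"] by blast
      \<comment> \<open>The estimates below give \<open>p * card A \<le> (p * b1 + b2) * D\<close>,
        which a boundary smaller than \<open>\<epsilon> * card A\<close> contradicts; the summand
        \<open>1\<close> keeps the denominator positive.\<close>
      define \<epsilon> where "\<epsilon> = p / (p * b1 + b2 + 1)"
      have den: "p * b1 + b2 + 1 > 0" using p by (intro add_nonneg_pos add_nonneg_nonneg) auto
      have "\<epsilon> > 0" using p den by (simp add: \<epsilon>_def)
      then obtain A where A: "A \<subseteq> V" "finite A" "A \<noteq> {}"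
          "real (card (vertex_boundary V E A)) < \<epsilon> * real (card A)"
        using amenable_boundary[OF assms] by blast
      define D where "D = card (vertex_boundary V E A)"
      \<comment> \<open>Radius \<open>Suc R\<close> places also the neighbours of each translate
        inside \<open>A\<close>.\<close>
      define A' where "A' = {x \<in> A. gball (Suc R) x \<subseteq> A}"
      have A': "finite A'" "A' \<subseteq> V" using A by (auto simp: A'_def)
      have "(\<Sum>x\<in>A'. prob {F \<in> space \<mu>. trifurcation (K x) F}) \<le> real (b2 * D)"
      proof (rule sum_prob_le[OF A'(1)])
        show "{F \<in> space \<mu>. trifurcation (K x) F} \<in> events" if "x \<in> A'" for x
          using K(1,2) that A'(2) by (intro ev) blast+
        fix F assume F: "F \<in> space \<mu>"
        define T where "T = {x \<in> A'. trifurcation (K x) F}"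
        have "card T \<le> b2 * D"
        proof (rule card_le_disjoint_subfamily[where L = K and R = R])
          show "finite T" "T \<subseteq> V" using A' by (auto simp: T_def)
          then show "K x \<noteq> {} \<and> K x \<subseteq> gball R x" if "x \<in> T" for x using that K(3,4) by blast
          fix S assume S: "S \<subseteq> T" "disjoint (K ` S)"
          show "card (K ` S) \<le> D"
            unfolding D_def
          proof (rule card_trifurcations_le[OF A(2)])
            show "F \<subseteq> V" using F by simp
            show "finite (K ` S)" using S(1) \<open>finite T\<close> finite_subset by blast
            fix M assume "M \<in> K ` S"
            then obtain x where x: "M = K x" "x \<in> A'" "trifurcation (K x) F" using S(1) by (auto simp: T_def)
            show "M \<noteq> {} \<and> conn_set M \<and> M \<subseteq> F \<and> three_branches M F"
              unfolding x(1) by (rule trifurcation_three_branches[OF x(3)])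
            have "E `` M \<subseteq> E `` gball R x" using x K(4) A'(2) by blast
            also have "\<dots> \<subseteq> gball (Suc R) x" by (auto simp: gball_Suc)
            also have "\<dots> \<subseteq> A" using x(2) by (simp add: A'_def)
            finally show "E `` M \<subseteq> A" .
          qed (rule S(2))
        qed (rule b2)
        moreover have "{x \<in> A'. F \<in> {F \<in> space \<mu>. trifurcation (K x) F}} = T"
          using F by (auto simp: T_def)
        ultimately show "real (card {x \<in> A'. F \<in> {F \<in> space \<mu>. trifurcation (K x) F}}) \<le> real (b2 * D)"
          by (simp only: of_nat_le_iff)
      qed
      moreover have "(\<Sum>x\<in>A'. prob {F \<in> space \<mu>. trifurcation (K x) F}) = (\<Sum>x\<in>A'. p)"
        using pK A'(2) by (intro sum.cong) auto
      ultimately have 1: "real (card A') * p \<le> b2 * D" by simp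
      have "card A \<le> card A' + b1 * D"
        unfolding A'_def D_def by (rule card_bulk_ge[OF A(2,1) b1])
      then have "real (card A) \<le> real (card A') + b1 * D"
        by (metis of_nat_add of_nat_le_iff of_nat_mult)
      then have "real (card A) * p \<le> (real (card A') + b1 * D) * p" using p by (intro mult_right_mono) auto
      also have "\<dots> = real (card A') * p + p * b1 * D" by (simp add: algebra_simps)
      also have "\<dots> \<le> (p * b1 + b2) * D" using 1 by (simp add: algebra_simps)
      also have "\<dots> \<le> (p * b1 + b2 + 1) * D" by (intro mult_right_mono) auto
      also have "\<dots> < (p * b1 + b2 + 1) * (\<epsilon> * real (card A))"
        using A(4) den unfolding D_def by (intro mult_strict_left_mono)
      also have "\<dots> = real (card A) * p" using den by (simp add: \<epsilon>_def)
      finally show False by simp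
    qed
    then have "AE F in \<mu>. F \<notin> {F \<in> space \<mu>. trifurcation L F}"
      unfolding p_def using prob_eq_0[OF ev[OF L]] by blast
    with AE_space show ?thesis by eventually_elim blast
  qed
  then have "AE F in \<mu>. \<forall>L\<in>{L. finite L \<and> L \<subseteq> V}. \<not> trifurcation L F"
    by (subst AE_ball_countable[OF countable_Collect_finite_subset[OF countable_V]]) blast
  then show ?thesis by eventually_elim blast
qed

end

section \<open>Uniqueness of the infinite cluster\<close>

context vt_graph
begin

text \<open>\<open>separated k F\<close> means that \<open>F\<close> has at least \<open>k\<close> infinite clusters.\<close>

definition separated :: "nat \<Rightarrow> 'v set \<Rightarrow> bool" where
  "separated k F \<longleftrightarrow> (\<exists>X\<in>{X. finite X \<and> X \<subseteq> V}. card X = k \<and>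
    (\<forall>x\<in>X. x \<in> F \<and> infinite (cluster F x)) \<and> (\<forall>x\<in>X. \<forall>y\<in>X. x \<noteq> y \<longrightarrow> (x, y) \<notin> (Restr E F)\<^sup>*))"

lemma pred_separated: "Measurable.pred Conf (separated k)"
  unfolding separated_def
proof (rule pred_bex_countable[OF countable_Collect_finite_subset[OF countable_V]])
  fix X assume "X \<in> {X. finite X \<and> X \<subseteq> V}"
  then have X: "finite X" "X \<subseteq> V" by auto
  have 1: "Measurable.pred Conf (\<lambda>F. x \<in> F \<and> infinite (cluster F x))" if "x \<in> X" for x
  proof -
    have [measurable]: "Measurable.pred Conf (\<lambda>F. infinite (cluster F x))"
      using that X by (intro pred_infinite_cluster) auto
    show ?thesis by measurable
  qed
  have 2: "Measurable.pred Conf (\<lambda>F. \<forall>x\<in>X. x \<in> F \<and> infinite (cluster F x))"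
    using 1 by (intro pred_intros_finite X(1))
  have 3: "Measurable.pred Conf (\<lambda>F. \<forall>x\<in>X. \<forall>y\<in>X. x \<noteq> y \<longrightarrow> (x, y) \<notin> (Restr E F)\<^sup>*)"
  proof (intro pred_intros_finite X(1))
    show "Measurable.pred Conf (\<lambda>F. x \<noteq> y \<longrightarrow> (x, y) \<notin> (Restr E F)\<^sup>*)" for x y by measurable
  qed
  note [measurable] = 2 3
  show "Measurable.pred Conf (\<lambda>F. card X = k \<and> (\<forall>x\<in>X. x \<in> F \<and> infinite (cluster F x)) \<and>
      (\<forall>x\<in>X. \<forall>y\<in>X. x \<noteq> y \<longrightarrow> (x, y) \<notin> (Restr E F)\<^sup>*))"
    by measurable
qed

lemma separatedE:
  assumes "separated k F"
  obtains X where "finite X" "X \<subseteq> V" "card X = k" "\<forall>x\<in>X. x \<in> F \<and> infinite (cluster F x)"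
    "\<forall>x\<in>X. \<forall>y\<in>X. x \<noteq> y \<longrightarrow> (x, y) \<notin> (Restr E F)\<^sup>*"
  using assms unfolding separated_def by (elim bexE conjE CollectE)

lemma separated_aut_imp:
  assumes f: "aut f" and S: "separated k F"
  shows "separated k (f ` F)"
proof -
  obtain X where X0: "finite X" "X \<subseteq> V" "card X = k"
    "\<forall>x\<in>X. x \<in> F \<and> infinite (cluster F x)"
    "\<forall>x\<in>X. \<forall>y\<in>X. x \<noteq> y \<longrightarrow> (x, y) \<notin> (Restr E F)\<^sup>*"
    using S by (rule separatedE)
  have X: "finite X" "X \<subseteq> V" "card X = k" "\<And>x. x \<in> X \<Longrightarrow> x \<in> F \<and> infinite (cluster F x)"
    "\<And>x y. x \<in> X \<Longrightarrow> y \<in> X \<Longrightarrow> x \<noteq> y \<Longrightarrow> (x, y) \<notin> (Restr E F)\<^sup>*"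
    using X0 by simp_all
  show ?thesis
    unfolding separated_def
  proof (intro bexI[of _ "f ` X"] conjI)
    show "f ` X \<in> {X. finite X \<and> X \<subseteq> V}" using X(1,2) aut_V_iff[OF f] by auto
    show "card (f ` X) = k" using X(3) card_image[OF inj_on_subset[OF aut_inj[OF f] subset_UNIV]] by simp
    show "\<forall>x\<in>f ` X. x \<in> f ` F \<and> infinite (cluster (f ` F) x)"
      using X(4) infinite_cluster_aut[OF f] by auto
    show "\<forall>x\<in>f ` X. \<forall>y\<in>f ` X. x \<noteq> y \<longrightarrow> (x, y) \<notin> (Restr E (f ` F))\<^sup>*"
      using X(5) aut_connected[OF f] by auto
  qed
qed

lemma separated_aut:
  assumes f: "aut f"
  shows "separated k (f ` F) \<longleftrightarrow> separated k F"
proof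
  have inv: "inv f ` f ` A = A" for A by (simp add: image_image aut_inj[OF f])
  show "separated k F" if "separated k (f ` F)"
    using separated_aut_imp[OF aut_inv[OF f] that] by (simp add: inv)
qed (rule separated_aut_imp[OF f])

lemma infinite_components:
  "{C \<in> components_of E F. infinite C} = {cluster F x | x. x \<in> F \<and> infinite (cluster F x)}"
proof -
  have "(Restr E F)\<^sup>* `` {x} = cluster F x" for x by (auto simp: cluster_def)
  then show ?thesis by (auto simp: components_of_def quotient_def)
qed

lemma num_infinite_components_0:
  assumes "F \<subseteq> V" "\<not> separated 1 F"
  shows "num_infinite_components E F = 0"
proof -
  have "finite (cluster F x)" if x: "x \<in> F" for x
  proof (rule ccontr)
    assume "infinite (cluster F x)"
    then have "separated 1 F"
      unfolding separated_def using assms(1) x by (intro bexI[of _ "{x}"]) auto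
    with assms(2) show False by simp
  qed
  then have "{C \<in> components_of E F. infinite C} = {}" unfolding infinite_components by blast
  then show ?thesis unfolding num_infinite_components_def Let_def by (simp only:) (simp add: zero_enat_def)
qed

lemma one_infinite_cluster:
  assumes "F \<subseteq> V" "\<not> separated 2 F" "x \<in> F" "infinite (cluster F x)" "y \<in> F" "infinite (cluster F y)"
  shows "(x, y) \<in> (Restr E F)\<^sup>*"
proof (rule ccontr)
  assume xy: "(x, y) \<notin> (Restr E F)\<^sup>*"
  then have ne: "x \<noteq> y" by auto
  have yx: "(y, x) \<notin> (Restr E F)\<^sup>*" using xy Restr_sym by blast
  have "separated 2 F"
    unfolding separated_def
  proof (intro bexI[of _ "{x, y}"] conjI)
    show "card {x, y} = 2" using ne by simp
  qed (use assms xy yx in auto)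
  with assms(2) show False by simp
qed

lemma num_infinite_components_1:
  assumes "F \<subseteq> V" "separated 1 F" "\<not> separated 2 F"
  shows "num_infinite_components E F = 1"
proof -
  obtain X where "card X = 1" "\<forall>x\<in>X. x \<in> F \<and> infinite (cluster F x)"
    using assms(2) by (rule separatedE)
  then obtain x where x: "x \<in> F" "infinite (cluster F x)" by (auto simp: card_1_singleton_iff)
  have "{C \<in> components_of E F. infinite C} = {cluster F x}"
    unfolding infinite_components
  proof (intro equalityI subsetI)
    fix C assume "C \<in> {cluster F x |x. x \<in> F \<and> infinite (cluster F x)}"
    then obtain y where y: "C = cluster F y" "y \<in> F" "infinite (cluster F y)" by blast
    then have "(x, y) \<in> (Restr E F)\<^sup>*" using one_infinite_cluster[OF assms(1,3) x] by blast
    then have "cluster F y = cluster F x" by (intro cluster_eq) (simp add: cluster_def)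
    then show "C \<in> {cluster F x}" using y(1) by simp
  qed (use x in blast)
  then show ?thesis unfolding num_infinite_components_def Let_def by (simp only:) (simp add: one_enat_def)
qed

text \<open>Every component left of the cluster after removal of \<open>L\<close> touches
  \<open>L\<close>, because the cluster contains \<open>l\<close>, and only finitely many vertices
  are adjacent to \<open>L\<close>. So finitely many components share an infinite set.\<close>

lemma ex_arm:
  assumes F: "F \<subseteq> V" and L: "finite L" and l: "l \<in> L" "(x, l) \<in> (Restr E F)\<^sup>*" and inf: "infinite (cluster F x)"
  obtains a where "arm L F a" "a \<in> cluster F x"
proof -
  let ?N = "(\<Union>l\<in>L. E `` {l}) \<inter> (cluster F x - L) \<inter> F"
  have "cluster F x - L \<subseteq> insert x (\<Union>a\<in>?N. cluster (F - L) a)"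
  proof
    fix y assume y: "y \<in> cluster F x - L"
    show "y \<in> insert x (\<Union>a\<in>?N. cluster (F - L) a)"
    proof (cases "y = x")
      case False
      then have yF: "y \<in> F - L" using y cluster_subset_insert[of F x] by blast
      have xy: "(x, y) \<in> (Restr E F)\<^sup>*" using y by (simp add: cluster_def)
      then have "(y, l) \<in> (Restr E F)\<^sup>*" using l(2) Restr_sym rtrancl_trans by meson
      from exit_path[OF this l(1) yF] obtain a l' where
        a: "(y, a) \<in> (Restr E (F - L))\<^sup>*" "a \<in> F - L" "l' \<in> L" "(a, l') \<in> E" by blast
      have "(y, a) \<in> (Restr E F)\<^sup>*" by (rule Restr_mono[OF _ a(1)]) blast
      with xy have "a \<in> cluster F x" by (simp add: cluster_def)
      then have "a \<in> ?N" using a E_sym by blast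
      moreover have "y \<in> cluster (F - L) a" using Restr_sym[OF a(1)] by (simp add: cluster_def)
      ultimately show ?thesis by blast
    qed simp
  qed
  moreover have "infinite (cluster F x - L)" by (rule Diff_infinite_finite[OF L inf])
  ultimately have "infinite (\<Union>a\<in>?N. cluster (F - L) a)"
    using finite_subset finite_insert by metis
  moreover have "finite ?N" using L by (intro finite_Int disjI1) auto
  ultimately obtain a where a: "a \<in> ?N" "infinite (cluster (F - L) a)" by blast
  then have "arm L F a" unfolding arm_def by blast
  then show ?thesis using a(1) by (intro that[of a]) blast+
qed

lemma conn_set_gball: "conn_set (gball n x)"
proof -
  have "(x, y) \<in> (Restr E (gball n x))\<^sup>*" if "y \<in> gball n x" for y
    using that
  proof (induction n arbitrary: y)
    case (Suc n)
    have mono: "gball n x \<subseteq> gball (Suc n) x" by (simp add: gball_Suc)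
    show ?case
    proof (cases "y \<in> gball n x")
      case True
      then show ?thesis using Suc.IH Restr_mono[OF mono] by blast
    next
      case False
      then obtain z where z: "z \<in> gball n x" "(z, y) \<in> E" using Suc.prems by (auto simp: gball_Suc)
      then have "(x, z) \<in> (Restr E (gball (Suc n) x))\<^sup>*" using Suc.IH Restr_mono[OF mono] by blast
      moreover have "(z, y) \<in> Restr E (gball (Suc n) x)" using z mono Suc.prems by blast
      ultimately show ?thesis by (rule rtrancl_into_rtrancl)
    qed
  qed simp
  then show ?thesis unfolding conn_set_def using rtrancl_trans[OF Restr_sym] by blast
qed

lemma ex_conn_set:
  assumes "finite X" "X \<subseteq> V"
  obtains K where "finite K" "K \<subseteq> V" "conn_set K" "X \<subseteq> K"
proof -
  obtain w where w: "w \<in> V" using V_nonempty by auto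
  obtain n where "X \<subseteq> gball n w" using finite_subset_gball[OF w assms] by blast
  then show ?thesis by (intro that[of "gball n w"] finite_gball gball_subset_V[OF w] conn_set_gball)
qed

end

context ergodic_conf
begin

text \<open>\<open>merge\<close> replaces finite energy: a connected set \<open>K\<close> can be
  added as part of some larger connected \<open>L\<close> that is not under control. Three infinite
  clusters would turn \<open>L\<close> into a trifurcation. Two are excluded by ergodicity: two
  infinite clusters would remain after \<open>L\<close> is added, one of them would miss
  \<open>L\<close>, and this one would be a third infinite cluster of \<open>F\<close>.\<close>

lemma zero_or_one_infinite_cluster:
  assumes amenable: "amenable V E"
    and merge: "\<And>Q. Measurable.pred Conf Q \<Longrightarrow> AE F in \<mu>. Q F \<Longrightarrow>
      AE F in \<mu>. \<forall>K. finite K \<longrightarrow> K \<subseteq> V \<longrightarrow> conn_set K \<longrightarrow> K \<inter> F \<noteq> {} \<longrightarrow>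
        (\<exists>L. finite L \<and> L \<subseteq> V \<and> K \<subseteq> L \<and> conn_set L \<and> Q (F \<union> L))"
  shows "(AE F in \<mu>. \<not> separated 1 F) \<or> (AE F in \<mu>. separated 1 F \<and> \<not> separated 2 F)"
proof -
  have erg: "(AE F in \<mu>. separated k F) \<or> (AE F in \<mu>. \<not> separated k F)" for k
    by (rule ergodic[OF pred_separated separated_aut])
  have no3: "AE F in \<mu>. \<not> separated 3 F"
  proof -
    define Q where "Q = (\<lambda>F. \<not> (\<exists>L\<in>{L. finite L \<and> L \<subseteq> V}. trifurcation L F))"
    have "Measurable.pred Conf (\<lambda>F. \<exists>L\<in>{L. finite L \<and> L \<subseteq> V}. trifurcation L F)"
      using pred_trifurcation
      by (intro pred_bex_countable[OF countable_Collect_finite_subset[OF countable_V]]) blast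
    then have "Measurable.pred Conf Q"
      unfolding Q_def by measurable
    moreover have "AE F in \<mu>. Q F"
      using AE_no_trifurcation[OF amenable] by eventually_elim (simp add: Q_def)
    ultimately have "AE F in \<mu>. \<forall>K. finite K \<longrightarrow> K \<subseteq> V \<longrightarrow> conn_set K \<longrightarrow> K \<inter> F \<noteq> {} \<longrightarrow>
        (\<exists>L. finite L \<and> L \<subseteq> V \<and> K \<subseteq> L \<and> conn_set L \<and> Q (F \<union> L))" by (rule merge)
    then show ?thesis using AE_space
    proof eventually_elim
      case (elim F)
      have F: "F \<subseteq> V" using elim(2) by simp
      show ?case
      proof
        assume s3: "separated 3 F"
        obtain X where X0: "finite X" "X \<subseteq> V" "card X = 3"
          "\<forall>x\<in>X. x \<in> F \<and> infinite (cluster F x)"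
          "\<forall>x\<in>X. \<forall>y\<in>X. x \<noteq> y \<longrightarrow> (x, y) \<notin> (Restr E F)\<^sup>*"
          using s3 by (rule separatedE)
        have X: "finite X" "X \<subseteq> V" "card X = 3" "\<And>x. x \<in> X \<Longrightarrow> x \<in> F \<and> infinite (cluster F x)"
          "\<And>x y. x \<in> X \<Longrightarrow> y \<in> X \<Longrightarrow> x \<noteq> y \<Longrightarrow> (x, y) \<notin> (Restr E F)\<^sup>*"
          using X0 by simp_all
        obtain a b c where abc: "X = {a, b, c}" "a \<noteq> b" "a \<noteq> c" "b \<noteq> c"
          using X(3) by (auto simp: card_3_iff)
        obtain K where K: "finite K" "K \<subseteq> V" "conn_set K" "X \<subseteq> K" by (rule ex_conn_set[OF X(1,2)])
        have "K \<inter> F \<noteq> {}" using K(4) X(4)[of a] abc(1) by blast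
        from elim(1)[rule_format, OF K(1-3) this] obtain L where L: "finite L" "L \<subseteq> V" "K \<subseteq> L"
          "conn_set L" "Q (F \<union> L)"
          by (elim exE conjE)
        have ex: "\<exists>a. arm L F a \<and> a \<in> cluster F x" if "x \<in> X" for x
        proof -
          have "x \<in> L" "infinite (cluster F x)" using that K(4) L(3) X(4) by auto
          then obtain a where "arm L F a" "a \<in> cluster F x"
            using ex_arm[OF F L(1), of x x] by blast
          then show ?thesis by blast
        qed
        \<comment> \<open>Adding \<open>L\<close> changes nothing outside \<open>L\<close>, so arms
          in \<open>F\<close> are arms in \<open>F \<union> L\<close>.\<close>
        have eq: "F \<union> L - L = F - L" by blast
        obtain a' where a': "arm L F a'" "a' \<in> cluster F a" using ex[of a] abc(1) by blast
        obtain b' where b': "arm L F b'" "b' \<in> cluster F b" using ex[of b] abc(1) by blast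
        obtain c' where c': "arm L F c'" "c' \<in> cluster F c" using ex[of c] abc(1) by blast
        have sep: "(v', w') \<notin> (Restr E (F - L))\<^sup>*"
          if "v' \<in> cluster F v" "w' \<in> cluster F w" "(v, w) \<notin> (Restr E F)\<^sup>*" for v w v' w'
        proof
          assume "(v', w') \<in> (Restr E (F - L))\<^sup>*"
          then have "(v', w') \<in> (Restr E F)\<^sup>*" by (rule Restr_mono[rotated]) blast
          moreover have "(v, v') \<in> (Restr E F)\<^sup>*" "(w', w) \<in> (Restr E F)\<^sup>*"
            using that(1,2) Restr_sym by (auto simp: cluster_def)
          ultimately have "(v, w) \<in> (Restr E F)\<^sup>*" by (meson rtrancl_trans)
          with that(3) show False by simp
        qed
        have arm: "arm L (F \<union> L) v" "v \<in> V" if "arm L F v" for v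
          using that F unfolding arm_def eq by auto
        have "(a', b') \<notin> (Restr E (F - L))\<^sup>*" "(a', c') \<notin> (Restr E (F - L))\<^sup>*" "(b', c') \<notin> (Restr E (F - L))\<^sup>*"
          using sep[OF a'(2) b'(2)] sep[OF a'(2) c'(2)] sep[OF b'(2) c'(2)] X(5) abc by blast+
        then have "trifurcation L (F \<union> L)"
          unfolding trifurcation_def eq using L(4) arm[OF a'(1)] arm[OF b'(1)] arm[OF c'(1)] by blast
        then show False using L(1,2,5) by (simp add: Q_def)
      qed
    qed
  qed
  have no2: "AE F in \<mu>. \<not> separated 2 F"
  proof (rule ccontr)
    assume "\<not> (AE F in \<mu>. \<not> separated 2 F)"
    then have two: "AE F in \<mu>. separated 2 F" using erg[of 2] by blast
    have "AE F in \<mu>. False"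
      using merge[OF pred_separated two] two no3 AE_space
    proof eventually_elim
      case (elim F)
      have F: "F \<subseteq> V" using elim(4) by simp
      obtain X where X0: "finite X" "X \<subseteq> V" "card X = 2"
        "\<forall>x\<in>X. x \<in> F \<and> infinite (cluster F x)"
        "\<forall>x\<in>X. \<forall>y\<in>X. x \<noteq> y \<longrightarrow> (x, y) \<notin> (Restr E F)\<^sup>*"
        using elim(2) by (rule separatedE)
      have X: "finite X" "X \<subseteq> V" "card X = 2" "\<And>x. x \<in> X \<Longrightarrow> x \<in> F \<and> infinite (cluster F x)"
        "\<And>x y. x \<in> X \<Longrightarrow> y \<in> X \<Longrightarrow> x \<noteq> y \<Longrightarrow> (x, y) \<notin> (Restr E F)\<^sup>*"
        using X0 by simp_all
      obtain a b where ab: "X = {a, b}" "a \<noteq> b" using X(3) by (auto simp: card_2_iff)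
      obtain K where K: "finite K" "K \<subseteq> V" "conn_set K" "X \<subseteq> K" by (rule ex_conn_set[OF X(1,2)])
      have "K \<inter> F \<noteq> {}" using K(4) X(4)[of a] ab(1) by blast
      from elim(1)[rule_format, OF K(1-3) this] obtain L where L: "finite L" "L \<subseteq> V" "K \<subseteq> L"
        "conn_set L" "separated 2 (F \<union> L)"
        by (elim exE conjE)
      obtain Y where Y0: "finite Y" "Y \<subseteq> V" "card Y = 2"
        "\<forall>x\<in>Y. x \<in> F \<union> L \<and> infinite (cluster (F \<union> L) x)"
        "\<forall>x\<in>Y. \<forall>y\<in>Y. x \<noteq> y \<longrightarrow> (x, y) \<notin> (Restr E (F \<union> L))\<^sup>*"
        using L(5) by (rule separatedE)
      have Y: "finite Y" "Y \<subseteq> V" "card Y = 2" "\<And>x. x \<in> Y \<Longrightarrow> x \<in> F \<union> L \<and> infinite (cluster (F \<union> L) x)"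
        "\<And>x y. x \<in> Y \<Longrightarrow> y \<in> Y \<Longrightarrow> x \<noteq> y \<Longrightarrow> (x, y) \<notin> (Restr E (F \<union> L))\<^sup>*"
        using Y0 by simp_all
      obtain c d where cd: "Y = {c, d}" "c \<noteq> d" using Y(3) by (auto simp: card_2_iff)
      \<comment> \<open>Clusters that meet the connected set \<open>L\<close> contain it, hence
        coincide; so one of the two misses \<open>L\<close>.\<close>
      have "\<exists>y\<in>Y. cluster (F \<union> L) y \<inter> L = {}"
      proof (rule ccontr)
        assume no: "\<not> ?thesis"
        have abs: "L \<subseteq> cluster (F \<union> L) y" if "y \<in> Y" for y
          using no that L(4) by (intro conn_set_subset_cluster) auto
        have "a \<in> L" using ab(1) K(4) L(3) by blast
        then have "a \<in> cluster (F \<union> L) c" "a \<in> cluster (F \<union> L) d" using abs cd(1) by blast+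
        then have "cluster (F \<union> L) c = cluster (F \<union> L) d"
          using cluster_eq_if_meet by blast
        then have "d \<in> cluster (F \<union> L) c" using cluster_self by blast
        then have "(c, d) \<in> (Restr E (F \<union> L))\<^sup>*" by (simp add: cluster_def)
        then show False using Y(5) cd by blast
      qed
      then obtain y where y: "y \<in> Y" "cluster (F \<union> L) y \<inter> L = {}" by blast
      have yF: "y \<in> F \<union> L - {}" using Y(4)[OF y(1)] by blast
      have yL: "y \<in> F" "y \<notin> L" using yF y(2) cluster_self[of y "F \<union> L"] by blast+
      have "cluster (F \<union> L - L) y = cluster (F \<union> L - {}) y"
        by (rule cluster_eq_Diff) (use y yF in auto)
      then have "cluster (F \<union> L) y = cluster (F - L) y" by (simp add: Un_Diff)
      moreover have "cluster (F - L) y \<subseteq> cluster F y" by (rule cluster_mono) blast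
      moreover have "cluster F y \<subseteq> cluster (F \<union> L) y" by (rule cluster_mono) blast
      ultimately have cy: "cluster F y = cluster (F \<union> L) y" by blast
      have inf: "infinite (cluster F y)" unfolding cy using Y(4)[OF y(1)] by blast
      have sep: "(y, x) \<notin> (Restr E F)\<^sup>*" if "x \<in> X" for x
      proof
        assume "(y, x) \<in> (Restr E F)\<^sup>*"
        then have "x \<in> cluster (F \<union> L) y" using cy by (auto simp: cluster_def)
        moreover have "x \<in> L" using that K(4) L(3) by blast
        ultimately show False using y(2) by blast
      qed
      have "separated 3 F"
        unfolding separated_def
      proof (intro bexI[of _ "insert y X"] conjI)
        have "y \<notin> X" using sep by blast
        then show "card (insert y X) = 3" using X(1,3) by simp
        show "insert y X \<in> {X. finite X \<and> X \<subseteq> V}" using X(1,2) yL F by auto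
        show "\<forall>x\<in>insert y X. x \<in> F \<and> infinite (cluster F x)" using X(4) yL inf by blast
        show "\<forall>x\<in>insert y X. \<forall>z\<in>insert y X. x \<noteq> z \<longrightarrow> (x, z) \<notin> (Restr E F)\<^sup>*"
          using X(5) sep Restr_sym by blast
      qed
      with elim(3) show False by simp
    qed
    then show False by simp
  qed
  show ?thesis
  proof (cases "AE F in \<mu>. separated 1 F")
    case True
    then have "AE F in \<mu>. separated 1 F \<and> \<not> separated 2 F" using no2 by eventually_elim simp
    then show ?thesis ..
  next
    case False
    then show ?thesis using erg[of 1] by blast
  qed
qed

end

section \<open>The vacant set\<close>

context interlacement
begin

text \<open>Iterates \<open>AE_insert\<close> as a predicate on configurations: \<open>Q\<close>
  survives up to \<open>n\<close> insertions, each next to an occupied vertex. As this holds for all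
  \<open>n\<close> on one almost sure event, the inserted set may depend on the
  configuration.\<close>

fun insertions :: "nat \<Rightarrow> ('v set \<Rightarrow> bool) \<Rightarrow> 'v set \<Rightarrow> bool" where
  "insertions 0 Q F \<longleftrightarrow> Q F"
| "insertions (Suc n) Q F \<longleftrightarrow> insertions n Q F \<and> (\<forall>y\<in>V. \<forall>x\<in>E `` {y}. y \<in> F \<longrightarrow> insertions n Q (insert x F))"

lemma pred_insertions:
  assumes Q: "Measurable.pred Conf Q"
  shows "Measurable.pred Conf (insertions n Q)"
proof (induction n)
  case 0
  then show ?case using Q by (simp cong: measurable_cong)
next
  case (Suc n)
  have "Measurable.pred Conf (\<lambda>F. \<forall>y\<in>V. \<forall>x\<in>E `` {y}. y \<in> F \<longrightarrow> insertions n Q (insert x F))"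
  proof (intro pred_ball_countable countable_V countable_finite finite_nbs)
    fix y x assume "y \<in> V" "x \<in> E `` {y}"
    then have "{x} \<subseteq> V" using E_in_V by auto
    then have "(\<lambda>F. F \<union> {x}) \<in> Conf \<rightarrow>\<^sub>M Conf"
      by (intro measurable_Conf_Un measurable_Conf_const) auto
    from pred_compose_Conf[OF Suc this] have [measurable]: "Measurable.pred Conf (\<lambda>F. insertions n Q (insert x F))"
      by simp
    show "Measurable.pred Conf (\<lambda>F. y \<in> F \<longrightarrow> insertions n Q (insert x F))" by measurable
  qed
  note [measurable] = this Suc
  show ?case unfolding insertions.simps[abs_def] by measurable
qed

lemma AE_insertions:
  assumes Q: "Measurable.pred Conf Q" "AE F in \<mu>. Q F"
  shows "AE F in \<mu>. \<forall>n. insertions n Q F"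
proof -
  have "AE F in \<mu>. insertions n Q F" for n
  proof (induction n)
    case 0
    then show ?case using Q(2) by simp
  next
    case (Suc n)
    have "AE F in \<mu>. \<forall>y\<in>V. \<forall>x\<in>E `` {y}. y \<in> F \<longrightarrow> insertions n Q (insert x F)"
    proof (subst AE_ball_countable[OF countable_V], intro ballI, subst AE_ball_countable[OF countable_finite[OF finite_nbs]], intro ballI)
      fix y x assume "y \<in> V" "x \<in> E `` {y}"
      then show "AE F in \<mu>. y \<in> F \<longrightarrow> insertions n Q (insert x F)"
        by (intro AE_insert pred_insertions Q(1) Suc) simp
    qed
    with Suc show ?case by eventually_elim simp
  qed
  then show ?thesis by (simp add: AE_all_countable)
qed

text \<open>A path from \<open>F\<close> to a missing point of \<open>R\<close> contains an edge
  from \<open>F\<close> to \<open>R - F\<close>. Inserting its endpoint leaves fewer missing points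
  and keeps all connections.\<close>

lemma insertions_Un:
  assumes "insertions n Q F" "finite R" "card (R - F) \<le> n" "\<forall>x\<in>R. \<exists>y\<in>F. (y, x) \<in> (Restr E (F \<union> R))\<^sup>*"
  shows "Q (F \<union> R)"
  using assms
proof (induction n arbitrary: F)
  case 0
  then have "R \<subseteq> F" by simp
  then show ?case using 0(1) by (simp add: Un_absorb2)
next
  case (Suc n)
  show ?case
  proof (cases "R \<subseteq> F")
    case True
    have "Q F" using Suc.prems(1)
    proof (induction "Suc n" arbitrary: n)
      case (Suc m)
      then show ?case by (cases m) auto
    qed
    then show ?thesis using True by (simp add: Un_absorb2)
  next
    case False
    then obtain x y where x: "x \<in> R - F" and y: "y \<in> F" "(y, x) \<in> (Restr E (F \<union> R))\<^sup>*"
      using Suc.prems(4) by blast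
    have "\<exists>a b. a \<in> F \<and> b \<in> R - F \<and> (a, b) \<in> E"
      using y(2,1)
    proof (induction rule: converse_rtrancl_induct)
      case (step y z)
      then show ?case by (cases "z \<in> F") auto
    qed (use x in auto)
    then obtain a b where ab: "a \<in> F" "b \<in> R - F" "(a, b) \<in> E" by blast
    have eq: "insert b F \<union> R = F \<union> R" using ab(2) by auto
    have "Q (insert b F \<union> R)"
    proof (rule Suc.IH)
      show "insertions n Q (insert b F)" using Suc.prems(1) ab E_in_V by auto
      have "R - insert b F = (R - F) - {b}" by blast
      then show "card (R - insert b F) \<le> n"
        using Suc.prems(2,3) ab(2) by (simp add: card_Diff_singleton)
      show "\<forall>x\<in>R. \<exists>y\<in>insert b F. (y, x) \<in> (Restr E (insert b F \<union> R))\<^sup>*"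
        unfolding eq using Suc.prems(4) by blast
    qed (rule Suc.prems(2))
    then show ?thesis unfolding eq .
  qed
qed

lemma AE_insert_connected:
  assumes Q: "Measurable.pred Conf Q" "AE F in \<mu>. Q F"
  shows "AE F in \<mu>. \<forall>R. finite R \<longrightarrow> (\<forall>x\<in>R. \<exists>y\<in>F. (y, x) \<in> (Restr E (F \<union> R))\<^sup>*) \<longrightarrow> Q (F \<union> R)"
  using AE_insertions[OF Q]
proof eventually_elim
  case (elim F)
  show ?case
  proof (intro allI impI)
    fix R assume "finite R" "\<forall>x\<in>R. \<exists>y\<in>F. (y, x) \<in> (Restr E (F \<union> R))\<^sup>*"
    then show "Q (F \<union> R)"
      using elim by (intro insertions_Un[of "card (R - F)" Q F R]) auto
  qed
qed

section \<open>Connectedness of the interlacement\<close>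

lemma AE_interlacement_infinite: "AE F in \<mu>. infinite F"
proof -
  have "AE F in \<mu>. \<forall>x\<in>V. x \<in> F \<longrightarrow> infinite (cluster F x)"
    by (subst AE_ball_countable[OF countable_V]) (intro ballI AE_infinite_cluster)
  with AE_meets_infinite[OF subset_refl infinite_V] show ?thesis
  proof eventually_elim
    case (elim F)
    then obtain x where "x \<in> F" "infinite (cluster F x)" by blast
    then show ?case using cluster_subset finite_subset by blast
  qed
qed

text \<open>The merging hypothesis holds with \<open>L = K\<close>, since a connected set that meets
  \<open>F\<close> can be inserted point by point. All clusters are infinite and there is at least
  one, so uniqueness of the infinite cluster is connectedness.\<close>

lemma AE_interlacement_connected:
  assumes "amenable V E"
  shows "AE F in \<mu>. \<forall>y\<in>F. \<forall>z\<in>F. (y, z) \<in> (Restr E F)\<^sup>*"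
proof -
  have inf: "AE F in \<mu>. \<forall>x\<in>V. x \<in> F \<longrightarrow> infinite (cluster F x)"
    by (subst AE_ball_countable[OF countable_V]) (intro ballI AE_infinite_cluster)
  have "(AE F in \<mu>. \<not> separated 1 F) \<or> (AE F in \<mu>. separated 1 F \<and> \<not> separated 2 F)"
  proof (rule zero_or_one_infinite_cluster[OF assms])
    fix Q assume "Measurable.pred Conf Q" "AE F in \<mu>. Q F"
    from AE_insert_connected[OF this]
    show "AE F in \<mu>. \<forall>K. finite K \<longrightarrow> K \<subseteq> V \<longrightarrow> conn_set K \<longrightarrow> K \<inter> F \<noteq> {} \<longrightarrow>
        (\<exists>L. finite L \<and> L \<subseteq> V \<and> K \<subseteq> L \<and> conn_set L \<and> Q (F \<union> L))"
    proof eventually_elim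
      case (elim F)
      show ?case
      proof (intro allI impI)
        fix K assume K: "finite K" "K \<subseteq> V" "conn_set K" "K \<inter> F \<noteq> {}"
        then obtain y where y: "y \<in> K" "y \<in> F" by blast
        have "(y, x) \<in> (Restr E (F \<union> K))\<^sup>*" if "x \<in> K" for x
        proof (rule Restr_mono)
          show "(y, x) \<in> (Restr E K)\<^sup>*" using K(3) y(1) that unfolding conn_set_def by simp
        qed blast
        then have "\<forall>x\<in>K. \<exists>y\<in>F. (y, x) \<in> (Restr E (F \<union> K))\<^sup>*" using y(2) by blast
        with elim K(1) have "Q (F \<union> K)" by blast
        then show "\<exists>L. finite L \<and> L \<subseteq> V \<and> K \<subseteq> L \<and> conn_set L \<and> Q (F \<union> L)"
          using K by (intro exI[of _ K]) simp
      qed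
    qed
  qed
  moreover have "\<not> (AE F in \<mu>. \<not> separated 1 F)"
  proof
    assume "AE F in \<mu>. \<not> separated 1 F"
    with inf AE_meets_infinite[OF subset_refl infinite_V] have "AE F in \<mu>. False"
    proof eventually_elim
      case (elim F)
      then obtain x where "x \<in> V" "x \<in> F" "infinite (cluster F x)" by blast
      then have "separated 1 F" unfolding separated_def by (intro bexI[of _ "{x}"]) auto
      with elim(3) show ?case by simp
    qed
    then show False by simp
  qed
  ultimately have "AE F in \<mu>. separated 1 F \<and> \<not> separated 2 F" by blast
  then show ?thesis using inf AE_space
  proof eventually_elim
    case (elim F)
    then have F: "F \<subseteq> V" by simp
    show ?case
    proof (intro ballI)
      fix y z assume yz: "y \<in> F" "z \<in> F"
      then have "infinite (cluster F y)" "infinite (cluster F z)" using elim(2) F by blast+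
      then show "(y, z) \<in> (Restr E F)\<^sup>*"
        using one_infinite_cluster[OF F] elim(1) yz by blast
    qed
  qed
qed

section \<open>Deleting finite connected sets\<close>

lemma AE_delete_set:
  assumes K: "finite K" "K \<subseteq> V" and Q: "Measurable.pred Conf Q" "AE F in \<mu>. Q F" and am: "amenable V E"
  shows "AE F in \<mu>. delete_set K Q F"
  using K
proof (induction K rule: finite_induct)
  case empty
  show ?case using Q(2)
  proof eventually_elim
    case (elim F)
    then show ?case unfolding delete_set_def by (intro bexI[of _ "{}"]) auto
  qed
next
  case (insert x K)
  have "AE F in \<mu>. delete_set {x} (delete_set K Q) F"
    using insert by (intro AE_delete pred_delete_set Q(1) AE_interlacement_connected[OF am]) auto
  then show ?case
  proof eventually_elim
    case (elim F)
    then obtain W W' where W: "finite W" "W \<subseteq> V" "{x} \<subseteq> W" "finite W'" "W' \<subseteq> V" "K \<subseteq> W'" "Q (F - W - W')"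
      unfolding delete_set_def by blast
    have "F - W - W' = F - (W \<union> W')" by blast
    then show ?case unfolding delete_set_def using W by (intro bexI[of _ "W \<union> W'"]) auto
  qed
qed

text \<open>After deleting a finite set \<open>W\<close> containing \<open>K\<close>, reinsert the points of \<open>W\<close> which are still
  connected to the rest outside \<open>K\<close>.  As \<open>F\<close> is connected, all remaining deleted points are
  connected to \<open>K\<close> by deleted points.\<close>

lemma reinsert:
  assumes F: "F \<subseteq> V" "infinite F" and conn: "\<forall>y\<in>F. \<forall>z\<in>F. (y, z) \<in> (Restr E F)\<^sup>*"
    and K: "conn_set K" "K \<noteq> {}" and W: "finite W" "W \<subseteq> V" "K \<subseteq> W"
  obtains R L where "finite R" "\<forall>x\<in>R. \<exists>y\<in>F - W. (y, x) \<in> (Restr E (F - W \<union> R))\<^sup>*"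
    "finite L" "L \<subseteq> V" "K \<subseteq> L" "conn_set L" "V - (F - W \<union> R) = (V - F) \<union> L"
proof -
  define R where "R = {x \<in> (F - K) \<inter> W. \<exists>y\<in>F - W. (y, x) \<in> (Restr E (F - K))\<^sup>*}"
  define G where "G = F - W \<union> R"
  define L where "L = K \<union> (F - G)"
  have GF: "G \<subseteq> F - K" using W(3) by (auto simp: G_def R_def)
  have closed: "cluster (F - K) y \<subseteq> G" if y: "y \<in> F - W" for y
  proof
    fix x assume x: "x \<in> cluster (F - K) y"
    have "y \<in> F - K" using y W(3) by blast
    then have "x \<in> F - K" using x cluster_subset by blast
    then show "x \<in> G" using x y by (auto simp: G_def R_def cluster_def)
  qed
  have fin: "finite R" "finite L"
  proof -
    show "finite R" by (rule finite_subset[OF _ W(1)]) (auto simp: R_def)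
    show "finite L" by (rule finite_subset[OF _ W(1)]) (use W(3) in \<open>auto simp: L_def G_def\<close>)
  qed
  have R: "\<forall>x\<in>R. \<exists>y\<in>F - W. (y, x) \<in> (Restr E (F - W \<union> R))\<^sup>*"
  proof
    fix x assume "x \<in> R"
    then obtain y where y: "y \<in> F - W" "x \<in> cluster (F - K) y" by (auto simp: R_def cluster_def)
    have yK: "y \<in> F - K" using y(1) W(3) by blast
    have "(y, x) \<in> (Restr E (cluster (F - K) y))\<^sup>*"
      using conn_set_cluster[OF yK] y(2) cluster_self by (auto simp: conn_set_def)
    then have "(y, x) \<in> (Restr E G)\<^sup>*" by (rule Restr_mono[OF closed[OF y(1)]])
    then show "\<exists>y\<in>F - W. (y, x) \<in> (Restr E (F - W \<union> R))\<^sup>*" using y(1) unfolding G_def by blast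
  qed
  have toK: "\<exists>k\<in>K. (p, k) \<in> (Restr E L)\<^sup>*" if p: "p \<in> L" for p
  proof (cases "p \<in> K")
    case False
    then have pFG: "p \<in> F - K" "p \<notin> G" using p by (auto simp: L_def)
    have disj: "cluster (F - K) p \<inter> (F - W) = {}"
    proof (rule ccontr)
      assume "cluster (F - K) p \<inter> (F - W) \<noteq> {}"
      then obtain q where q: "q \<in> cluster (F - K) p" "q \<in> F - W" by blast
      have "p \<in> cluster (F - K) q" unfolding cluster_eq[OF q(1)] by (rule cluster_self)
      then show False using closed[OF q(2)] pFG(2) by blast
    qed
    have sub: "cluster (F - K) p \<subseteq> L"
    proof
      fix c assume c: "c \<in> cluster (F - K) p"
      have "c \<in> F - K" using c cluster_subset[OF pFG(1)] by blast
      moreover have "c \<notin> G"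
      proof
        assume "c \<in> G"
        moreover have "c \<notin> F - W" using c disj by blast
        ultimately have "c \<in> R" unfolding G_def by blast
        then obtain y where y: "y \<in> F - W" "c \<in> cluster (F - K) y" by (auto simp: R_def cluster_def)
        have "cluster (F - K) p = cluster (F - K) y"
          by (rule cluster_eq_if_meet) (use c y(2) in blast)
        then have "y \<in> cluster (F - K) p" using cluster_self by simp
        then show False using y(1) disj by blast
      qed
      ultimately show "c \<in> L" by (simp add: L_def)
    qed
    have "F - W \<noteq> {}" using Diff_infinite_finite[OF W(1) F(2)] by (rule infinite_imp_nonempty)
    then obtain q where q: "q \<in> F - W" by blast
    \<comment> \<open>Otherwise \<open>F - K = F\<close>, and connectedness of \<open>F\<close>
      joins \<open>p\<close> to \<open>q\<close>, a point that was not deleted.\<close>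
    have "K \<inter> F \<noteq> {}"
    proof
      assume "K \<inter> F = {}"
      then have "F - K = F" by blast
      then have "q \<in> cluster (F - K) p" using conn pFG(1) q by (simp add: cluster_def)
      then show False using disj q by blast
    qed
    then obtain l where l: "l \<in> K" "l \<in> F" by blast
    have "(p, l) \<in> (Restr E F)\<^sup>*" using conn pFG(1) l(2) by blast
    from exit_path[OF this l(1) pFG(1)] obtain a k where
      a: "(p, a) \<in> (Restr E (F - K))\<^sup>*" "k \<in> K" "(a, k) \<in> E" by blast
    have "a \<in> cluster (F - K) p" using a(1) by (simp add: cluster_def)
    then have "(p, a) \<in> (Restr E (cluster (F - K) p))\<^sup>*" "a \<in> L"
      using conn_set_cluster[OF pFG(1)] cluster_self sub by (auto simp: conn_set_def)
    then have "(p, a) \<in> (Restr E L)\<^sup>*" "(a, k) \<in> Restr E L"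
      using Restr_mono[OF sub] a by (auto simp: L_def)
    then show ?thesis using a(2) rtrancl_into_rtrancl by metis
  qed blast
  have "conn_set L"
    unfolding conn_set_def
  proof (intro ballI)
    fix p q assume "p \<in> L" "q \<in> L"
    then obtain k k' where k: "k \<in> K" "(p, k) \<in> (Restr E L)\<^sup>*" "k' \<in> K" "(q, k') \<in> (Restr E L)\<^sup>*"
      using toK by metis
    have "(k, k') \<in> (Restr E L)\<^sup>*"
    proof (rule Restr_mono)
      show "(k, k') \<in> (Restr E K)\<^sup>*" using K(1) k(1,3) unfolding conn_set_def by simp
    qed (simp add: L_def)
    then show "(p, q) \<in> (Restr E L)\<^sup>*"
      using k(2) Restr_sym[OF k(4)] by (meson rtrancl_trans)
  qed
  moreover have "V - G = (V - F) \<union> L"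
    using GF F(1) W(2,3) by (auto simp: L_def)
  moreover have "L \<subseteq> V" "K \<subseteq> L" using F(1) W(2,3) by (auto simp: L_def)
  ultimately show ?thesis using fin R by (intro that[of R L]) (simp_all only: G_def)
qed

section \<open>The law of the vacant set\<close>

lemma measurable_vacant: "(\<lambda>F. V - F) \<in> Conf \<rightarrow>\<^sub>M Conf"
  using measurable_Conf_const[of V] by (intro measurable_Conf_Diff) auto

lemma measurable_vacant': "(\<lambda>F. V - F) \<in> \<mu> \<rightarrow>\<^sub>M Conf"
  using measurable_vacant by (simp only: measurable_cong_sets[OF sets_mu refl])

lemma AE_vacant:
  "Measurable.pred Conf P \<Longrightarrow> (AE F in distr \<mu> Conf (\<lambda>F. V - F). P F) \<longleftrightarrow> (AE F in \<mu>. P (V - F))"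
  by (rule AE_distr_iff[OF measurable_vacant']) (simp add: pred_def)

lemma vacant_aut: "aut f \<Longrightarrow> F \<subseteq> V \<Longrightarrow> f ` (V - F) = V - f ` F"
  using aut_image_V by (simp add: image_set_diff aut_inj)

text \<open>Taking complements commutes with automorphisms, so invariance and ergodicity pass from
  the interlacement to the vacant set.\<close>

lemma ergodic_vacant: "ergodic_conf V E (distr \<mu> Conf (\<lambda>F. V - F))" (is "ergodic_conf V E ?\<nu>")
proof (intro ergodic_conf.intro invariant_conf.intro random_conf.intro random_conf_axioms.intro
    invariant_conf_axioms.intro ergodic_conf_axioms.intro vt_graph_axioms)
  have vac: "(\<lambda>F. V - F) \<in> \<mu> \<rightarrow>\<^sub>M Conf" by (rule measurable_vacant')
  show "prob_space ?\<nu>" by (rule prob_space_distr[OF vac])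
  show "sets ?\<nu> = sets Conf" by simp
  show "distr ?\<nu> Conf ((`) f) = ?\<nu>" if f: "aut f" for f
  proof -
    have m: "(`) f \<in> \<mu> \<rightarrow>\<^sub>M Conf"
      using measurable_Conf_aut[OF f] by (simp only: measurable_cong_sets[OF sets_mu refl])
    have "distr ?\<nu> Conf ((`) f) = distr \<mu> Conf ((`) f \<circ> (\<lambda>F. V - F))"
      by (rule distr_distr[OF measurable_Conf_aut[OF f] vac])
    also have "\<dots> = distr \<mu> Conf ((\<lambda>F. V - F) \<circ> (`) f)"
      by (rule distr_cong) (simp_all add: vacant_aut[OF f])
    also have "\<dots> = distr (distr \<mu> Conf ((`) f)) Conf (\<lambda>F. V - F)"
      by (rule distr_distr[OF measurable_vacant m, symmetric])
    also have "\<dots> = ?\<nu>" by (simp only: invariant[OF f])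
    finally show ?thesis .
  qed
  fix P assume P: "Measurable.pred Conf P"
    and inv: "\<And>f F. aut f \<Longrightarrow> F \<subseteq> V \<Longrightarrow> P (f ` F) = P F"
  have P': "Measurable.pred Conf (\<lambda>F. \<not> P F)" using P by measurable
  have "(AE F in \<mu>. P (V - F)) \<or> (AE F in \<mu>. \<not> P (V - F))"
  proof (rule ergodicity)
    show "Measurable.pred Conf (\<lambda>F. P (V - F))" by (rule pred_compose_Conf[OF P measurable_vacant])
    show "P (V - f ` F) = P (V - F)" if "aut f" "F \<subseteq> V" for f F
      using inv[OF that(1), of "V - F"] vacant_aut[OF that] by auto
  qed
  then show "(AE F in ?\<nu>. P F) \<or> (AE F in ?\<nu>. \<not> P F)"
    by (simp only: AE_vacant[OF P] AE_vacant[OF P'])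
qed

text \<open>Verifies the merging hypothesis for the law of the vacant set. Adding vacant points
  means deleting occupied ones; the deletion may remove too much, and \<open>reinsert\<close>
  returns the surplus so that the vacant set grows by a connected set.\<close>

lemma vacant_zero_or_one:
  assumes am: "amenable V E"
  shows "(AE F in \<mu>. \<not> separated 1 (V - F)) \<or> (AE F in \<mu>. separated 1 (V - F) \<and> \<not> separated 2 (V - F))"
proof -
  let ?\<nu> = "distr \<mu> Conf (\<lambda>F. V - F)"
  interpret vac: ergodic_conf V E ?\<nu> by (rule ergodic_vacant)
  have "(AE F in ?\<nu>. \<not> separated 1 F) \<or> (AE F in ?\<nu>. separated 1 F \<and> \<not> separated 2 F)"
  proof (rule vac.zero_or_one_infinite_cluster[OF am])
    fix Q assume Q: "Measurable.pred Conf Q" "AE F in ?\<nu>. Q F"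
    have Q': "Measurable.pred Conf (\<lambda>F. Q (V - F))" "AE F in \<mu>. Q (V - F)"
      using pred_compose_Conf[OF Q(1) measurable_vacant] Q(2) AE_vacant[OF Q(1)] by auto
    \<comment> \<open>The property fed into the deletion says that all admissible insertions are
      good, so the surplus can still be put back after the deletion.\<close>
    have ins: "Measurable.pred Conf (\<lambda>F. \<forall>n. insertions n (\<lambda>F. Q (V - F)) F)"
      using pred_insertions[OF Q'(1)] by (rule pred_intros_countable)
    have "AE F in \<mu>. \<forall>K\<in>{K. finite K \<and> K \<subseteq> V}. delete_set K (\<lambda>F. \<forall>n. insertions n (\<lambda>F. Q (V - F)) F) F"
      by (subst AE_ball_countable[OF countable_Collect_finite_subset[OF countable_V]])
        (use AE_delete_set[OF _ _ ins AE_insertions[OF Q'] am] in blast)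
    then have merged: "AE F in \<mu>. \<forall>K. finite K \<longrightarrow> K \<subseteq> V \<longrightarrow> conn_set K \<longrightarrow> K \<inter> (V - F) \<noteq> {} \<longrightarrow>
        (\<exists>L. finite L \<and> L \<subseteq> V \<and> K \<subseteq> L \<and> conn_set L \<and> Q ((V - F) \<union> L))"
      using AE_interlacement_connected[OF am] AE_interlacement_infinite AE_space
    proof eventually_elim
      case (elim F)
      show ?case
      proof (intro allI impI)
        fix K assume K: "finite K" "K \<subseteq> V" "conn_set K" "K \<inter> (V - F) \<noteq> {}"
        have "delete_set K (\<lambda>F. \<forall>n. insertions n (\<lambda>F. Q (V - F)) F) F" using elim(1) K(1,2) by blast
        then obtain W where W: "finite W" "W \<subseteq> V" "K \<subseteq> W" "\<forall>n. insertions n (\<lambda>F. Q (V - F)) (F - W)"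
          unfolding delete_set_def by blast
        have F: "F \<subseteq> V" using elim(4) by simp
        have Kne: "K \<noteq> {}" using K(4) by blast
        obtain R L where R: "finite R" "\<forall>x\<in>R. \<exists>y\<in>F - W. (y, x) \<in> (Restr E (F - W \<union> R))\<^sup>*"
          and L: "finite L" "L \<subseteq> V" "K \<subseteq> L" "conn_set L" "V - (F - W \<union> R) = (V - F) \<union> L"
          using reinsert[OF F elim(3,2) K(3) Kne W(1-3)] by metis
        have "Q (V - (F - W \<union> R))"
          using insertions_Un[OF W(4)[rule_format, of "card (R - (F - W))"] R(1) _ R(2)] by simp
        then have "Q ((V - F) \<union> L)" unfolding L(5) .
        then show "\<exists>L. finite L \<and> L \<subseteq> V \<and> K \<subseteq> L \<and> conn_set L \<and> Q ((V - F) \<union> L)"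
          using L(1-4) by blast
      qed
    qed
    \<comment> \<open>Stated with quantifiers over countably many finite sets, the property is
      measurable and can be transferred to the law of the vacant set.\<close>
    have P: "Measurable.pred Conf (\<lambda>F. \<forall>K\<in>{K. finite K \<and> K \<subseteq> V}. conn_set K \<longrightarrow> K \<inter> F \<noteq> {} \<longrightarrow>
        (\<exists>L\<in>{L. finite L \<and> L \<subseteq> V}. K \<subseteq> L \<and> conn_set L \<and> Q (F \<union> L)))" (is "Measurable.pred Conf ?P")
    proof (rule pred_ball_countable[OF countable_Collect_finite_subset[OF countable_V]])
      fix K assume K: "K \<in> {K. finite K \<and> K \<subseteq> V}"
      have [measurable]: "Measurable.pred Conf (\<lambda>F. \<exists>L\<in>{L. finite L \<and> L \<subseteq> V}. K \<subseteq> L \<and> conn_set L \<and> Q (F \<union> L))"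
      proof (rule pred_bex_countable[OF countable_Collect_finite_subset[OF countable_V]])
        fix L assume "L \<in> {L. finite L \<and> L \<subseteq> V}"
        then have "(\<lambda>F. F \<union> L) \<in> Conf \<rightarrow>\<^sub>M Conf"
          by (intro measurable_Conf_Un measurable_Conf_const) auto
        note [measurable] = pred_compose_Conf[OF Q(1) this]
        show "Measurable.pred Conf (\<lambda>F. K \<subseteq> L \<and> conn_set L \<and> Q (F \<union> L))" by measurable
      qed
      have [measurable]: "Measurable.pred Conf (\<lambda>F. K \<inter> F \<noteq> {})"
      proof -
        have "Measurable.pred Conf (\<lambda>F. \<exists>x\<in>K. x \<in> F)"
          using K by (intro pred_intros_finite) auto
        moreover have "K \<inter> F \<noteq> {} \<longleftrightarrow> (\<exists>x\<in>K. x \<in> F)" for F by blast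
        ultimately show ?thesis by simp
      qed
      show "Measurable.pred Conf (\<lambda>F. conn_set K \<longrightarrow> K \<inter> F \<noteq> {} \<longrightarrow>
          (\<exists>L\<in>{L. finite L \<and> L \<subseteq> V}. K \<subseteq> L \<and> conn_set L \<and> Q (F \<union> L)))" by measurable
    qed
    from merged have "AE F in \<mu>. ?P (V - F)" by eventually_elim (simp add: Bex_def conj_assoc)
    then have "AE F in ?\<nu>. ?P F" unfolding AE_vacant[OF P] .
    then show "AE F in ?\<nu>. \<forall>K. finite K \<longrightarrow> K \<subseteq> V \<longrightarrow> conn_set K \<longrightarrow> K \<inter> F \<noteq> {} \<longrightarrow>
        (\<exists>L. finite L \<and> L \<subseteq> V \<and> K \<subseteq> L \<and> conn_set L \<and> Q (F \<union> L))"
      by eventually_elim (simp add: Bex_def conj_assoc)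
  qed
  moreover have "Measurable.pred Conf (\<lambda>F. \<not> separated 1 F)" "Measurable.pred Conf (\<lambda>F. separated 1 F \<and> \<not> separated 2 F)"
    using pred_separated[of 1] pred_separated[of 2] by measurable
  ultimately show ?thesis by (simp only: AE_vacant)
qed

end

theorem theorem1p1:
  fixes V :: "'v set" and E :: "('v \<times> 'v) set"
    and u :: real and M :: "'w measure" and I :: "'w \<Rightarrow> 'v set"
  assumes "graph V E" and "connected_graph V E" and "locally_finite V E" and "infinite V"
    and "vertex_transitive V E" and "amenable V E" and "transient_graph V E"
    and "u > 0" and "random_interlacement V E u M I"
  shows "(AE \<omega> in M. num_infinite_components E (V - I \<omega>) = 0) \<or>
         (AE \<omega> in M. num_infinite_components E (V - I \<omega>) = 1)"
proof -
  interpret transient_vt_graph V E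
    using assms by unfold_locales
  have M: "prob_space M" and I: "I \<in> M \<rightarrow>\<^sub>M Conf"
    and law: "\<And>K. K \<subseteq> V \<Longrightarrow> finite K \<Longrightarrow> measure M {\<omega> \<in> space M. I \<omega> \<inter> K = {}} = exp (- u * capacity E K)"
    using assms(9) by (auto simp: random_interlacement_def)
  have IV: "I \<omega> \<subseteq> V" if "\<omega> \<in> space M" for \<omega>
    using measurable_space[OF I that] by simp
  \<comment> \<open>The argument runs on the law of \<open>I\<close>; the conclusion is pulled back
    to \<open>M\<close> at the end.\<close>
  interpret interlacement V E "distr M Conf I" u
  proof (intro interlacement.intro random_conf.intro random_conf_axioms.intro interlacement_axioms.intro
      vt_graph_axioms transient_vt_graph_axioms)
    show "prob_space (distr M Conf I)" by (rule prob_space.prob_space_distr[OF M I])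
    show "measure (distr M Conf I) (missing K) = exp (- u * capacity E K)" if K: "K \<subseteq> V" "finite K" for K
    proof -
      have "measure (distr M Conf I) (missing K) = measure M (I -` missing K \<inter> space M)"
        by (rule measure_distr[OF I missing_in_sets[OF K]])
      also have "I -` missing K \<inter> space M = {\<omega> \<in> space M. I \<omega> \<inter> K = {}}"
        using IV by (auto simp: missing_def)
      finally show ?thesis using law[OF K] by simp
    qed
  qed (use assms(8) in auto)
  have transfer: "AE \<omega> in M. P (I \<omega>)" if "AE F in distr M Conf I. P F" for P
    by (rule AE_distrD[OF I that])
  show ?thesis
  proof (rule disjE[OF vacant_zero_or_one[OF assms(6)]])
    assume "AE F in distr M Conf I. \<not> separated 1 (V - F)"
    from transfer[OF this] have "AE \<omega> in M. num_infinite_components E (V - I \<omega>) = 0"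
      by eventually_elim (rule num_infinite_components_0[OF Diff_subset])
    then show ?thesis ..
  next
    assume "AE F in distr M Conf I. separated 1 (V - F) \<and> \<not> separated 2 (V - F)"
    from transfer[OF this] have "AE \<omega> in M. num_infinite_components E (V - I \<omega>) = 1"
      by eventually_elim (intro num_infinite_components_1[OF Diff_subset], simp_all)
    then show ?thesis ..
  qed
qed

end
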